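(* Let $N\ge1$, $s\in(0,1)$, and let $\Omega\subseteq\mathbb{R}^N$ be an open set with continuous boundary (as defined in the context). Let $G_{x,y}$ be as in the context, satisfying $(g_1)$–$(g_4)$, $(H_1)$, $(H_2)$ and $\mathcal{B}_f$. Then $C_0^\infty(\Omega)$ is dense in $W_0^{s,G_{x,y}}(\Omega)$ with respect to the norm $\|\cdot\|_{W^{s,G_{x,y}}(\mathbb{R}^N)}$.
   Context: An open set $\Omega\subseteq\mathbb{R}^N$ has continuous boundary if $\partial\Omega$ is compact and there exist $M\in\mathbb{N}$, open sets $W_1,\dots,W_M$, sets $\Omega_1,\dots,\Omega_M\subseteq\mathbb{R}^N$, continuous functions $\xi_1,\dots,\xi_M:\mathbb{R}^{N-1}\to\mathbb{R}$ and rigid motions $\mathscr R_1,\dots,\mathscr R_M$ of $\mathbb{R}^N$ such that $\partial\Omega\subseteq\bigcup_j W_j$, $\mathscr R_j(\Omega_j)=\{(x',x_N): x_N<\xi_j(x')\}$, and $W_j\cap\Omega=W_j\cap\Omega_j$ for each $j$. Let $G:\mathbb{R}^N\times\mathbb{R}^N\times[0,\infty)\to[0,\infty)$ be a Carathéodory function given by $G_{x,y}(t)=\int_0^t g(x,y,\tau)d\tau$, $g(x,y,t)=a(x,y,t)t$ ($t\ne0$), $g(x,y,0)=0$, where $a\ge0$ satisfies: $(g_1)$ $\lim_{t\to0}a(x,y,t)t=0$, $\lim_{t\to\infty}a(x,y,t)t=\infty$; $(g_2)$ $t\mapsto a(x,y,t)$ continuous on $(0,\infty)$; $(g_3)$ $t\mapsto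 a(x,y,t)t$ increasing; $(g_4)$ $1<g^-\le a(x,y,t)t^2/G_{x,y}(t)\le g^+<\infty$ for all $(x,y)$, $t>0$. $\widehat G_x(t)=G_{x,x}(t)$. $(H_1)$: for every $c>0$ and compact $A$, $\int_{A\times A}G_{x,y}(c)dxdy<\infty$ and $\int_A\widehat G_x(c)dx<\infty$. $(H_2)$: $G(x-z,y-z,t)=G(x,y,t)$ for all $x,y,z$, $t\ge0$. $\mathcal{B}_f$: there are $C_1,C_2>0$ with $C_1\le G_{x,y}(1)\le C_2$ for all $(x,y)$. $L^{\widehat G_x}(U)$: measurable $u$ with $\int_U\widehat G_x(\lambda|u|)dx<\infty$ for some $\lambda>0$, Luxemburg norm $\inf\{\lambda>0:\int_U\widehat G_x(|u|/\lambda)\le1\}$. $J_{s,G}(u)=\int_U\int_U G_{x,y}(|u(x)-u(y)|/|x-y|^s)\,|x-y|^{-N}dxdy$; $W^{s,G_{x,y}}(U)=\{u\in L^{\widehat G_x}(U):J_{s,G}(\lambda u)<\infty\text{ for some }\lambda>0\}$ with norm $\|u\|_{L^{\widehat G_x}(U)}+\inf\{\lambda>0:J_{s,G}(u/\lambda)\le1\}$. $W_0^{s,G_{x,y}}(\Omega)=\{u\in W^{s,G_{x,y}}(\mathbb{R}^N):u=0\text{ a.e. in }\mathbb{R}^N\setminus\Omega\}$. $C_0^\infty(\Omega)$: functions in $C^\infty(\mathbb{R}^N)$ with compact support contained in $\Omega$. *)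

theory Defs
  imports "HOL-Analysis.Analysis"
begin

definition rigid_motion :: "('a::euclidean_space \<Rightarrow> 'a) \<Rightarrow> bool" where
  "rigid_motion R \<longleftrightarrow> (\<forall>x y. dist (R x) (R y) = dist x y)"

text \<open>The subgraph {(x',x_N). x_N < xi(x')}: the distinguished last coordinate is a
  basis vector b; a continuous function of x' in R^(N-1) is encoded as a continuous
  function on R^N that does not depend on the b-component.\<close>
definition subgraph_region :: "'a::euclidean_space \<Rightarrow> ('a \<Rightarrow> real) \<Rightarrow> 'a set" where
  "subgraph_region b xi = {x. x \<bullet> b < xi x}"

definition continuous_boundary :: "'a::euclidean_space set \<Rightarrow> bool" where
  "continuous_boundary \<Omega> \<longleftrightarrow> compact (frontier \<Omega>) \<and>
     (\<exists>(M::nat) W O' xi R b.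
        (\<forall>j<M. open (W j)) \<and>
        frontier \<Omega> \<subseteq> (\<Union>j<M. W j) \<and>
        (\<forall>j<M. b j \<in> Basis \<and> continuous_on UNIV (xi j) \<and>
              (\<forall>x t. xi j (x + t *\<^sub>R b j) = xi j x) \<and>
              rigid_motion (R j) \<and>
              R j ` (O' j) = subgraph_region (b j) (xi j) \<and>
              W j \<inter> \<Omega> = W j \<inter> O' j))"

definition gfun :: "('a \<Rightarrow> 'a \<Rightarrow> real \<Rightarrow> real) \<Rightarrow> 'a \<Rightarrow> 'a \<Rightarrow> real \<Rightarrow> real" where
  "gfun a x y t = (if t = 0 then 0 else a x y t * t)"

definition Gfun :: "('a \<Rightarrow> 'a \<Rightarrow> real \<Rightarrow> real) \<Rightarrow> 'a \<Rightarrow> 'a \<Rightarrow> real \<Rightarrow> real" where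
  "Gfun a x y t = integral {0..t} (gfun a x y)"

definition modular_L :: "('a::euclidean_space \<Rightarrow> 'a \<Rightarrow> real \<Rightarrow> real) \<Rightarrow> 'a set \<Rightarrow> ('a \<Rightarrow> real) \<Rightarrow> ennreal" where
  "modular_L G U u = (\<integral>\<^sup>+ x. indicator U x * ennreal (G x x \<bar>u x\<bar>) \<partial>lebesgue)"

definition in_L :: "('a::euclidean_space \<Rightarrow> 'a \<Rightarrow> real \<Rightarrow> real) \<Rightarrow> 'a set \<Rightarrow> ('a \<Rightarrow> real) \<Rightarrow> bool" where
  "in_L G U u \<longleftrightarrow> u \<in> borel_measurable lebesgue \<and>
      (\<exists>c>0. modular_L G U (\<lambda>x. c * u x) < \<infinity>)"

definition norm_L :: "('a::euclidean_space \<Rightarrow> 'a \<Rightarrow> real \<Rightarrow> real) \<Rightarrow> 'a set \<Rightarrow> ('a \<Rightarrow> real) \<Rightarrow> real" where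
  "norm_L G U u = Inf {c. c > 0 \<and> modular_L G U (\<lambda>x. u x / c) \<le> 1}"

definition J_sG :: "real \<Rightarrow> ('a::euclidean_space \<Rightarrow> 'a \<Rightarrow> real \<Rightarrow> real) \<Rightarrow> 'a set \<Rightarrow> ('a \<Rightarrow> real) \<Rightarrow> ennreal" where
  "J_sG s G U u = (\<integral>\<^sup>+ x. indicator U x * (\<integral>\<^sup>+ y. indicator U y *
       ennreal (G x y (\<bar>u x - u y\<bar> / dist x y powr s) / dist x y ^ DIM('a)) \<partial>lebesgue) \<partial>lebesgue)"

definition in_W :: "real \<Rightarrow> ('a::euclidean_space \<Rightarrow> 'a \<Rightarrow> real \<Rightarrow> real) \<Rightarrow> 'a set \<Rightarrow> ('a \<Rightarrow> real) \<Rightarrow> bool" where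
  "in_W s G U u \<longleftrightarrow> in_L G U u \<and> (\<exists>c>0. J_sG s G U (\<lambda>x. c * u x) < \<infinity>)"

definition norm_W :: "real \<Rightarrow> ('a::euclidean_space \<Rightarrow> 'a \<Rightarrow> real \<Rightarrow> real) \<Rightarrow> 'a set \<Rightarrow> ('a \<Rightarrow> real) \<Rightarrow> real" where
  "norm_W s G U u = norm_L G U u + Inf {c. c > 0 \<and> J_sG s G U (\<lambda>x. u x / c) \<le> 1}"

definition in_W0 :: "real \<Rightarrow> ('a::euclidean_space \<Rightarrow> 'a \<Rightarrow> real \<Rightarrow> real) \<Rightarrow> 'a set \<Rightarrow> ('a \<Rightarrow> real) \<Rightarrow> bool" where
  "in_W0 s G \<Omega> u \<longleftrightarrow> in_W s G UNIV u \<and> (AE x in lebesgue. x \<notin> \<Omega> \<longrightarrow> u x = 0)"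

fun Ck :: "nat \<Rightarrow> ('a::euclidean_space \<Rightarrow> real) \<Rightarrow> bool" where
  "Ck 0 f = continuous_on UNIV f"
| "Ck (Suc k) f = (continuous_on UNIV f \<and> (\<forall>x. f differentiable (at x)) \<and>
      (\<forall>b\<in>Basis. Ck k (\<lambda>x. frechet_derivative f (at x) b)))"

definition smooth_fun :: "('a::euclidean_space \<Rightarrow> real) \<Rightarrow> bool" where
  "smooth_fun f \<longleftrightarrow> (\<forall>k. Ck k f)"

definition C0_infty :: "'a::euclidean_space set \<Rightarrow> ('a \<Rightarrow> real) set" where
  "C0_infty \<Omega> = {f. smooth_fun f \<and> compact (closure {x. f x \<noteq> 0}) \<and> closure {x. f x \<noteq> 0} \<subseteq> \<Omega>}"

end

theory Submission
  imports Defs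
begin

text \<open>By translation invariance \<open>G x y = K (x - y)\<close>, so \<open>u\<close> lies in the space iff two modulars of the form
  \<open>\<Phi> v = \<integral>\<integral> B (x - y) (v x - \<theta> * v y)\<close> with \<open>B z\<close> even, convex and doubling are finite: \<open>\<theta> = 1\<close> gives the
  Gagliardo term, and \<open>\<theta> = 0\<close> with \<open>B z t = indicator (unit cube) z * K 0 \<bar>t\<bar>\<close> gives the zeroth-order term; by doubling,
  modular and norm convergence agree. Since \<open>K 0\<close> need not be comparable to \<open>K z\<close> for \<open>z \<noteq> 0\<close>, truncation comes first:
  \<open>clip M u - clip m u\<close> is bounded with support of finite measure and converges to \<open>u\<close> by dominated convergence,
  and for such functions multiplication by Lipschitz cutoffs is controlled by the tail integral of \<open>B\<close> alone. Cutoffs reduce to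
  functions supported near a single point of the closure of \<open>\<Omega>\<close>, where the subgraph condition allows a small
  shift of the support into \<open>\<Omega>\<close>. Convolving with a mollifier centred at that shift gives a test function, and
  Jensen's inequality bounds the error by the modulus of continuity of translations in \<open>\<Phi>\<close>.\<close>

section \<open>Translations in L1\<close>

text \<open>\<open>K 0\<close> and \<open>K z\<close> are tied together only at
  \<open>t = 1\<close>, by the two-sided bound there; elsewhere one may grow like t to the g^- and
  the other like t to the g^+. For v bounded with support of finite measure the same term is at most
  a constant times min 1 |x - y|. Its modular converges because a growth exponent p = g^- > 0 turns
  |z|^(1-s) near 0 and |z|^(-s) at infinity into integrable powers, uniformly in z by the upper
  bound on \<open>K z 1\<close>.

  Measurability is a second obstacle: for fixed t the integrand is only Lebesgue measurable in (x,
  y). Tonelli is applied to Borel functions, so \<open>u\<close> gets a Borel representative and the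
  kernel a Borel version off a null set of differences.

  Continuity of translations is not deduced from density of smooth functions in the modular space,
  which would come close to the claim itself. It uses almost everywhere convergence of translates,
  obtained from L1. One convolution performs both the shift and the smoothing, so no separate
  estimate for a shifted function appears.\<close>

lemma tendsto_zero_ennreal_iff:
  fixes f :: "'b \<Rightarrow> ennreal"
  shows "(f \<longlongrightarrow> 0) F \<longleftrightarrow> (\<forall>e>0. eventually (\<lambda>x. f x < ennreal e) F)"
proof
  assume "(f \<longlongrightarrow> 0) F"
  then show "\<forall>e>0. eventually (\<lambda>x. f x < ennreal e) F"
    by (auto intro: order_tendstoD(2))
next
  assume *: "\<forall>e>0. eventually (\<lambda>x. f x < ennreal e) F"
  show "(f \<longlongrightarrow> 0) F"
  proof (rule order_tendstoI)
    fix a :: ennreal assume "a < 0" then show "eventually (\<lambda>x. a < f x) F" by simp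
  next
    fix a :: ennreal assume "0 < a"
    then obtain b where b: "0 < b" "b < a" using dense by blast
    then obtain e where e: "b = ennreal e" "e > 0"
      by (cases b) (auto simp: top.extremum_strict ennreal_less_zero_iff)
    show "eventually (\<lambda>x. f x < a) F"
      using *[rule_format, OF e(2)] by eventually_elim (use b e in auto)
  qed
qed

lemma nn_integral_lborel_translation:
  fixes f :: "'a::euclidean_space \<Rightarrow> ennreal"
  assumes [measurable]: "f \<in> borel_measurable borel"
  shows "(\<integral>\<^sup>+x. f (x + c) \<partial>lborel) = (\<integral>\<^sup>+x. f x \<partial>lborel)"
proof -
  have "(\<integral>\<^sup>+x. f x \<partial>lborel) = (\<integral>\<^sup>+x. f x \<partial>distr lborel borel ((+) c))"
    by (simp add: lborel_distr_plus)
  also have "\<dots> = (\<integral>\<^sup>+x. f (c + x) \<partial>lborel)"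
    by (subst nn_integral_distr) auto
  finally show ?thesis by (simp add: add.commute)
qed

lemma nn_integral_lborel_minus_translation:
  fixes f :: "'a::euclidean_space \<Rightarrow> ennreal"
  assumes [measurable]: "f \<in> borel_measurable borel"
  shows "(\<integral>\<^sup>+x. f (x - c) \<partial>lborel) = (\<integral>\<^sup>+x. f x \<partial>lborel)"
  using nn_integral_lborel_translation[of f "-c"] by simp

lemma nn_integral_lborel_reflect:
  fixes f :: "'a::euclidean_space \<Rightarrow> ennreal"
  assumes [measurable]: "f \<in> borel_measurable borel"
  shows "(\<integral>\<^sup>+x. f (c - x) \<partial>lborel) = (\<integral>\<^sup>+x. f x \<partial>lborel)"
proof -
  have "(lborel :: 'a measure) = distr lborel borel (\<lambda>x. c + (-1) *\<^sub>R x)"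
    by (subst lborel_affine[of "-1" c]) (auto simp: density_1)
  then have "(\<integral>\<^sup>+x. f x \<partial>lborel) = (\<integral>\<^sup>+x. f x \<partial>distr lborel borel (\<lambda>x. c + (-1) *\<^sub>R x))"
    by simp
  also have "\<dots> = (\<integral>\<^sup>+x. f (c - x) \<partial>lborel)"
    by (subst nn_integral_distr) auto
  finally show ?thesis by simp
qed

definition L1_shift :: "('a::euclidean_space \<Rightarrow> real) \<Rightarrow> 'a \<Rightarrow> ennreal" where
  "L1_shift f h = (\<integral>\<^sup>+x. ennreal \<bar>f x - f (x - h)\<bar> \<partial>lborel)"

lemma L1_shift_approx:
  fixes f g :: "'a::euclidean_space \<Rightarrow> real"
  assumes [measurable]: "f \<in> borel_measurable borel" "g \<in> borel_measurable borel"
  shows "L1_shift f h \<le> L1_shift g h + 2 * (\<integral>\<^sup>+x. ennreal \<bar>f x - g x\<bar> \<partial>lborel)"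
proof -
  have "L1_shift f h \<le> (\<integral>\<^sup>+x. ennreal \<bar>g x - g (x - h)\<bar> +
      (ennreal \<bar>f x - g x\<bar> + ennreal \<bar>f (x - h) - g (x - h)\<bar>) \<partial>lborel)"
    unfolding L1_shift_def
    by (intro nn_integral_mono) (auto simp flip: ennreal_plus intro!: ennreal_leI)
  also have "\<dots> = L1_shift g h + ((\<integral>\<^sup>+x. ennreal \<bar>f x - g x\<bar> \<partial>lborel) +
      (\<integral>\<^sup>+x. ennreal \<bar>f (x - h) - g (x - h)\<bar> \<partial>lborel))"
    unfolding L1_shift_def by (simp add: nn_integral_add)
  also have "(\<integral>\<^sup>+x. ennreal \<bar>f (x - h) - g (x - h)\<bar> \<partial>lborel) = (\<integral>\<^sup>+x. ennreal \<bar>f x - g x\<bar> \<partial>lborel)"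
    by (rule nn_integral_lborel_minus_translation[of "\<lambda>x. ennreal \<bar>f x - g x\<bar>"]) measurable
  finally show ?thesis by (simp add: mult_2)
qed

text \<open>The error term in \<open>L1_shift_approx\<close> does not depend on \<open>h\<close>, so
  continuity of translations survives L1 limits. With e/4 for each ingredient the total is 3e/4,
  which keeps the inequality strict.\<close>

lemma L1_shift_tendsto_closure:
  fixes f :: "'a::euclidean_space \<Rightarrow> real"
  assumes f: "f \<in> borel_measurable borel"
    and *: "\<And>e. e > 0 \<Longrightarrow> \<exists>g\<in>borel_measurable borel. (\<lambda>n. L1_shift g (h n)) \<longlonglongrightarrow> 0 \<and>
        (\<integral>\<^sup>+x. ennreal \<bar>f x - g x\<bar> \<partial>lborel) < ennreal e"
  shows "(\<lambda>n. L1_shift f (h n)) \<longlonglongrightarrow> 0"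
  unfolding tendsto_zero_ennreal_iff
proof (intro allI impI)
  fix e :: real assume e: "e > 0"
  obtain g where g: "g \<in> borel_measurable borel" "(\<lambda>n. L1_shift g (h n)) \<longlonglongrightarrow> 0"
        "(\<integral>\<^sup>+x. ennreal \<bar>f x - g x\<bar> \<partial>lborel) < ennreal (e/4)"
    using *[of "e/4"] e by auto
  have "eventually (\<lambda>n. L1_shift g (h n) < ennreal (e/4)) sequentially"
    using g(2) e unfolding tendsto_zero_ennreal_iff by auto
  then show "eventually (\<lambda>n. L1_shift f (h n) < ennreal e) sequentially"
  proof eventually_elim
    case (elim n)
    have "L1_shift f (h n) \<le> L1_shift g (h n) + 2 * (\<integral>\<^sup>+x. ennreal \<bar>f x - g x\<bar> \<partial>lborel)"
      by (rule L1_shift_approx[OF f g(1)])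
    also have "\<dots> \<le> ennreal (e/4) + 2 * ennreal (e/4)"
      using elim g(3) by (intro add_mono mult_left_mono) auto
    also have "\<dots> = ennreal (3*e/4)"
      using e by (simp add: ennreal_plus[symmetric] ennreal_mult[symmetric] flip: ennreal_numeral del: ennreal_plus)
    also have "\<dots> < ennreal e" using e by (intro ennreal_lessI) auto
    finally show ?case .
  qed
qed

text \<open>Openness replaces continuity: if x lies in \<open>U\<close>, then so does x - h n
  eventually, so the part of \<open>U\<close> lost under the shift vanishes pointwise, dominated by
  the indicator of \<open>U\<close>. Nothing about the measure of the boundary of \<open>U\<close>
  enters.\<close>

lemma L1_shift_open_tendsto:
  fixes U :: "'a::euclidean_space set"
  assumes U: "open U" "emeasure lborel U < \<infinity>" and h: "h \<longlonglongrightarrow> 0"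
  shows "(\<lambda>n. L1_shift (\<lambda>x. indicator U x * c) (h n)) \<longlonglongrightarrow> 0"
proof -
  have [measurable]: "U \<in> sets borel" using U by auto
  have half: "(\<lambda>n. \<integral>\<^sup>+x. ennreal \<bar>c\<bar> * (indicator U x * (1 - indicator U (x - k n))) \<partial>lborel) \<longlonglongrightarrow> 0"
    if k: "k \<longlonglongrightarrow> (0::'a)" for k
  proof -
    have "(\<lambda>n. \<integral>\<^sup>+x. ennreal \<bar>c\<bar> * (indicator U x * (1 - indicator U (x - k n))) \<partial>lborel) \<longlonglongrightarrow> (\<integral>\<^sup>+(x::'a). 0 \<partial>lborel)"
    proof (rule nn_integral_dominated_convergence[where w="\<lambda>x. ennreal \<bar>c\<bar> * indicator U x"])
      show "(\<integral>\<^sup>+x. ennreal \<bar>c\<bar> * indicator U x \<partial>lborel) < \<infinity>"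
        using U(2) by (simp add: nn_integral_cmult ennreal_mult_less_top)
      show "AE x in lborel. (\<lambda>n. ennreal \<bar>c\<bar> * (indicator U x * (1 - indicator U (x - k n)))) \<longlonglongrightarrow> 0"
      proof (rule AE_I2)
        fix x :: 'a
        show "(\<lambda>n. ennreal \<bar>c\<bar> * (indicator U x * (1 - indicator U (x - k n)))) \<longlonglongrightarrow> 0"
        proof (cases "x \<in> U")
          case True
          have "(\<lambda>n. x - k n) \<longlonglongrightarrow> x" using tendsto_diff[OF tendsto_const k, of x] by simp
          then have "eventually (\<lambda>n. x - k n \<in> U) sequentially"
            using U(1) True by (rule topological_tendstoD)
          then show ?thesis by (intro tendsto_eventually, elim eventually_mono) simp
        qed auto
      qed
    qed (auto split: split_indicator)
    then show ?thesis by simp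
  qed
  \<comment> \<open>The symmetric difference of \<open>U\<close> and its translate has two halves.
    Translating the second one turns it into the first with -k in place of k, so \<open>half\<close>
    covers both.\<close>
  have eq: "L1_shift (\<lambda>x. indicator U x * c) k =
      (\<integral>\<^sup>+x. ennreal \<bar>c\<bar> * (indicator U x * (1 - indicator U (x - k))) \<partial>lborel) +
      (\<integral>\<^sup>+x. ennreal \<bar>c\<bar> * (indicator U x * (1 - indicator U (x - (-k)))) \<partial>lborel)" for k
  proof -
    have "(\<integral>\<^sup>+x. ennreal \<bar>c\<bar> * (indicator U x * (1 - indicator U (x - (-k)))) \<partial>lborel)
       = (\<integral>\<^sup>+x. ennreal \<bar>c\<bar> * (indicator U (x - k) * (1 - indicator U x)) \<partial>lborel)"
      using nn_integral_lborel_minus_translation[of "\<lambda>x. ennreal \<bar>c\<bar> * (indicator U x * (1 - indicator U (x - (-k))))" k]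
      by simp
    note * = this
    show ?thesis unfolding L1_shift_def *
      by (subst nn_integral_add[symmetric], measurable, intro nn_integral_cong)
         (auto split: split_indicator)
  qed
  have "(\<lambda>n. - h n) \<longlonglongrightarrow> 0" using tendsto_minus[OF h] by simp
  from tendsto_add[OF half[OF h] half[OF this]] show ?thesis unfolding eq by simp
qed

lemma L1_shift_tendsto:
  fixes f :: "'a::euclidean_space \<Rightarrow> real"
  assumes f: "integrable lborel f" and h: "h \<longlonglongrightarrow> 0"
  shows "(\<lambda>n. L1_shift f (h n)) \<longlonglongrightarrow> 0"
  using f
proof (induction rule: integrable_induct)
  case (base A c)
  show ?case
  proof (rule L1_shift_tendsto_closure)
    fix e :: real assume e: "e > 0"
    \<comment> \<open>Makes \<open>\<bar>c\<bar> * d < e\<close> also for \<open>c = 0\<close>.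
      Outer regularity then exchanges \<open>A\<close> for an open set of almost the same
      measure.\<close>
    define d where "d = e / (\<bar>c\<bar> + 1)"
    have d: "d > 0" using e by (simp add: d_def add_nonneg_pos)
    have A: "A \<in> sets lebesgue" "A \<in> sets borel" using base by auto
    obtain U where U: "open U" "A \<subseteq> U" "U - A \<in> lmeasurable" "emeasure lebesgue (U - A) < ennreal d"
      using sets_lebesgue_outer_open[OF A(1) d] by blast
    have [measurable]: "U \<in> sets borel" "A \<in> sets borel" using U A by auto
    have UA: "emeasure lborel (U - A) < ennreal d" using U by simp
    have "U = A \<union> (U - A)" using U by auto
    then have "emeasure lborel U \<le> emeasure lborel A + emeasure lborel (U - A)"
      by (metis emeasure_subadditive A(2) \<open>U \<in> sets borel\<close> sets.Diff sets_lborel)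
    also have "\<dots> < \<infinity>" using base UA by (simp add: less_top[symmetric]) (auto simp: top_unique)
    finally have Uf: "emeasure lborel U < \<infinity>" .
    show "\<exists>g\<in>borel_measurable borel. (\<lambda>n. L1_shift g (h n)) \<longlonglongrightarrow> 0 \<and>
        (\<integral>\<^sup>+x. ennreal \<bar>indicator A x *\<^sub>R c - g x\<bar> \<partial>lborel) < ennreal e"
    proof (intro bexI conjI)
      show "(\<lambda>n. L1_shift (\<lambda>x. indicator U x * c) (h n)) \<longlonglongrightarrow> 0"
        by (rule L1_shift_open_tendsto[OF U(1) Uf h])
      have "(\<integral>\<^sup>+x. ennreal \<bar>indicator A x *\<^sub>R c - indicator U x * c\<bar> \<partial>lborel)
          = (\<integral>\<^sup>+x. ennreal \<bar>c\<bar> * indicator (U - A) x \<partial>lborel)"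
        using U(2) by (intro nn_integral_cong) (auto split: split_indicator)
      also have "\<dots> = ennreal \<bar>c\<bar> * emeasure lborel (U - A)"
        by (simp add: nn_integral_cmult)
      also have "\<dots> \<le> ennreal \<bar>c\<bar> * ennreal d"
        using UA by (intro mult_left_mono) auto
      also have "\<dots> = ennreal (\<bar>c\<bar> * d)" using d by (simp add: ennreal_mult)
      also have "\<dots> < ennreal e"
        using e by (intro ennreal_lessI) (auto simp: d_def field_simps add_nonneg_pos)
      finally show "(\<integral>\<^sup>+x. ennreal \<bar>indicator A x *\<^sub>R c - indicator U x * c\<bar> \<partial>lborel) < ennreal e" .
    qed measurable
  qed (use base in auto)
next
  case (add f g)
  have [measurable]: "f \<in> borel_measurable borel" "g \<in> borel_measurable borel"
    using add(1,2) by (auto dest: borel_measurable_integrable)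
  have "L1_shift (\<lambda>x. f x + g x) k \<le> L1_shift f k + L1_shift g k" for k
    unfolding L1_shift_def
    by (subst nn_integral_add[symmetric])
       (auto simp flip: ennreal_plus intro!: ennreal_leI nn_integral_mono)
  moreover have "(\<lambda>n. L1_shift f (h n) + L1_shift g (h n)) \<longlonglongrightarrow> 0"
    using tendsto_add[OF add(3,4)] by simp
  ultimately show ?case
    using tendsto_sandwich[of "\<lambda>_. 0" "\<lambda>n. L1_shift (\<lambda>x. f x + g x) (h n)" sequentially "\<lambda>n. L1_shift f (h n) + L1_shift g (h n)" 0]
    by simp
next
  case (lim f s)
  have [measurable]: "f \<in> borel_measurable borel" "\<And>i. s i \<in> borel_measurable borel"
    using borel_measurable_integrable[OF lim(4)] borel_measurable_integrable[OF lim(1)] by simp_all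
  have "(\<lambda>i. \<integral>\<^sup>+x. ennreal \<bar>f x - s i x\<bar> \<partial>lborel) \<longlonglongrightarrow> (\<integral>\<^sup>+(x::'a). 0 \<partial>lborel)"
  \<comment> \<open>The induction rule supplies simple functions bounded by twice |f|, hence the
    factor 3.\<close>
  proof (rule nn_integral_dominated_convergence[where w="\<lambda>x. ennreal (3 * norm (f x))"])
    show "(\<integral>\<^sup>+ x. ennreal (3 * norm (f x)) \<partial>lborel) < \<infinity>"
      using lim(4) unfolding integrable_iff_bounded by (simp add: ennreal_mult nn_integral_cmult ennreal_mult_less_top)
    show "AE x in lborel. ennreal \<bar>f x - s j x\<bar> \<le> ennreal (3 * norm (f x))" for j
    proof (rule AE_I2, rule ennreal_leI)
      fix x show "\<bar>f x - s j x\<bar> \<le> 3 * norm (f x)" using lim(3)[of x j] by auto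
    qed
    show "AE x in lborel. (\<lambda>i. ennreal \<bar>f x - s i x\<bar>) \<longlonglongrightarrow> 0"
    proof (rule AE_I2)
      fix x :: 'a
      have "(\<lambda>i. \<bar>f x - s i x\<bar>) \<longlonglongrightarrow> \<bar>f x - f x\<bar>"
        using lim(2)[of x] by (intro tendsto_intros) auto
      then show "(\<lambda>i. ennreal \<bar>f x - s i x\<bar>) \<longlonglongrightarrow> 0"
        using tendsto_ennrealI by fastforce
    qed
  qed measurable
  then have c: "(\<lambda>i. \<integral>\<^sup>+x. ennreal \<bar>f x - s i x\<bar> \<partial>lborel) \<longlonglongrightarrow> 0" by simp
  show ?case
  proof (rule L1_shift_tendsto_closure)
    fix e :: real assume "e > 0"
    then have "eventually (\<lambda>i. (\<integral>\<^sup>+x. ennreal \<bar>f x - s i x\<bar> \<partial>lborel) < ennreal e) sequentially"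
      using c unfolding tendsto_zero_ennreal_iff by auto
    then obtain i where "(\<integral>\<^sup>+x. ennreal \<bar>f x - s i x\<bar> \<partial>lborel) < ennreal e"
      by (auto simp: eventually_sequentially)
    then show "\<exists>g\<in>borel_measurable borel. (\<lambda>n. L1_shift g (h n)) \<longlonglongrightarrow> 0 \<and>
        (\<integral>\<^sup>+x. ennreal \<bar>f x - g x\<bar> \<partial>lborel) < ennreal e"
      using lim(5)[of i] by (intro bexI[of _ "s i"]) auto
  qed measurable
qed

section \<open>Translation-invariant convex modulars\<close>

lemma AE_lborel_fst_snd:
  fixes P :: "'a::euclidean_space \<Rightarrow> bool"
  assumes "AE x in lborel. P x"
  shows "AE p in (lborel :: ('a \<times> 'a) measure). P (fst p) \<and> P (snd p)"
proof -
  obtain N where N: "{x \<in> space lborel. \<not> P x} \<subseteq> N" "emeasure lborel N = 0" "N \<in> sets lborel"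
    using assms by (auto elim: AE_E)
  have "N \<times> UNIV \<union> UNIV \<times> N \<in> null_sets (lborel \<Otimes>\<^sub>M (lborel :: 'a measure))"
  proof (rule null_sets.Un)
    show "N \<times> UNIV \<in> null_sets (lborel \<Otimes>\<^sub>M (lborel :: 'a measure))"
      using N by (intro null_setsI) (auto simp: lborel.emeasure_pair_measure_Times)
    show "UNIV \<times> N \<in> null_sets ((lborel :: 'a measure) \<Otimes>\<^sub>M lborel)"
      using N by (intro null_setsI) (auto simp: lborel.emeasure_pair_measure_Times)
  qed
  then have "N \<times> UNIV \<union> UNIV \<times> N \<in> null_sets (lborel :: ('a \<times> 'a) measure)"
    by (simp only: lborel_prod)
  then show ?thesis
    by (rule AE_I') (use N in auto)
qed

text \<open>L1 convergence of the translates gives pointwise convergence along a subsequence. That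
  is enough below, where translations are treated by contradiction along a sequence with errors
  bounded from below.\<close>

lemma L1_shift_AE_subseq:
  fixes v :: "'a::euclidean_space \<Rightarrow> real"
  assumes v: "integrable lborel v" and h: "h \<longlonglongrightarrow> 0"
  obtains r :: "nat \<Rightarrow> nat" where "strict_mono r"
    "AE x in lborel. (\<lambda>n. v (x - h (r n))) \<longlonglongrightarrow> v x"
proof -
  have [measurable]: "v \<in> borel_measurable borel" using borel_measurable_integrable[OF v] by simp
  have int: "integrable lborel (\<lambda>x. v (x - k))" for k
    using v nn_integral_lborel_minus_translation[of "\<lambda>x. ennreal (norm (v x))" k]
    unfolding integrable_iff_bounded by simp
  have eq: "(\<integral>x. norm (v x - v (x - h n)) \<partial>lborel) = enn2real (L1_shift v (h n))" for n
    unfolding L1_shift_def by (subst integral_eq_nn_integral) auto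
  have "(\<lambda>n. enn2real (L1_shift v (h n))) \<longlonglongrightarrow> enn2real 0"
    using L1_shift_tendsto[OF v h] by (intro tendsto_enn2real) auto
  then have "\<exists>r::nat\<Rightarrow>nat. strict_mono r \<and> (AE x in lborel. (\<lambda>n. v x - v (x - h (r n))) \<longlonglongrightarrow> 0)"
    by (intro tendsto_L1_AE_subseq[where u="\<lambda>n x. v x - v (x - h n)"]) (simp_all only: eq, simp_all add: v int)
  then obtain r :: "nat \<Rightarrow> nat" where r: "strict_mono r" "AE x in lborel. (\<lambda>n. v x - v (x - h (r n))) \<longlonglongrightarrow> 0"
    by auto
  have "AE x in lborel. (\<lambda>n. v (x - h (r n))) \<longlonglongrightarrow> v x"
    using r(2)
  proof eventually_elim
    case (elim x)
    have "(\<lambda>n. v x - (v x - v (x - h (r n)))) \<longlonglongrightarrow> v x - 0"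
      by (intro tendsto_intros elim)
    then show ?case by simp
  qed
  with r(1) show thesis by (rule that)
qed

text \<open>Integrate the supporting line of \<open>q\<close> at the weighted mean. The right side
  is an extended integral: if it is infinite the claim is trivial, and otherwise its finiteness
  provides the integrability that the argument uses.\<close>

lemma jensen_weighted:
  fixes q :: "real \<Rightarrow> real" and f \<rho> :: "'b \<Rightarrow> real"
  assumes q: "convex_on UNIV q" "\<And>t. 0 \<le> q t"
    and \<rho>: "\<And>h. 0 \<le> \<rho> h" "integrable M \<rho>" "(\<integral>h. \<rho> h \<partial>M) = 1"
    and f [measurable]: "f \<in> borel_measurable M" and int: "integrable M (\<lambda>h. \<rho> h * f h)"
  shows "ennreal (q (\<integral>h. \<rho> h * f h \<partial>M)) \<le> (\<integral>\<^sup>+h. ennreal (\<rho> h * q (f h)) \<partial>M)"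
proof (cases "(\<integral>\<^sup>+h. ennreal (\<rho> h * q (f h)) \<partial>M) = \<infinity>")
  case False
  have [measurable]: "\<rho> \<in> borel_measurable M" using \<rho>(2) by auto
  have [measurable]: "q \<in> borel_measurable borel"
    by (intro borel_measurable_continuous_onI convex_on_continuous q) auto
  define m where "m = (\<integral>h. \<rho> h * f h \<partial>M)"
  obtain c where c: "\<And>y. q m + c * (y - m) \<le> q y"
    using convex_le_Inf_differential[OF q(1), of m] by auto
  have fin: "integrable M (\<lambda>h. \<rho> h * q (f h))"
    using False \<rho>(1) q(2) by (intro integrableI_nonneg) (auto simp: less_top)
  have "q m = (\<integral>h. (q m - c * m) * \<rho> h + c * (\<rho> h * f h) \<partial>M)"
    using \<rho> int by (simp add: m_def[symmetric] algebra_simps)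
  also have "\<dots> \<le> (\<integral>h. \<rho> h * q (f h) \<partial>M)"
  proof (rule integral_mono)
    show "integrable M (\<lambda>h. (q m - c * m) * \<rho> h + c * (\<rho> h * f h))"
      using \<rho> int by auto
    fix h
    have "\<rho> h * (q m + c * (f h - m)) \<le> \<rho> h * q (f h)"
      by (intro mult_left_mono c \<rho>)
    then show "(q m - c * m) * \<rho> h + c * (\<rho> h * f h) \<le> \<rho> h * q (f h)"
      by (simp add: algebra_simps)
  qed (rule fin)
  finally have "ennreal (q m) \<le> ennreal (\<integral>h. \<rho> h * q (f h) \<partial>M)" by (rule ennreal_leI)
  also have "\<dots> = (\<integral>\<^sup>+h. ennreal (\<rho> h * q (f h)) \<partial>M)"
    using fin \<rho>(1) q(2) by (subst nn_integral_eq_integral) auto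
  finally show ?thesis by (simp add: m_def)
qed auto

definition clip :: "real \<Rightarrow> real \<Rightarrow> real" where
  "clip c t = max (- c) (min c t)"

lemma clip_measurable [measurable]: "clip c \<in> borel_measurable borel"
  unfolding clip_def by measurable

text \<open>The function clip M - clip m is flat on [-m, m], has slope 1 for absolute values between
  m and M, and is constant beyond. Both it and its difference from the identity are nondecreasing,
  and they add up to the identity, so both are 1-Lipschitz.\<close>

lemma clip_diff_mono:
  assumes "0 \<le> m" "m \<le> M" "s \<le> t"
  shows "clip M s - clip m s \<le> clip M t - clip m t"
    and "(clip M t - clip m t) - (clip M s - clip m s) \<le> t - s"
  using assms unfolding clip_def by (-) (smt (verit))+
lemma clip_diff_contraction:
  assumes "0 \<le> m" "m \<le> M"
  shows "\<bar>(clip M s - clip m s) - (clip M t - clip m t)\<bar> \<le> \<bar>s - t\<bar>"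
    and "\<bar>(s - (clip M s - clip m s)) - (t - (clip M t - clip m t))\<bar> \<le> \<bar>s - t\<bar>"
  using clip_diff_mono[OF assms, of s t] clip_diff_mono[OF assms, of t s] by (-) linarith+

lemma clip_diff_zero:
  assumes "0 \<le> m" "m \<le> M" "\<bar>t\<bar> \<le> m" shows "clip M t - clip m t = 0"
  using assms unfolding clip_def by auto

lemma clip_diff_bound:
  assumes "0 \<le> m" "m \<le> M" shows "\<bar>clip M t - clip m t\<bar> \<le> M"
  using assms unfolding clip_def by (auto simp: max_def min_def)

text \<open>Letting \<theta> range over 0 and 1 proves every estimate once for the zeroth-order and
  the Gagliardo modular. \<open>B_mono\<close> contains evenness. In \<open>B_tail\<close> the
  argument \<open>K * min 1 (norm z)\<close> is the largest increment over a displacement z, up to a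
  constant, of a bounded Lipschitz function.\<close>

locale nonlocal_modular =
  fixes B :: "'a::euclidean_space \<Rightarrow> real \<Rightarrow> real" and \<theta> C :: real
  assumes theta: "\<theta> = 0 \<or> \<theta> = 1"
    and C_ge_1: "1 \<le> C"
    and B_measurable: "case_prod B \<in> borel_measurable borel"
    and B_convex: "convex_on UNIV (B z)"
    and B_zero [simp]: "B z 0 = 0"
    and B_mono: "\<bar>t\<bar> \<le> \<bar>t'\<bar> \<Longrightarrow> B z t \<le> B z t'"
    and B_double: "B z (2 * t) \<le> C * B z t"
    and B_tail: "(\<integral>\<^sup>+z. ennreal (B z (K * min 1 (norm z))) \<partial>lborel) < \<infinity>"
begin

definition J :: "('a \<Rightarrow> real) \<Rightarrow> 'a \<times> 'a \<Rightarrow> real" where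
  "J v p = B (fst p - snd p) (v (fst p) - \<theta> * v (snd p))"

definition \<Phi> :: "('a \<Rightarrow> real) \<Rightarrow> ennreal" where
  "\<Phi> v = (\<integral>\<^sup>+p. ennreal (J v p) \<partial>lborel)"

lemma B_nonneg [simp]: "0 \<le> B z t"
  using B_mono[of 0 t z] by simp

lemma B_minus [simp]: "B z (- t) = B z t"
  using B_mono[of t "-t" z] B_mono[of "-t" t z] by simp

lemma J_nonneg [simp]: "0 \<le> J v p"
  by (simp add: J_def)

lemma B_continuous: "continuous_on UNIV (B z)"
  using B_convex by (intro convex_on_continuous) auto

lemma B_tendsto: "(f \<longlongrightarrow> t) F \<Longrightarrow> ((\<lambda>n. B z (f n)) \<longlongrightarrow> B z t) F"
  by (rule continuous_on_tendsto_compose[OF B_continuous]) simp_all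

text \<open>A quasi-triangle inequality: s + t is twice a midpoint, doubling pays for the factor and
  convexity splits the midpoint.\<close>

lemma B_add: "B z (s + t) \<le> C * (B z s + B z t)"
proof -
  have "B z (s + t) = B z (2 * ((1/2) *\<^sub>R s + (1/2) *\<^sub>R t))" by simp
  also have "\<dots> \<le> C * B z ((1/2) *\<^sub>R s + (1/2) *\<^sub>R t)" by (rule B_double)
  also have "\<dots> \<le> C * ((1/2) * B z s + (1/2) * B z t)"
    using convex_onD[OF B_convex[of z], of "1/2" s t] C_ge_1 by (intro mult_left_mono) auto
  also have "\<dots> \<le> C * (B z s + B z t)"
    using C_ge_1 by (intro mult_left_mono add_mono) auto
  finally show ?thesis .
qed

lemma B_scale_le: "\<bar>c\<bar> \<le> 1 \<Longrightarrow> B z (c * t) \<le> B z t"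
  by (rule B_mono) (simp add: abs_mult mult_left_le_one_le)

lemma B_compose_measurable [measurable (raw)]:
  assumes [measurable]: "f \<in> M \<rightarrow>\<^sub>M borel" "g \<in> borel_measurable M"
  shows "(\<lambda>x. B (f x) (g x)) \<in> borel_measurable M"
  using measurable_compose[OF _ B_measurable, of "\<lambda>x. (f x, g x)" M] by simp

lemma J_measurable [measurable]:
  assumes [measurable]: "v \<in> borel_measurable borel"
  shows "J v \<in> borel_measurable borel"
proof -
  have [measurable]: "fst \<in> (borel :: ('a \<times> 'a) measure) \<rightarrow>\<^sub>M borel"
      "snd \<in> (borel :: ('a \<times> 'a) measure) \<rightarrow>\<^sub>M borel"
    by (intro borel_measurable_continuous_onI continuous_intros)+
  show ?thesis unfolding J_def by measurable
qed

lemma J_add: "J (\<lambda>x. v x + w x) p \<le> C * (J v p + J w p)"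
proof -
  have "v (fst p) + w (fst p) - \<theta> * (v (snd p) + w (snd p)) =
      (v (fst p) - \<theta> * v (snd p)) + (w (fst p) - \<theta> * w (snd p))"
    by (simp add: algebra_simps)
  then show ?thesis unfolding J_def using B_add by metis
qed

lemma \<Phi>_mono: "(\<And>p. J v p \<le> J w p) \<Longrightarrow> \<Phi> v \<le> \<Phi> w"
  unfolding \<Phi>_def by (intro nn_integral_mono ennreal_leI) auto

lemma \<Phi>_add:
  assumes [measurable]: "v \<in> borel_measurable borel" "w \<in> borel_measurable borel"
  shows "\<Phi> (\<lambda>x. v x + w x) \<le> ennreal C * (\<Phi> v + \<Phi> w)"
proof -
  have "\<Phi> (\<lambda>x. v x + w x) \<le> (\<integral>\<^sup>+p. ennreal C * (ennreal (J v p) + ennreal (J w p)) \<partial>lborel)"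
    unfolding \<Phi>_def
  proof (rule nn_integral_mono)
    fix p
    show "ennreal (J (\<lambda>x. v x + w x) p) \<le> ennreal C * (ennreal (J v p) + ennreal (J w p))"
      using J_add[of v w p] C_ge_1 by (simp flip: ennreal_plus ennreal_mult add: ennreal_leI)
  qed
  also have "\<dots> = ennreal C * (\<Phi> v + \<Phi> w)"
    unfolding \<Phi>_def by (simp add: nn_integral_cmult nn_integral_add)
  finally show ?thesis .
qed

text \<open>For \<theta> = 1 this is the Lipschitz bound; for \<theta> = 0 it is the Lipschitz bound
  against the point 0, which \<open>r\<close> fixes.\<close>

lemma \<Phi>_contraction:
  assumes r0: "r 0 = 0" and r: "\<And>s t. \<bar>r s - r t\<bar> \<le> \<bar>s - t\<bar>"
  shows "J (\<lambda>x. r (v x)) p \<le> J v p"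
proof -
  have "\<bar>r (v (fst p)) - \<theta> * r (v (snd p))\<bar> \<le> \<bar>v (fst p) - \<theta> * v (snd p)\<bar>"
    using theta r[of "v (fst p)" 0] r[of "v (fst p)" "v (snd p)"] r0 by auto
  then show ?thesis unfolding J_def by (rule B_mono)
qed

lemma \<Phi>_tendsto_zero:
  assumes [measurable]: "\<And>n. w n \<in> borel_measurable borel" "D \<in> borel_measurable borel"
    and D: "(\<integral>\<^sup>+p. ennreal (D p) \<partial>lborel) < \<infinity>" "\<And>n p. J (w n) p \<le> D p"
    and w: "\<And>x. (\<lambda>n. w n x) \<longlonglongrightarrow> 0"
  shows "(\<lambda>n. \<Phi> (w n)) \<longlonglongrightarrow> 0"
proof -
  have "(\<lambda>n. \<integral>\<^sup>+p. ennreal (J (w n) p) \<partial>lborel) \<longlonglongrightarrow> (\<integral>\<^sup>+(p::'a\<times>'a). 0 \<partial>lborel)"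
  proof (rule nn_integral_dominated_convergence[where w="\<lambda>p. ennreal (D p)"])
    show "AE p in lborel. (\<lambda>n. ennreal (J (w n) p)) \<longlonglongrightarrow> 0"
    proof (rule AE_I2)
      fix p :: "'a \<times> 'a"
      have "(\<lambda>n. J (w n) p) \<longlonglongrightarrow> B (fst p - snd p) (0 - \<theta> * 0)"
        unfolding J_def by (intro B_tendsto tendsto_intros w)
      then show "(\<lambda>n. ennreal (J (w n) p)) \<longlonglongrightarrow> 0"
        using tendsto_ennrealI[of _ 0] by simp
    qed
  qed (use D in \<open>auto intro!: ennreal_leI AE_I2\<close>)
  then show ?thesis by (simp add: \<Phi>_def)
qed

text \<open>The removed part is itself a contraction of \<open>u\<close>, so \<open>J u\<close>
  dominates it for every n.\<close>

lemma \<Phi>_truncation_tendsto: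
  assumes u [measurable]: "u \<in> borel_measurable borel" and fin: "\<Phi> u < \<infinity>"
  shows "(\<lambda>n. \<Phi> (\<lambda>x. u x - (clip (real (Suc n)) (u x) - clip (1 / real (Suc n)) (u x)))) \<longlonglongrightarrow> 0"
proof (rule \<Phi>_tendsto_zero[where D="J u"])
  have le: "1 / real (Suc n) \<le> real (Suc n)" for n by (simp add: field_simps)
  show "(\<integral>\<^sup>+p. ennreal (J u p) \<partial>lborel) < \<infinity>" using fin by (simp add: \<Phi>_def)
  show "J (\<lambda>x. u x - (clip (real (Suc n)) (u x) - clip (1 / real (Suc n)) (u x))) p \<le> J u p" for n p
    by (rule \<Phi>_contraction[where r="\<lambda>t. t - (clip (real (Suc n)) t - clip (1 / real (Suc n)) t)"])
       (simp add: clip_def, intro clip_diff_contraction(2) le, simp)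
  show "(\<lambda>n. u x - (clip (real (Suc n)) (u x) - clip (1 / real (Suc n)) (u x))) \<longlonglongrightarrow> 0" for x
  proof -
    have 1: "(\<lambda>n. clip (1 / real (Suc n)) (u x)) \<longlonglongrightarrow> max (-0) (min 0 (u x))"
      unfolding clip_def
      by (intro tendsto_max tendsto_min tendsto_minus tendsto_const lim_1_over_n[THEN LIMSEQ_Suc])
    obtain N :: nat where N: "\<bar>u x\<bar> \<le> real N" using real_arch_simple by blast
    \<comment> \<open>Once n exceeds |u x| the upper truncation is inactive at x, and only the lower
      clip, of size at most 1/(n+1), is left.\<close>
    have "eventually (\<lambda>n. u x - (clip (real (Suc n)) (u x) - clip (1 / real (Suc n)) (u x)) =
        clip (1 / real (Suc n)) (u x)) sequentially"
      using eventually_ge_at_top[of N]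
    proof eventually_elim
      case (elim n)
      then have "\<bar>u x\<bar> \<le> real (Suc n)" using N by linarith
      then show ?case unfolding clip_def[of "real (Suc n)"] by auto
    qed
    moreover have "(\<lambda>n. clip (1 / real (Suc n)) (u x)) \<longlonglongrightarrow> 0" using 1 by (simp add: max_def min_def split: if_splits)
    ultimately show ?thesis by (subst tendsto_cong)
  qed
qed measurable

text \<open>The dominating function is chosen before \<psi>, so it serves a whole sequence of
  cutoffs with a common Lipschitz constant, and dominated convergence applies to it. It arises from
  the discrete product rule: the first term is at most \<open>J v\<close>, and the second is
  \<open>R\<close>.\<close>

lemma multiplier_dominated:
  assumes v [measurable]: "v \<in> borel_measurable borel" and M: "\<And>x. \<bar>v x\<bar> \<le> M"
    and supp: "emeasure lborel {x. v x \<noteq> 0} < \<infinity>" and fin: "\<Phi> v < \<infinity>" and L: "0 \<le> L"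
  obtains D where "D \<in> borel_measurable borel" "(\<integral>\<^sup>+p. ennreal (D p) \<partial>lborel) < \<infinity>"
    "\<And>\<psi> p. (\<And>x. \<bar>\<psi> x\<bar> \<le> 1) \<Longrightarrow> (\<And>x y. \<bar>\<psi> x - \<psi> y\<bar> \<le> L * norm (x - y)) \<Longrightarrow>
        J (\<lambda>x. \<psi> x * v x) p \<le> D p"
proof -
  define M' where "M' = M * (L + 2)"
  \<comment> \<open>The increment of \<psi> is multiplied by v y, so it matters only for y in the
    support. Integrating x first gives the tail integral for each y, and then the finite measure of
    the support.\<close>
  define R where "R p = indicator {x. v x \<noteq> 0} (snd p) * B (fst p - snd p) (M' * min 1 (norm (fst p - snd p)))"
    for p :: "'a \<times> 'a"
  have [measurable]: "fst \<in> (borel :: ('a \<times> 'a) measure) \<rightarrow>\<^sub>M borel"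
      "snd \<in> (borel :: ('a \<times> 'a) measure) \<rightarrow>\<^sub>M borel"
    by (intro borel_measurable_continuous_onI continuous_intros)+
  have R_meas [measurable]: "R \<in> borel_measurable borel" unfolding R_def by measurable
  have R_nonneg [simp]: "0 \<le> R p" for p by (simp add: R_def)
  have M0: "0 \<le> M" using M[of undefined] by linarith
  have R_meas': "(\<lambda>p. ennreal (R p)) \<in> borel_measurable (lborel \<Otimes>\<^sub>M lborel)"
    by (simp only: lborel_prod) measurable
  have "(\<integral>\<^sup>+p. ennreal (R p) \<partial>lborel) = (\<integral>\<^sup>+y. (\<integral>\<^sup>+x. ennreal (R (x, y)) \<partial>lborel) \<partial>lborel)"
    using lborel_pair.nn_integral_snd[OF R_meas'] by (simp only: lborel_prod)
  also have "\<dots> = (\<integral>\<^sup>+y. indicator {x. v x \<noteq> 0} y *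
      (\<integral>\<^sup>+z. ennreal (B z (M' * min 1 (norm z))) \<partial>lborel) \<partial>lborel)"
  proof (rule nn_integral_cong)
    fix y :: 'a
    have "(\<integral>\<^sup>+x. ennreal (R (x, y)) \<partial>lborel) =
      (\<integral>\<^sup>+x. indicator {x. v x \<noteq> 0} y * ennreal (B (x - y) (M' * min 1 (norm (x - y)))) \<partial>lborel)"
      by (intro nn_integral_cong) (auto simp: R_def split: split_indicator)
    also have "\<dots> = indicator {x. v x \<noteq> 0} y * (\<integral>\<^sup>+x. ennreal (B (x - y) (M' * min 1 (norm (x - y)))) \<partial>lborel)"
      by (simp add: nn_integral_cmult)
    finally show "(\<integral>\<^sup>+x. ennreal (R (x, y)) \<partial>lborel) = indicator {x. v x \<noteq> 0} y *
      (\<integral>\<^sup>+z. ennreal (B z (M' * min 1 (norm z))) \<partial>lborel)"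
      using nn_integral_lborel_minus_translation[of "\<lambda>z. ennreal (B z (M' * min 1 (norm z)))" y] by simp
  qed
  also have "\<dots> = emeasure lborel {x. v x \<noteq> 0} * (\<integral>\<^sup>+z. ennreal (B z (M' * min 1 (norm z))) \<partial>lborel)"
    by (simp add: nn_integral_multc)
  also have "\<dots> < \<infinity>" using supp B_tail[of M'] by (simp add: ennreal_mult_less_top)
  finally have R_fin: "(\<integral>\<^sup>+p. ennreal (R p) \<partial>lborel) < \<infinity>" .
  show thesis
  proof (rule that[of "\<lambda>p. C * (J v p + R p)"])
    have "(\<integral>\<^sup>+p. ennreal (C * (J v p + R p)) \<partial>lborel) =
        (\<integral>\<^sup>+p. ennreal C * (ennreal (J v p) + ennreal (R p)) \<partial>lborel)"
      using C_ge_1 by (intro nn_integral_cong) (simp flip: ennreal_plus ennreal_mult)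
    also have "\<dots> = ennreal C * (\<Phi> v + (\<integral>\<^sup>+p. ennreal (R p) \<partial>lborel))"
      by (simp add: nn_integral_cmult nn_integral_add \<Phi>_def)
    also have "\<dots> < \<infinity>" using fin R_fin by (simp add: ennreal_mult_less_top)
    finally show "(\<integral>\<^sup>+p. ennreal (C * (J v p + R p)) \<partial>lborel) < \<infinity>" .
    fix \<psi> :: "'a \<Rightarrow> real" and p :: "'a \<times> 'a"
    assume \<psi>: "\<And>x. \<bar>\<psi> x\<bar> \<le> 1" "\<And>x y. \<bar>\<psi> x - \<psi> y\<bar> \<le> L * norm (x - y)"
    obtain x y where p: "p = (x, y)" by (cases p)
    have "J (\<lambda>x. \<psi> x * v x) p = B (x - y) (\<psi> x * (v x - \<theta> * v y) + \<theta> * v y * (\<psi> x - \<psi> y))"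
      unfolding J_def p by (simp add: algebra_simps)
    also have "\<dots> \<le> C * (B (x - y) (\<psi> x * (v x - \<theta> * v y)) + B (x - y) (\<theta> * v y * (\<psi> x - \<psi> y)))"
      by (rule B_add)
    also have "\<dots> \<le> C * (J v p + R p)"
    proof (intro mult_left_mono add_mono)
      show "B (x - y) (\<psi> x * (v x - \<theta> * v y)) \<le> J v p"
        unfolding J_def p using \<psi>(1) by (simp add: B_scale_le)
      show "B (x - y) (\<theta> * v y * (\<psi> x - \<psi> y)) \<le> R p"
      proof (cases "v y = 0")
        case False
        \<comment> \<open>L comes from the Lipschitz bound at distance at most 1, and 2 is the
          largest oscillation beyond it.\<close>
        have "\<bar>\<psi> x - \<psi> y\<bar> \<le> (L + 2) * min 1 (norm (x - y))"
        proof (cases "norm (x - y) \<le> 1")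
          case True
          then show ?thesis using \<psi>(2)[of x y] by (simp add: min_def algebra_simps) (use norm_ge_zero[of "x - y"] in linarith)
        next
          case False
          then show ?thesis using \<psi>(1)[of x] \<psi>(1)[of y] L by (simp add: min_def) 
        qed
        then have "\<bar>v y\<bar> * \<bar>\<psi> x - \<psi> y\<bar> \<le> M * ((L + 2) * min 1 (norm (x - y)))"
          by (intro mult_mono M M0) auto
        then have "\<bar>\<theta> * v y * (\<psi> x - \<psi> y)\<bar> \<le> \<bar>M' * min 1 (norm (x - y))\<bar>"
          using theta M0 L by (auto simp: abs_mult M'_def mult.assoc)
        then show ?thesis using False unfolding R_def p by (simp add: B_mono)
      qed (simp add: p)
    qed (use C_ge_1 in auto)
    finally show "J (\<lambda>x. \<psi> x * v x) p \<le> C * (J v p + R p)" .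
  qed measurable
qed

text \<open>The shift acts on both coordinates of p at once and so preserves fst p - snd p.\<close>

lemma \<Phi>_shift:
  assumes [measurable]: "v \<in> borel_measurable borel"
  shows "\<Phi> (\<lambda>x. v (x - h)) = \<Phi> v"
proof -
  have "\<Phi> (\<lambda>x. v (x - h)) = (\<integral>\<^sup>+p. ennreal (J v (p - (h, h))) \<partial>lborel)"
    unfolding \<Phi>_def J_def by (simp add: fst_diff snd_diff)
  also have "\<dots> = \<Phi> v"
    unfolding \<Phi>_def by (rule nn_integral_lborel_minus_translation[of "\<lambda>p. ennreal (J v p)"]) measurable
  finally show ?thesis .
qed

text \<open>The integrals of \<open>J (\<lambda>x. v (x - h)) = J v \<circ> translation\<close> do not depend on \<open>h\<close>, so Fatou's lemma for
  \<open>C * (J v + J (\<lambda>x. v (x - h))) - J (\<lambda>x. v x - v (x - h)) \<ge> 0\<close> replaces a dominating function.\<close>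

lemma \<Phi>_translation_continuous:
  assumes v: "integrable lborel v" and fin: "\<Phi> v < \<infinity>" and e: "0 < e"
  obtains r where "r > 0" "\<And>h. norm h < r \<Longrightarrow> \<Phi> (\<lambda>x. v x - v (x - h)) < e"
proof (rule ccontr)
  assume "\<not> thesis"
  \<comment> \<open>If continuity fails, there is a sequence of shifts tending to 0 with error at
    least e. Passing to the subsequence of almost everywhere convergence keeps this bound.\<close>
  with that have "\<exists>h. norm h < r \<and> e \<le> \<Phi> (\<lambda>x. v x - v (x - h))" if "r > 0" for r
    using \<open>r > 0\<close> by (meson not_le)
  then have "\<exists>h. norm h < 1 / real (Suc n) \<and> e \<le> \<Phi> (\<lambda>x. v x - v (x - h))" for n
    by simp
  then obtain h where h: "\<And>n. norm (h n) < 1 / real (Suc n)" "\<And>n. e \<le> \<Phi> (\<lambda>x. v x - v (x - h n))"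
    by metis
  have "h \<longlonglongrightarrow> 0"
    by (rule tendsto_norm_zero_cancel, rule tendsto_sandwich[OF _ _ tendsto_const lim_1_over_n[THEN LIMSEQ_Suc]])
       (use h(1) in \<open>auto intro!: always_eventually less_imp_le\<close>)
  then obtain r :: "nat \<Rightarrow> nat" where r: "strict_mono r"
      "AE x in lborel. (\<lambda>n. v (x - h (r n))) \<longlonglongrightarrow> v x"
    by (rule L1_shift_AE_subseq[OF v])
  have vm [measurable]: "v \<in> borel_measurable borel" using borel_measurable_integrable[OF v] by simp
  define f where "f n = J (\<lambda>x. v x - v (x - h (r n)))" for n
  define g where "g n = J (\<lambda>x. v (x - h (r n)))" for n
  have [measurable]: "f n \<in> borel_measurable borel" "g n \<in> borel_measurable borel" for n
    unfolding f_def g_def by measurable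
  define F where "F n p = C * (J v p + g n p) - f n p" for n p
  have F_nonneg: "0 \<le> F n p" for n p
    \<comment> \<open>The difference is a sum with the negated translate, and evenness of
      \<open>B z\<close> removes the sign.\<close>
    using J_add[of v "\<lambda>x. - v (x - h (r n))" p]
    unfolding F_def f_def g_def J_def by (simp add: algebra_simps) (metis B_minus minus_diff_eq)
  have AE2: "AE p in lborel. (\<lambda>n. v (fst p - h (r n))) \<longlonglongrightarrow> v (fst p) \<and> (\<lambda>n. v (snd p - h (r n))) \<longlonglongrightarrow> v (snd p)"
    using AE_lborel_fst_snd[OF r(2)] by simp
  have lim: "AE p in lborel. liminf (\<lambda>n. ennreal (F n p)) = ennreal (C * (J v p + J v p))"
    using AE2
  proof eventually_elim
    case (elim p)
    have "(\<lambda>n. F n p) \<longlonglongrightarrow> C * (J v p + J v p) - B (fst p - snd p) ((v (fst p) - v (fst p)) - \<theta> * (v (snd p) - v (snd p)))"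
      unfolding F_def g_def f_def J_def
      by (intro tendsto_intros B_tendsto) (use elim in auto)
    then have "(\<lambda>n. ennreal (F n p)) \<longlonglongrightarrow> ennreal (C * (J v p + J v p))"
      by (intro tendsto_ennrealI) simp
    then show ?case by (intro lim_imp_Liminf) auto
  qed
  define A where "A = (\<integral>\<^sup>+p. ennreal (C * (J v p + J v p)) \<partial>lborel)"
  have A_eq: "A = ennreal C * (\<Phi> v + \<Phi> v)"
  proof -
    have "A = (\<integral>\<^sup>+p. ennreal C * (ennreal (J v p) + ennreal (J v p)) \<partial>lborel)"
      unfolding A_def using C_ge_1 by (intro nn_integral_cong) (simp flip: ennreal_plus ennreal_mult)
    then show ?thesis by (simp add: nn_integral_cmult nn_integral_add \<Phi>_def)
  qed
  have A_fin: "A < \<infinity>" using fin unfolding A_eq by (simp add: ennreal_mult_less_top)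
  have sum: "(\<integral>\<^sup>+p. ennreal (F n p) \<partial>lborel) + (\<integral>\<^sup>+p. ennreal (f n p) \<partial>lborel) = A" for n
  proof -
    have "(\<integral>\<^sup>+p. ennreal (F n p) \<partial>lborel) + (\<integral>\<^sup>+p. ennreal (f n p) \<partial>lborel)
      = (\<integral>\<^sup>+p. ennreal C * (ennreal (J v p) + ennreal (g n p)) \<partial>lborel)"
      unfolding F_def
    proof (subst nn_integral_add[symmetric])
      show "(\<integral>\<^sup>+p. ennreal (C * (J v p + g n p) - f n p) + ennreal (f n p) \<partial>lborel) =
        (\<integral>\<^sup>+p. ennreal C * (ennreal (J v p) + ennreal (g n p)) \<partial>lborel)"
      proof (intro nn_integral_cong)
        fix p
        have "ennreal (C * (J v p + g n p) - f n p) + ennreal (f n p) = ennreal (C * (J v p + g n p))"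
          using F_nonneg[of n p] unfolding F_def by (subst ennreal_plus[symmetric]) (auto simp: f_def)
        then show "ennreal (C * (J v p + g n p) - f n p) + ennreal (f n p) = ennreal C * (ennreal (J v p) + ennreal (g n p))"
          using C_ge_1 by (simp add: g_def flip: ennreal_plus ennreal_mult)
      qed
    qed measurable
    also have "\<dots> = ennreal C * (\<Phi> v + (\<integral>\<^sup>+p. ennreal (g n p) \<partial>lborel))"
      by (simp add: nn_integral_cmult nn_integral_add \<Phi>_def)
    also have "(\<integral>\<^sup>+p. ennreal (g n p) \<partial>lborel) = \<Phi> v"
      using \<Phi>_shift[OF vm, of "h (r n)"] by (simp add: g_def \<Phi>_def)
    finally show ?thesis by (simp add: A_eq)
  qed
  have le: "(\<integral>\<^sup>+p. ennreal (F n p) \<partial>lborel) \<le> A - e" for n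
  proof -
    have fe: "e \<le> (\<integral>\<^sup>+p. ennreal (f n p) \<partial>lborel)" using h(2)[of "r n"] by (simp add: f_def \<Phi>_def)
    have ff: "(\<integral>\<^sup>+p. ennreal (f n p) \<partial>lborel) \<noteq> \<infinity>" using sum[of n] A_fin by auto
    have "(\<integral>\<^sup>+p. ennreal (F n p) \<partial>lborel) = A - (\<integral>\<^sup>+p. ennreal (f n p) \<partial>lborel)"
      using ff by (simp flip: sum[of n])
    also have "\<dots> \<le> A - e" using fe by (rule ennreal_mono_minus)
    finally show ?thesis .
  qed
  have "A = (\<integral>\<^sup>+p. liminf (\<lambda>n. ennreal (F n p)) \<partial>lborel)"
    unfolding A_def using lim by (intro nn_integral_cong_AE) auto
  also have "\<dots> \<le> liminf (\<lambda>n. \<integral>\<^sup>+p. ennreal (F n p) \<partial>lborel)"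
    by (rule nn_integral_liminf) (simp add: F_def)
  also have "\<dots> \<le> liminf (\<lambda>n. A - e)"
    by (intro Liminf_mono always_eventually allI le)
  also have "\<dots> = A - e" by (rule Liminf_const) simp
  finally have "A \<le> A - e" .
  \<comment> \<open>Subtraction in \<open>ennreal\<close> stops at 0, so A \<le> A - e is
    contradictory only with e \<le> A and \<open>A\<close> finite.\<close>
  moreover have "e \<le> A"
  proof -
    have "e \<le> (\<integral>\<^sup>+p. ennreal (f 0 p) \<partial>lborel)" using h(2)[of "r 0"] by (simp add: f_def \<Phi>_def)
    also have "\<dots> \<le> (\<integral>\<^sup>+p. ennreal (F 0 p) \<partial>lborel) + (\<integral>\<^sup>+p. ennreal (f 0 p) \<partial>lborel)"
      by (rule add_increasing) auto
    finally show ?thesis unfolding sum .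
  qed
  moreover obtain a where a: "A = ennreal a" "0 \<le> a" using A_fin by (cases A) auto
  moreover obtain b where b: "e = ennreal b" "0 \<le> b" using \<open>e \<le> A\<close> A_fin by (cases e) (auto simp: top_unique)
  ultimately show False
    using e by (auto simp: ennreal_minus)
qed

text \<open>As \<rho> has mass 1, v minus its convolution is the \<rho>-average of v - v(. - h).
  Jensen for each pair of points and Tonelli bound its modular by the average of the translation
  errors. Only shifts with \<rho> h \<noteq> 0 count, so the support of \<rho> may be centred
  anywhere. The bound \<open>M\<close> makes the convolution integral exist at every point.\<close>

lemma \<Phi>_mollify_le:
  assumes v [measurable]: "v \<in> borel_measurable borel" and M: "\<And>x. \<bar>v x\<bar> \<le> M"
    and \<rho>: "\<And>h. 0 \<le> \<rho> h" "integrable lborel \<rho>" "(\<integral>h. \<rho> h \<partial>lborel) = 1"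
    and e: "\<And>h. \<rho> h \<noteq> 0 \<Longrightarrow> \<Phi> (\<lambda>x. v x - v (x - h)) \<le> e"
  shows "\<Phi> (\<lambda>x. v x - (\<integral>h. \<rho> h * v (x - h) \<partial>lborel)) \<le> e"
proof -
  have \<rho>m [measurable]: "\<rho> \<in> borel_measurable borel" using borel_measurable_integrable[OF \<rho>(2)] by simp
  have [measurable]: "fst \<in> (borel :: ('a \<times> 'a) measure) \<rightarrow>\<^sub>M borel"
      "snd \<in> (borel :: ('a \<times> 'a) measure) \<rightarrow>\<^sub>M borel"
    by (intro borel_measurable_continuous_onI continuous_intros)+
  have int: "integrable lborel (\<lambda>h. \<rho> h * v (x - h))" for x
    by (rule Bochner_Integration.integrable_bound[OF integrable_mult_left[OF \<rho>(2), of M]])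
       (use M \<rho>(1) in \<open>auto intro!: AE_I2 simp: abs_mult mult_left_mono abs_of_nonneg
          intro: order_trans[OF mult_left_mono[OF M \<rho>(1)]]\<close>)
  define d where "d p h = (v (fst p) - v (fst p - h)) - \<theta> * (v (snd p) - v (snd p - h))" for p h
  have dint: "integrable lborel (\<lambda>h. \<rho> h * d p h)"
    and dval: "(\<integral>h. \<rho> h * d p h \<partial>lborel) = (v (fst p) - (\<integral>h. \<rho> h * v (fst p - h) \<partial>lborel)) -
        \<theta> * (v (snd p) - (\<integral>h. \<rho> h * v (snd p - h) \<partial>lborel))" for p
  proof -
    have eq: "\<rho> h * d p h = (v (fst p) * \<rho> h - \<rho> h * v (fst p - h)) - \<theta> * (v (snd p) * \<rho> h - \<rho> h * v (snd p - h))" for h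
      by (simp add: d_def algebra_simps)
    show "integrable lborel (\<lambda>h. \<rho> h * d p h)" unfolding eq using int \<rho>(2) by auto
    show "(\<integral>h. \<rho> h * d p h \<partial>lborel) = (v (fst p) - (\<integral>h. \<rho> h * v (fst p - h) \<partial>lborel)) -
        \<theta> * (v (snd p) - (\<integral>h. \<rho> h * v (snd p - h) \<partial>lborel))"
      unfolding eq using int \<rho>(2,3) by simp
  qed
  have "\<Phi> (\<lambda>x. v x - (\<integral>h. \<rho> h * v (x - h) \<partial>lborel))
      = (\<integral>\<^sup>+p. ennreal (B (fst p - snd p) (\<integral>h. \<rho> h * d p h \<partial>lborel)) \<partial>lborel)"
    unfolding \<Phi>_def J_def dval ..
  also have "\<dots> \<le> (\<integral>\<^sup>+p. (\<integral>\<^sup>+h. ennreal (\<rho> h * B (fst p - snd p) (d p h)) \<partial>lborel) \<partial>lborel)"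
  proof (intro nn_integral_mono jensen_weighted B_convex \<rho> dint B_nonneg)
    show "d p \<in> borel_measurable lborel" for p unfolding d_def by measurable
  qed
  also have "\<dots> = (\<integral>\<^sup>+h. (\<integral>\<^sup>+p. ennreal (\<rho> h * B (fst p - snd p) (d p h)) \<partial>lborel) \<partial>lborel)"
  proof -
    have "(\<lambda>(h, p). ennreal (\<rho> h * B (fst p - snd p) (d p h))) \<in> borel_measurable (lborel \<Otimes>\<^sub>M lborel)"
      unfolding d_def by measurable
    from lborel_pair.Fubini'[OF this] show ?thesis .
  qed
  also have "\<dots> = (\<integral>\<^sup>+h. ennreal (\<rho> h) * \<Phi> (\<lambda>x. v x - v (x - h)) \<partial>lborel)"
  proof (rule nn_integral_cong)
    fix h :: 'a
    have "(\<integral>\<^sup>+p. ennreal (\<rho> h * B (fst p - snd p) (d p h)) \<partial>lborel) =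
        (\<integral>\<^sup>+p. ennreal (\<rho> h) * ennreal (J (\<lambda>x. v x - v (x - h)) p) \<partial>lborel)"
      by (intro nn_integral_cong) (simp add: J_def d_def ennreal_mult \<rho>(1))
    then show "(\<integral>\<^sup>+p. ennreal (\<rho> h * B (fst p - snd p) (d p h)) \<partial>lborel) = ennreal (\<rho> h) * \<Phi> (\<lambda>x. v x - v (x - h))"
      unfolding \<Phi>_def by (simp add: nn_integral_cmult)
  qed
  also have "\<dots> \<le> (\<integral>\<^sup>+h. ennreal (\<rho> h) * e \<partial>lborel)"
  proof (rule nn_integral_mono)
    fix h show "ennreal (\<rho> h) * \<Phi> (\<lambda>x. v x - v (x - h)) \<le> ennreal (\<rho> h) * e"
      by (cases "\<rho> h = 0") (auto intro: mult_left_mono e)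
  qed
  also have "\<dots> = (\<integral>\<^sup>+h. ennreal (\<rho> h) \<partial>lborel) * e" by (simp add: nn_integral_multc)
  also have "\<dots> = e" using \<rho> by (subst nn_integral_eq_integral) auto
  finally show ?thesis .
qed

end

lemma (in nonlocal_modular) B_scale_power: "\<bar>c\<bar> \<le> 2 ^ n \<Longrightarrow> B z (c * t) \<le> C ^ n * B z t"
proof (induction n arbitrary: c)
  case 0
  then show ?case using B_scale_le[of c z t] by simp
next
  case (Suc n)
  have "B z (c * t) = B z (2 * ((c / 2) * t))" by simp
  also have "\<dots> \<le> C * B z ((c / 2) * t)" by (rule B_double)
  also have "\<dots> \<le> C * (C ^ n * B z t)"
    using Suc C_ge_1 by (intro mult_left_mono Suc.IH) auto
  finally show ?case by simp
qed

text \<open>The link between modular and norm: it removes the scaling factor from membership in the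
  space, and it makes the modular of (u - \<phi>)/c small once that of u - \<phi> is.\<close>

lemma (in nonlocal_modular) \<Phi>_scale:
  assumes [measurable]: "v \<in> borel_measurable borel" and c: "\<bar>c\<bar> \<le> 2 ^ n"
  shows "\<Phi> (\<lambda>x. c * v x) \<le> ennreal (C ^ n) * \<Phi> v"
proof -
  have "\<Phi> (\<lambda>x. c * v x) \<le> (\<integral>\<^sup>+p. ennreal (C ^ n) * ennreal (J v p) \<partial>lborel)"
    unfolding \<Phi>_def
  proof (rule nn_integral_mono)
    fix p
    have "J (\<lambda>x. c * v x) p = B (fst p - snd p) (c * (v (fst p) - \<theta> * v (snd p)))"
      unfolding J_def by (simp add: algebra_simps)
    also have "\<dots> \<le> C ^ n * J v p" unfolding J_def by (rule B_scale_power[OF c])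
    finally show "ennreal (J (\<lambda>x. c * v x) p) \<le> ennreal (C ^ n) * ennreal (J v p)"
      using C_ge_1 by (simp add: ennreal_leI flip: ennreal_mult)
  qed
  also have "\<dots> = ennreal (C ^ n) * \<Phi> v" unfolding \<Phi>_def by (rule nn_integral_cmult) measurable
  finally show ?thesis .
qed

section \<open>Mollifiers and shifts into the domain\<close>

text \<open>Level 0 is the classical flat function exp(-1/t). The negative powers of t make the
  family closed under differentiation up to linear combinations: the derivative of level m involves
  levels m + 1 and m + 2.\<close>

definition exp_profile :: "nat \<Rightarrow> real \<Rightarrow> real" where
  "exp_profile m t = (if t > 0 then exp (- (1 / t)) / t ^ m else 0)"

lemma exp_profile_tendsto_zero: "(exp_profile m \<longlongrightarrow> 0) (at 0)"
proof -
  have "((\<lambda>t. (inverse t) ^ m / exp (inverse t)) \<longlongrightarrow> 0) (at_right (0::real))"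
    by (rule filterlim_compose[OF tendsto_power_div_exp_0 filterlim_inverse_at_top_right])
  then have "(exp_profile m \<longlongrightarrow> 0) (at_right 0)"
    by (rule Lim_transform_eventually, intro eventually_mono[OF eventually_at_right_less[of 0]])
       (simp add: exp_profile_def exp_minus field_simps)
  moreover have "(exp_profile m \<longlongrightarrow> 0) (at_left 0)"
    by (rule Lim_transform_eventually[OF tendsto_const],
        intro eventually_mono[OF eventually_at_leftI[of "-1" 0 "\<lambda>x. x < 0"]])
       (auto simp: exp_profile_def)
  ultimately show ?thesis by (simp add: filterlim_at_split)
qed

lemma exp_profile_deriv:
  "(exp_profile m has_real_derivative (exp_profile (m + 2) t - real m * exp_profile (m + 1) t)) (at t)"
proof (cases t "0 :: real" rule: linorder_cases)
  case less
  have "((\<lambda>_. 0) has_real_derivative 0) (at t)" by simp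
  then have "(exp_profile m has_real_derivative 0) (at t)"
    by (rule has_field_derivative_transform_within_open[where S="{..<0}"])
       (use less in \<open>auto simp: exp_profile_def\<close>)
  then show ?thesis using less by (simp add: exp_profile_def)
next
  case equal
  \<comment> \<open>Division by h raises the level by one, so the difference quotient at 0 is
    \<open>exp_profile (Suc m)\<close>, whose limit is known.\<close>
  have "((\<lambda>h. (exp_profile m (0 + h) - exp_profile m 0) / h) \<longlongrightarrow> 0) (at 0)"
    by (rule Lim_transform_eventually[OF exp_profile_tendsto_zero[of "Suc m"]])
       (auto simp: exp_profile_def eventually_at_filter)
  then have "(exp_profile m has_real_derivative 0) (at 0)"
    by (simp add: DERIV_def)
  then show ?thesis using equal by (simp add: exp_profile_def)
next
  case greater
  have "((\<lambda>t. exp (- (1 / t)) / t ^ m) has_real_derivative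
      (exp (- (1 / t)) * (1 / t ^ 2)) / t ^ m - real m * (exp (- (1 / t)) / t ^ (m + 1))) (at t)"
  proof (cases m)
    case 0
    then show ?thesis using greater
      by (auto intro!: derivative_eq_intros simp: power2_eq_square)
  next
    case (Suc n)
    have "n \<noteq> 0 \<longrightarrow> t ^ n = t * t ^ (n - Suc 0)" by (cases n) auto
    then show ?thesis using greater Suc
      by (auto intro!: derivative_eq_intros simp: power2_eq_square field_simps)
  qed
  then have "(exp_profile m has_real_derivative
      (exp (- (1 / t)) * (1 / t ^ 2)) / t ^ m - real m * (exp (- (1 / t)) / t ^ (m + 1))) (at t)"
    by (rule has_field_derivative_transform_within_open[where S="{0<..}"])
       (use greater in \<open>auto simp: exp_profile_def\<close>)
  then show ?thesis using greater by (simp add: exp_profile_def power_add power2_eq_square mult.assoc)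
qed

text \<open>A class of functions containing a standard bump around \<open>c\<close>, closed under partial derivatives;
  this closure replaces iterated differentiation in the proof of smoothness.\<close>

inductive bump_class :: "'a::euclidean_space \<Rightarrow> real \<Rightarrow> ('a \<Rightarrow> real) \<Rightarrow> bool" for c :: 'a and d :: real where
  base: "bump_class c d (\<lambda>x. exp_profile m (d\<^sup>2 - (x - c) \<bullet> (x - c)))"
| mult: "bump_class c d f \<Longrightarrow> bump_class c d (\<lambda>x. ((x - c) \<bullet> b) * f x)"
| scale: "bump_class c d f \<Longrightarrow> bump_class c d (\<lambda>x. k * f x)"
| add: "bump_class c d f \<Longrightarrow> bump_class c d g \<Longrightarrow> bump_class c d (\<lambda>x. f x + g x)"

text \<open>The chain rule through d^2 - |x - c|^2 produces the linear factor (x - c) \<bullet> k;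
  the rule \<open>mult\<close> is in the class to absorb it.\<close>

lemma bump_class_derivative:
  assumes "bump_class c d f"
  shows "\<exists>f'. (\<forall>x. (f has_derivative f' x) (at x)) \<and> (\<forall>b. bump_class c d (\<lambda>x. f' x b))"
  using assms
proof induction
  case (base m)
  let ?P = "\<lambda>k x. exp_profile k (d\<^sup>2 - (x - c) \<bullet> (x - c))"
  let ?f' = "\<lambda>x k. (?P (m + 2) x - real m * ?P (m + 1) x) * (- 2 * ((x - c) \<bullet> k))"
  have A: "(?P m has_derivative ?f' x) (at x)" for x
  proof -
    have 1: "((\<lambda>x. d\<^sup>2 - (x - c) \<bullet> (x - c)) has_derivative (\<lambda>k. - 2 * ((x - c) \<bullet> k))) (at x)"
      by (auto intro!: derivative_eq_intros simp: inner_commute)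
    show ?thesis
      using has_derivative_compose[OF 1 exp_profile_deriv[of m "d\<^sup>2 - (x - c) \<bullet> (x - c)", unfolded has_field_derivative_def]]
      by simp
  qed
  have B: "bump_class c d (\<lambda>x. ?f' x b)" for b
  proof -
    have "bump_class c d (\<lambda>x. (- 2) * (((x - c) \<bullet> b) * (?P (m + 2) x + (- real m) * ?P (m + 1) x)))"
      by (intro bump_class.intros)
    then show ?thesis by (simp add: algebra_simps)
  qed
  show ?case by (intro exI[of _ ?f'] conjI allI A B)
next
  case (mult f b)
  then obtain f' where f': "\<And>x. (f has_derivative f' x) (at x)" "\<And>b. bump_class c d (\<lambda>x. f' x b)" by blast
  have "((\<lambda>x. ((x - c) \<bullet> b) * f x) has_derivative (\<lambda>k. ((x - c) \<bullet> b) * f' x k + (k \<bullet> b) * f x)) (at x)" for x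
    by (auto intro!: derivative_eq_intros f'(1))
  moreover have "bump_class c d (\<lambda>x. ((x - c) \<bullet> b) * f' x k + (k \<bullet> b) * f x)" for k
    by (intro bump_class.intros f' mult)
  ultimately show ?case by (intro exI[of _ "\<lambda>x k. ((x - c) \<bullet> b) * f' x k + (k \<bullet> b) * f x"]) blast
next
  case (scale f k)
  then obtain f' where f': "\<And>x. (f has_derivative f' x) (at x)" "\<And>b. bump_class c d (\<lambda>x. f' x b)" by blast
  have "((\<lambda>x. k * f x) has_derivative (\<lambda>h. k * f' x h)) (at x)" for x
    by (auto intro!: derivative_eq_intros f'(1))
  moreover have "bump_class c d (\<lambda>x. k * f' x h)" for h
    by (intro bump_class.intros f')
  ultimately show ?case by (intro exI[of _ "\<lambda>x h. k * f' x h"]) blast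
next
  case (add f g)
  then obtain f' g' where f': "\<And>x. (f has_derivative f' x) (at x)" "\<And>b. bump_class c d (\<lambda>x. f' x b)"
    and g': "\<And>x. (g has_derivative g' x) (at x)" "\<And>b. bump_class c d (\<lambda>x. g' x b)" by blast
  have "((\<lambda>x. f x + g x) has_derivative (\<lambda>h. f' x h + g' x h)) (at x)" for x
    by (auto intro!: derivative_eq_intros f'(1) g'(1))
  moreover have "bump_class c d (\<lambda>x. f' x h + g' x h)" for h
    by (intro bump_class.intros f' g')
  ultimately show ?case by (intro exI[of _ "\<lambda>x h. f' x h + g' x h"]) blast
qed

lemma bump_class_zero:
  assumes "bump_class c d f" "0 \<le> d" "d \<le> dist x c"
  shows "f x = 0"
  using assms(1)
proof induction
  case (base m)
  have "d\<^sup>2 \<le> (norm (x - c))\<^sup>2" using assms(2,3) by (intro power_mono) (auto simp: dist_norm)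
  then show ?case by (simp add: exp_profile_def power2_norm_eq_inner)
qed auto

lemma bump_class_continuous: "bump_class c d f \<Longrightarrow> continuous_on UNIV f"
  using bump_class_derivative[of c d f]
  by (metis continuous_at_imp_continuous_on has_derivative_continuous)

lemma bump_class_bounded:
  assumes f: "bump_class c d f" and d: "0 \<le> d"
  obtains K where "0 \<le> K" "\<And>x. \<bar>f x\<bar> \<le> K"
proof -
  have "compact (f ` cball c d)"
    by (intro compact_continuous_image continuous_on_subset[OF bump_class_continuous[OF f]]) auto
  then obtain K where "\<forall>y\<in>f ` cball c d. norm y \<le> K"
    using compact_imp_bounded bounded_iff by metis
  then have K: "\<bar>f x\<bar> \<le> K" if "x \<in> cball c d" for x using that by simp
  have "\<bar>f x\<bar> \<le> max K 0" for x
  proof (cases "x \<in> cball c d")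
    case True then show ?thesis using K[of x] by auto
  next
    case False
    then have "f x = 0" by (intro bump_class_zero[OF f d]) (auto simp: dist_commute)
    then show ?thesis by simp
  qed
  then show thesis by (intro that[of "max K 0"]) auto
qed

section \<open>Uniform Lipschitz and Taylor estimates for bumps\<close>

lemma linear_functional_bound:
  fixes g :: "'a::euclidean_space \<Rightarrow> real"
  assumes "linear g"
  shows "\<bar>g k\<bar> \<le> norm k * (\<Sum>b\<in>Basis. \<bar>g b\<bar>)"
proof -
  have "g k = (\<Sum>b\<in>Basis. (k \<bullet> b) * g b)"
    by (subst (1) euclidean_representation[of k, symmetric])
       (simp add: linear_sum[OF assms] linear_cmul[OF assms])
  also have "\<bar>\<dots>\<bar> \<le> (\<Sum>b\<in>Basis. \<bar>(k \<bullet> b) * g b\<bar>)" by (rule sum_abs)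
  also have "\<dots> \<le> (\<Sum>b\<in>Basis. norm k * \<bar>g b\<bar>)"
    by (intro sum_mono) (auto simp: abs_mult intro!: mult_right_mono Basis_le_norm)
  finally show ?thesis by (simp add: sum_distrib_left)
qed

lemma bump_class_lipschitz:
  assumes f: "bump_class c d f" and d: "0 \<le> d"
  obtains K where "0 \<le> K" "\<And>x y. \<bar>f x - f y\<bar> \<le> K * norm (x - y)"
proof -
  obtain f' where f': "\<And>x. (f has_derivative f' x) (at x)" "\<And>b. bump_class c d (\<lambda>x. f' x b)"
    using bump_class_derivative[OF f] by blast
  have "\<exists>K. 0 \<le> K \<and> (\<forall>x. \<bar>f' x b\<bar> \<le> K)" for b
    using bump_class_bounded[OF f'(2)[of b] d] by metis
  then obtain K where K: "\<And>b. 0 \<le> K b" "\<And>b x. \<bar>f' x b\<bar> \<le> K b" by metis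
  have "norm (f x - f y) \<le> (\<Sum>b\<in>Basis. K b) * norm (x - y)" for x y
  proof (rule differentiable_bound[where S=UNIV])
    show "(f has_derivative f' x) (at x within UNIV)" for x using f' by simp
    show "onorm (f' x) \<le> (\<Sum>b\<in>Basis. K b)" for x
    proof (rule onorm_le)
      fix k
      have "norm (f' x k) \<le> norm k * (\<Sum>b\<in>Basis. \<bar>f' x b\<bar>)"
        using linear_functional_bound[OF has_derivative_linear[OF f'(1)]] by simp
      also have "\<dots> \<le> norm k * (\<Sum>b\<in>Basis. K b)" by (intro mult_left_mono sum_mono K) auto
      finally show "norm (f' x k) \<le> (\<Sum>b\<in>Basis. K b) * norm k" by (simp add: mult.commute)
    qed
  qed auto
  then show thesis using K(1) by (intro that[of "\<Sum>b\<in>Basis. K b"]) (auto intro: sum_nonneg)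
qed

text \<open>Each partial derivative is again in the class, hence Lipschitz on the whole space. The
  remainder is therefore quadratic with one constant for all base points, as needed to differentiate
  under an integral.\<close>

lemma bump_class_taylor:
  assumes f: "bump_class c d f" and d: "0 \<le> d"
    and f': "\<And>x. (f has_derivative f' x) (at x)" "\<And>b. bump_class c d (\<lambda>x. f' x b)"
  obtains K where "0 \<le> K" "\<And>x k. \<bar>f (x + k) - f x - f' x k\<bar> \<le> K * (norm k)\<^sup>2"
proof -
  have "\<exists>K. 0 \<le> K \<and> (\<forall>x y. \<bar>f' x b - f' y b\<bar> \<le> K * norm (x - y))" for b
    using bump_class_lipschitz[OF f'(2)[of b] d] by metis
  then obtain K where K: "\<And>b. 0 \<le> K b" "\<And>b x y. \<bar>f' x b - f' y b\<bar> \<le> K b * norm (x - y)" by metis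
  have lin: "linear (f' x)" for x using f'(1) by (rule has_derivative_linear)
  have "\<bar>f (x + k) - f x - f' x k\<bar> \<le> (\<Sum>b\<in>Basis. K b) * (norm k)\<^sup>2" for x k
  proof -
    have "norm (f (x + k) - f x - f' x (x + k - x)) \<le> norm (x + k - x) * ((\<Sum>b\<in>Basis. K b) * norm k)"
    proof (rule differentiable_bound_linearization[where S="cball x (norm k)"])
      show "x + t *\<^sub>R (x + k - x) \<in> cball x (norm k)" if "t \<in> {0..1}" for t
        using that by (auto simp: dist_norm intro: mult_left_le_one_le)
      show "(f has_derivative f' y) (at y within cball x (norm k))" for y
        by (rule has_derivative_at_withinI[OF f'(1)])
      show "onorm (f' y - f' x) \<le> (\<Sum>b\<in>Basis. K b) * norm k" if "y \<in> cball x (norm k)" for y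
      proof (rule onorm_le)
        fix h
        have "linear (f' y - f' x)"
          using linear_compose_sub[OF lin[of y] lin[of x]] by (simp add: fun_diff_def)
        then have "norm ((f' y - f' x) h) \<le> norm h * (\<Sum>b\<in>Basis. \<bar>(f' y - f' x) b\<bar>)"
          using linear_functional_bound[of "f' y - f' x" h] by (simp only: real_norm_def)
        also have "\<dots> \<le> norm h * (\<Sum>b\<in>Basis. K b * norm k)"
        proof (intro mult_left_mono sum_mono)
          fix b
          have "\<bar>(f' y - f' x) b\<bar> \<le> K b * norm (y - x)" using K(2) by simp
          also have "\<dots> \<le> K b * norm k" using that K(1) by (intro mult_left_mono) (auto simp: dist_norm norm_minus_commute)
          finally show "\<bar>(f' y - f' x) b\<bar> \<le> K b * norm k" .
        qed auto
        finally show "norm ((f' y - f' x) h) \<le> (\<Sum>b\<in>Basis. K b) * norm k * norm h"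
          by (simp add: sum_distrib_left sum_distrib_right mult_ac)
      qed
    qed auto
    then show ?thesis by (simp add: power2_eq_square mult_ac)
  qed
  then show thesis using K(1) by (intro that[of "\<Sum>b\<in>Basis. K b"]) (auto intro: sum_nonneg)
qed

section \<open>Smoothness of the convolution of an integrable function with a bump\<close>

lemma integrable_mult_bump:
  assumes v: "integrable lborel v" and f: "bump_class c d f" and d: "0 \<le> d"
  shows "integrable lborel (\<lambda>y. v y * f (x - y))"
proof -
  obtain K where K: "0 \<le> K" "\<And>x. \<bar>f x\<bar> \<le> K" using bump_class_bounded[OF f d] by blast
  have [measurable]: "f \<in> borel_measurable borel" "v \<in> borel_measurable borel"
    using bump_class_continuous[OF f] borel_measurable_integrable[OF v]
    by (auto intro: borel_measurable_continuous_onI)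
  show ?thesis
    by (rule Bochner_Integration.integrable_bound[OF integrable_mult_right[OF v, of K]])
       (use K(1) in \<open>auto intro!: AE_I2 mult_left_mono K(2) simp: abs_mult mult.commute[of K]\<close>)
qed

text \<open>The uniform Taylor remainder integrates against |v| to at most \<open>I * K\<close>
  times |k|^2, with \<open>I\<close> the L1 norm of v. Divided by |k| this tends to 0, so
  integrability of v suffices.\<close>

lemma convolution_bump_has_derivative:
  assumes v: "integrable lborel v" and f: "bump_class c d f" and d: "0 \<le> d"
    and f': "\<And>x. (f has_derivative f' x) (at x)" "\<And>b. bump_class c d (\<lambda>x. f' x b)"
  shows "((\<lambda>x. \<integral>y. v y * f (x - y) \<partial>lborel) has_derivative
      (\<lambda>k. \<integral>y. v y * f' (x - y) k \<partial>lborel)) (at x)"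
proof -
  note int = integrable_mult_bump[OF v f d] integrable_mult_bump[OF v f'(2) d]
  have lin: "linear (f' x)" for x using f'(1) by (rule has_derivative_linear)
  obtain K where K: "0 \<le> K" "\<And>x k. \<bar>f (x + k) - f x - f' x k\<bar> \<le> K * (norm k)\<^sup>2"
    using bump_class_taylor[OF f d f'] by blast
  define I where "I = (\<integral>y. \<bar>v y\<bar> \<partial>lborel)"
  have "linear (\<lambda>k. \<integral>y. v y * f' (x - y) k \<partial>lborel)"
    by (rule linearI)
       (simp_all add: linear_add[OF lin] linear_cmul[OF lin] distrib_left int mult.left_commute
        flip: Bochner_Integration.integral_add)
  then have bl: "bounded_linear (\<lambda>k. \<integral>y. v y * f' (x - y) k \<partial>lborel)"
    by (simp add: linear_conv_bounded_linear)
  have est: "norm ((\<integral>y. v y * f (x + k - y) \<partial>lborel) - (\<integral>y. v y * f (x - y) \<partial>lborel) -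
      (\<integral>y. v y * f' (x - y) k \<partial>lborel)) / norm k \<le> I * K * norm k" for k
  proof -
    have "(\<integral>y. v y * f (x + k - y) \<partial>lborel) - (\<integral>y. v y * f (x - y) \<partial>lborel) - (\<integral>y. v y * f' (x - y) k \<partial>lborel)
       = (\<integral>y. v y * (f (x - y + k) - f (x - y) - f' (x - y) k) \<partial>lborel)"
      using int(1)[of "x + k"] int(1)[of x] int(2)[of x k]
      by (simp add: right_diff_distrib algebra_simps)
    also have "norm \<dots> \<le> (\<integral>y. \<bar>v y\<bar> * (K * (norm k)\<^sup>2) \<partial>lborel)"
    proof (rule order_trans[OF integral_norm_bound], rule integral_mono)
      have "integrable lborel (\<lambda>y. v y * f (x + k - y) - v y * f (x - y) - v y * f' (x - y) k)"
        using int(1)[of "x + k"] int(1)[of x] int(2)[of x k] by auto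
      then show "integrable lborel (\<lambda>y. norm (v y * (f (x - y + k) - f (x - y) - f' (x - y) k)))"
        by (intro integrable_norm) (simp add: algebra_simps)
      show "integrable lborel (\<lambda>y. \<bar>v y\<bar> * (K * (norm k)\<^sup>2))" using v by auto
      show "norm (v y * (f (x - y + k) - f (x - y) - f' (x - y) k)) \<le> \<bar>v y\<bar> * (K * (norm k)\<^sup>2)" for y
        using K(2)[of "x - y" k] by (simp add: abs_mult mult_left_mono)
    qed
    also have "\<dots> = I * (K * (norm k)\<^sup>2)" by (simp add: I_def)
    finally show ?thesis
      by (cases "k = 0") (simp_all add: divide_simps power2_eq_square mult_ac)
  qed
  have lim: "((\<lambda>k. I * K * norm k) \<longlongrightarrow> 0) (at (0::'a))"
    using tendsto_norm[OF tendsto_ident_at[of "0::'a" UNIV]] by (intro tendsto_mult_right_zero) simp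
  show ?thesis
    unfolding has_derivative_at
    by (intro conjI bl tendsto_sandwich[OF _ _ tendsto_const lim] always_eventually allI est) simp_all
qed

lemma Ck_convolution_bump:
  assumes v: "integrable lborel v" and d: "0 \<le> d"
  shows "bump_class c d f \<Longrightarrow> Ck k (\<lambda>x. \<integral>y. v y * f (x - y) \<partial>lborel)"
proof (induction k arbitrary: f)
  case 0
  obtain f' where f': "\<And>x. (f has_derivative f' x) (at x)" "\<And>b. bump_class c d (\<lambda>x. f' x b)"
    using bump_class_derivative[OF 0] by blast
  show ?case
    using convolution_bump_has_derivative[OF v 0 d f']
    by (auto intro!: continuous_at_imp_continuous_on has_derivative_continuous)
next
  case (Suc k)
  obtain f' where f': "\<And>x. (f has_derivative f' x) (at x)" "\<And>b. bump_class c d (\<lambda>x. f' x b)"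
    using bump_class_derivative[OF Suc.prems] by blast
  note D = convolution_bump_has_derivative[OF v Suc.prems d f']
  have fd: "frechet_derivative (\<lambda>x. \<integral>y. v y * f (x - y) \<partial>lborel) (at x) = (\<lambda>k. \<integral>y. v y * f' (x - y) k \<partial>lborel)" for x
    using frechet_derivative_at[OF D] by simp
  have "continuous_on UNIV (\<lambda>x. \<integral>y. v y * f (x - y) \<partial>lborel)"
    using D by (auto intro!: continuous_at_imp_continuous_on has_derivative_continuous)
  moreover have "\<forall>x. (\<lambda>x. \<integral>y. v y * f (x - y) \<partial>lborel) differentiable (at x)"
    using D unfolding differentiable_def by blast
  ultimately show ?case using Suc.IH[OF f'(2)] by (simp add: fd)
qed

lemma lborel_integral_reflect:
  fixes f :: "'a::euclidean_space \<Rightarrow> real"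
  assumes [measurable]: "f \<in> borel_measurable borel"
  shows "(\<integral>y. f (c - y) \<partial>lborel) = (\<integral>y. f y \<partial>lborel)"
proof -
  have "(lborel :: 'a measure) = distr lborel borel (\<lambda>x. c + (-1) *\<^sub>R x)"
    by (subst lborel_affine[of "-1" c]) (auto simp: density_1)
  then have "(\<integral>y. f y \<partial>lborel) = (\<integral>y. f y \<partial>distr lborel borel (\<lambda>x. c + (-1) *\<^sub>R x))" by simp
  also have "\<dots> = (\<integral>y. f (c - y) \<partial>lborel)" by (subst integral_distr) auto
  finally show ?thesis by simp
qed

text \<open>The bump of level 0, normalised to mass 1. The centre is a parameter because it will be
  the shift that moves a support into the domain.\<close>

lemma smooth_mollifier:
  fixes c :: "'a::euclidean_space"
  assumes d: "0 < d"
  obtains \<rho> :: "'a \<Rightarrow> real" where "\<And>h. 0 \<le> \<rho> h" "integrable lborel \<rho>" "(\<integral>h. \<rho> h \<partial>lborel) = 1"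
    "\<And>h. \<rho> h \<noteq> 0 \<Longrightarrow> dist h c < d"
    "\<And>v. integrable lborel v \<Longrightarrow> smooth_fun (\<lambda>x. \<integral>h. \<rho> h * v (x - h) \<partial>lborel)"
proof -
  define \<eta> where "\<eta> = (\<lambda>x. exp_profile 0 (d\<^sup>2 - (x - c) \<bullet> (x - c)))"
  have \<eta>: "bump_class c d \<eta>" unfolding \<eta>_def by (rule bump_class.base)
  have d0: "0 \<le> d" using d by simp
  have [measurable]: "\<eta> \<in> borel_measurable borel"
    using bump_class_continuous[OF \<eta>] by (rule borel_measurable_continuous_onI)
  have nn: "0 \<le> \<eta> x" for x by (simp add: \<eta>_def exp_profile_def)
  have pos: "0 < \<eta> x" if "x \<in> ball c d" for x
  proof -
    have "(norm (x - c))\<^sup>2 < d\<^sup>2" using that d by (intro power_strict_mono) (auto simp: dist_norm norm_minus_commute)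
    then show ?thesis by (simp add: \<eta>_def exp_profile_def power2_norm_eq_inner)
  qed
  obtain K where K: "0 \<le> K" "\<And>x. \<bar>\<eta> x\<bar> \<le> K" using bump_class_bounded[OF \<eta> d0] by blast
  have int: "integrable lborel \<eta>"
  proof (rule Bochner_Integration.integrable_bound[where f="\<lambda>x. K * indicator (cball c d) x"])
    show "integrable lborel (\<lambda>x. K * indicat_real (cball c d) x)"
      by (intro integrable_mult_right integrable_real_indicator) (auto intro!: emeasure_bounded_finite[unfolded infinity_ennreal_def])
    show "AE x in lborel. norm (\<eta> x) \<le> norm (K * indicat_real (cball c d) x)"
      using K bump_class_zero[OF \<eta> d0] by (intro AE_I2) (auto split: split_indicator simp: dist_commute)
  qed simp
  define I where "I = (\<integral>x. \<eta> x \<partial>lborel)"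
  \<comment> \<open>A zero integral of the nonnegative bump would make the ball on which it is
    positive a null set.\<close>
  have "I \<noteq> 0"
  proof
    assume "I = 0"
    then have "AE x in lborel. \<eta> x = 0"
      using integral_nonneg_eq_0_iff_AE[OF int] nn by (simp add: I_def)
    then have "AE x in lborel. x \<notin> ball c d" by eventually_elim (use pos in fastforce)
    then have "emeasure lborel (ball c d) = 0" by (subst (asm) AE_iff_measurable[where N="ball c d"]) auto
    then show False using d open_not_negligible[of "ball c d"]
      by (auto simp: negligible_iff_emeasure0)
  qed
  moreover have "I \<ge> 0" unfolding I_def using nn by simp
  ultimately have I: "I > 0" by simp
  define \<rho> where "\<rho> = (\<lambda>x. (1 / I) * \<eta> x)"
  have \<rho>: "bump_class c d \<rho>" unfolding \<rho>_def using \<eta> by (rule bump_class.scale)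
  have [measurable]: "\<rho> \<in> borel_measurable borel" unfolding \<rho>_def by measurable
  show thesis
  proof (rule that[of \<rho>])
    show "0 \<le> \<rho> h" for h using nn I by (simp add: \<rho>_def)
    show "integrable lborel \<rho>" using int by (simp add: \<rho>_def)
    show "(\<integral>h. \<rho> h \<partial>lborel) = 1" using I by (simp add: \<rho>_def I_def[symmetric])
    show "dist h c < d" if "\<rho> h \<noteq> 0" for h
      using bump_class_zero[OF \<rho> d0, of h] that by force
    fix v :: "'a \<Rightarrow> real" assume v: "integrable lborel v"
    have [measurable]: "v \<in> borel_measurable borel" using borel_measurable_integrable[OF v] by simp
    \<comment> \<open>The reflection y = x - h moves the dependence on x from v, which is merely
      integrable, to the bump.\<close>
    have eq: "(\<integral>h. \<rho> h * v (x - h) \<partial>lborel) = (\<integral>y. v y * \<rho> (x - y) \<partial>lborel)" for x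
      using lborel_integral_reflect[of "\<lambda>h. \<rho> h * v (x - h)" x] by (simp add: mult.commute)
    show "smooth_fun (\<lambda>x. \<integral>h. \<rho> h * v (x - h) \<partial>lborel)"
      unfolding smooth_fun_def eq using Ck_convolution_bump[OF v d0 \<rho>] by blast
  qed
qed

text \<open>Near a boundary point the shift is against the distinguished direction of the local subgraph.\<close>

lemma continuous_boundary_shift:
  fixes \<Omega> :: "'a::euclidean_space set"
  assumes op: "open \<Omega>" and cb: "continuous_boundary \<Omega>" and x: "x \<in> closure \<Omega>"
  obtains r where "r > 0"
    "\<And>\<tau>. \<tau> > 0 \<Longrightarrow> \<exists>h. norm h < \<tau> \<and> (\<forall>y \<in> cball x (2 * r) \<inter> closure \<Omega>. y + h \<in> \<Omega>)"
proof (cases "x \<in> \<Omega>")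
  case True
  then obtain e where e: "e > 0" "cball x e \<subseteq> \<Omega>" using op open_contains_cball by blast
  show thesis
  proof (rule that[of "e / 2"])
    fix \<tau> :: real assume "\<tau> > 0"
    then show "\<exists>h. norm h < \<tau> \<and> (\<forall>y \<in> cball x (2 * (e / 2)) \<inter> closure \<Omega>. y + h \<in> \<Omega>)"
      using e by (intro exI[of _ 0]) auto
  qed (use e in auto)
next
  case False
  then have fr: "x \<in> frontier \<Omega>" using x op by (simp add: frontier_def interior_open)
  obtain M :: nat and W O' xi R b where *:
    "\<forall>j<M. open (W j)" "frontier \<Omega> \<subseteq> (\<Union>j<M. W j)"
    "\<forall>j<M. b j \<in> Basis \<and> continuous_on UNIV (xi j) \<and> (\<forall>x t. xi j (x + t *\<^sub>R b j) = xi j x) \<and>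
       rigid_motion (R j) \<and> R j ` (O' j) = subgraph_region (b j) (xi j) \<and> W j \<inter> \<Omega> = W j \<inter> O' j"
    using cb unfolding continuous_boundary_def
    by (elim exE conjE) (rule that; assumption)
  obtain j where j: "j < M" "x \<in> W j" using fr *(2) by auto
  define b' xi' R' P where defs: "b' = b j" "xi' = xi j" "R' = R j" "P = O' j"
  have W: "open (W j)" and b: "b' \<in> Basis" and xi: "continuous_on UNIV xi'" "\<And>x t. xi' (x + t *\<^sub>R b') = xi' x"
    and R: "rigid_motion R'" "R' ` P = subgraph_region b' xi'" and WP: "W j \<inter> \<Omega> = W j \<inter> P"
    using * j unfolding defs by auto
  have iso: "dist (R' y) (R' z) = dist y z" for y z using R(1) by (simp add: rigid_motion_def)
  have inj: "y = z" if "R' y = R' z" for y z using iso[of y z] that by simp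
  \<comment> \<open>A rigid motion is given only as a map preserving distances. Subtracting its
    value at 0 gives an orthogonal map, hence linearity and, in finite dimension,
    surjectivity.\<close>
  define L where "L y = R' y - R' 0" for y
  have orth: "orthogonal_transformation L"
    unfolding orthogonal_transformation_isometry L_def using iso by (simp add: dist_norm)
  then have lin: "linear L" by (rule orthogonal_transformation_linear)
  \<comment> \<open>The vertical direction of the graph in the original coordinates: moving by -t e
    lowers the distinguished coordinate by t and leaves the value of \<open>xi'\<close>
    unchanged.\<close>
  obtain e where e: "L e = b'" using orthogonal_transformation_surj[OF orth] by (metis surjD)
  have shift: "R' (y + t *\<^sub>R e) = R' y + t *\<^sub>R b'" for y t
    using linear_add[OF lin, of y "t *\<^sub>R e"] linear_cmul[OF lin, of t e] e by (simp add: L_def algebra_simps)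
  have ne: "norm e = 1" using orthogonal_transformation_norm[OF orth, of e] e b by simp
  have Rcont: "continuous_on UNIV R'"
    unfolding continuous_on_iff using iso by auto
  obtain q where q: "q > 0" "cball x q \<subseteq> W j" using W j(2) open_contains_cball by blast
  \<comment> \<open>Closure points satisfy the subgraph condition with \<le>, by continuity; any
    positive downward shift makes it strict.\<close>
  have below: "R' y \<bullet> b' \<le> xi' (R' y)" if "y \<in> cball x (q/2) \<inter> closure \<Omega>" for y
  proof -
    have cl: "closed {y. R' y \<bullet> b' \<le> xi' (R' y)}"
      by (intro closed_Collect_le continuous_intros continuous_on_compose2[OF xi(1)] Rcont) auto
    have "y \<in> ball x q" using that q by auto
    then have "y \<in> ball x q \<inter> closure \<Omega>" using that by auto
    then have "y \<in> closure (ball x q \<inter> \<Omega>)" using open_Int_closure_subset[of "ball x q" \<Omega>] by auto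
    moreover have "ball x q \<inter> \<Omega> \<subseteq> {y. R' y \<bullet> b' \<le> xi' (R' y)}"
    proof
      fix z assume "z \<in> ball x q \<inter> \<Omega>"
      then have "z \<in> W j \<inter> \<Omega>" using q(2) by auto
      then have "R' z \<in> subgraph_region b' xi'" using WP R(2) by blast
      then show "z \<in> {y. R' y \<bullet> b' \<le> xi' (R' y)}" by (simp add: subgraph_region_def)
    qed
    ultimately show ?thesis using closure_minimal[OF _ cl] by blast
  qed
  show thesis
  \<comment> \<open>The region in question has radius 2 (q/4) = q/2 and the shift has length at most
    q/2. The shifted points stay in cball x q, inside \<open>W j\<close>, where \<Omega> and the
    subgraph region agree.\<close>
  proof (rule that[of "q / 4"])
    fix \<tau> :: real assume \<tau>: "\<tau> > 0"
    define t where "t = min (\<tau> / 2) (q / 2)"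
    have t: "t > 0" "t < \<tau>" "t \<le> q / 2" using \<tau> q by (auto simp: t_def)
    show "\<exists>h. norm h < \<tau> \<and> (\<forall>y \<in> cball x (2 * (q / 4)) \<inter> closure \<Omega>. y + h \<in> \<Omega>)"
    proof (intro exI[of _ "(- t) *\<^sub>R e"] conjI ballI)
      show "norm ((- t) *\<^sub>R e) < \<tau>" using t ne by simp
      fix y assume y: "y \<in> cball x (2 * (q / 4)) \<inter> closure \<Omega>"
      then have "R' y \<bullet> b' \<le> xi' (R' y)" using below by simp
      then have "R' (y + (- t) *\<^sub>R e) \<in> subgraph_region b' xi'"
        using t(1) b unfolding shift subgraph_region_def mem_Collect_eq xi(2) by (simp add: inner_diff_left)
      then obtain z where "z \<in> P" "R' z = R' (y + (- t) *\<^sub>R e)" using R(2) by (metis imageE)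
      then have P: "y + (- t) *\<^sub>R e \<in> P" using inj by metis
      have "dist x (y + (- t) *\<^sub>R e) \<le> dist x y + dist y (y + (- t) *\<^sub>R e)" by (rule dist_triangle)
      also have "\<dots> \<le> q" using y t ne by (simp add: dist_norm)
      finally have "y + (- t) *\<^sub>R e \<in> W j" using q(2) by auto
      with P WP show "y + (- t) *\<^sub>R e \<in> \<Omega>" by blast
    qed
  qed (use q in auto)
qed

section \<open>Density for a pair of modulars\<close>

lemma Ck_continuous: "Ck k f \<Longrightarrow> continuous_on UNIV f"
  by (cases k) auto

lemma Ck_zero: "Ck k (\<lambda>_. 0)"
  by (induction k) (auto simp: frechet_derivative_const)

lemma Ck_add: "Ck k f \<Longrightarrow> Ck k g \<Longrightarrow> Ck k (\<lambda>x. f x + g x)"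
proof (induction k arbitrary: f g)
  case (Suc k)
  have "frechet_derivative (\<lambda>x. f x + g x) (at x) =
      (\<lambda>h. frechet_derivative f (at x) h + frechet_derivative g (at x) h)" for x
    using Suc.prems
    by (intro frechet_derivative_at[symmetric] has_derivative_add) (auto simp: frechet_derivative_works)
  then show ?case using Suc by (auto intro!: continuous_intros)
qed (auto intro: continuous_intros)

lemma C0_infty_measurable: "\<phi> \<in> C0_infty \<Omega> \<Longrightarrow> \<phi> \<in> borel_measurable borel"
  unfolding C0_infty_def smooth_fun_def
  by (auto intro!: borel_measurable_continuous_onI Ck_continuous)

lemma C0_infty_intro:
  assumes "smooth_fun \<phi>" "compact S" "S \<subseteq> \<Omega>" "\<And>x. \<phi> x \<noteq> 0 \<Longrightarrow> x \<in> S"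
  shows "\<phi> \<in> C0_infty \<Omega>"
proof -
  have "closure {x. \<phi> x \<noteq> 0} \<subseteq> S"
    using assms by (intro closure_minimal) (auto intro: compact_imp_closed)
  then show ?thesis using assms unfolding C0_infty_def
    by (auto intro: compact_closure[THEN iffD2] bounded_subset[OF compact_imp_bounded]
        order_trans[OF closure_subset])
qed

lemma C0_infty_zero: "(\<lambda>_. 0) \<in> C0_infty \<Omega>"
  by (rule C0_infty_intro[of _ "{}"]) (auto simp: smooth_fun_def Ck_zero)

lemma C0_infty_add:
  assumes "\<phi> \<in> C0_infty \<Omega>" "\<psi> \<in> C0_infty \<Omega>"
  shows "(\<lambda>x. \<phi> x + \<psi> x) \<in> C0_infty \<Omega>"
proof (rule C0_infty_intro[of _ "closure {x. \<phi> x \<noteq> 0} \<union> closure {x. \<psi> x \<noteq> 0}"])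
  fix x assume "\<phi> x + \<psi> x \<noteq> 0"
  then have "x \<in> {x. \<phi> x \<noteq> 0} \<union> {x. \<psi> x \<noteq> 0}" by auto
  then show "x \<in> closure {x. \<phi> x \<noteq> 0} \<union> closure {x. \<psi> x \<noteq> 0}"
    using closure_subset[of "{x. \<phi> x \<noteq> 0}"] closure_subset[of "{x. \<psi> x \<noteq> 0}"] by blast
qed (use assms in \<open>auto simp: C0_infty_def smooth_fun_def Ck_add intro: compact_Un\<close>)

locale modular_pair = loc: nonlocal_modular B0 0 C + glob: nonlocal_modular B1 1 C
  for B0 B1 :: "'a::euclidean_space \<Rightarrow> real \<Rightarrow> real" and C :: real
begin

text \<open>One energy for both modulars, since a single test function has to approximate in
  both.\<close>

definition E :: "('a \<Rightarrow> real) \<Rightarrow> ennreal" where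
  "E v = loc.\<Phi> v + glob.\<Phi> v"

lemma E_add:
  assumes "v \<in> borel_measurable borel" "w \<in> borel_measurable borel"
  shows "E (\<lambda>x. v x + w x) \<le> ennreal C * (E v + E w)"
  using add_mono[OF loc.\<Phi>_add[OF assms] glob.\<Phi>_add[OF assms]]
  by (simp add: E_def distrib_left add_ac)

lemma E_less_top: "E v < \<infinity> \<longleftrightarrow> loc.\<Phi> v < \<infinity> \<and> glob.\<Phi> v < \<infinity>"
  by (simp add: E_def)

definition approximable :: "'a set \<Rightarrow> ('a \<Rightarrow> real) \<Rightarrow> bool" where
  "approximable \<Omega> v \<longleftrightarrow> v \<in> borel_measurable borel \<and>
     (\<forall>e>0. \<exists>\<phi>\<in>C0_infty \<Omega>. E (\<lambda>x. v x - \<phi> x) < ennreal e)"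

text \<open>What truncation achieves and \<open>multiplier_dominated\<close> requires. Boundedness
  and finite measure of the support also give integrability, which translations and mollification
  use. The function vanishes at every point outside \<Omega>, not just almost everywhere, because
  supports are handled pointwise.\<close>

definition tame :: "'a set \<Rightarrow> ('a \<Rightarrow> real) \<Rightarrow> bool" where
  "tame \<Omega> v \<longleftrightarrow> v \<in> borel_measurable borel \<and> (\<exists>M. \<forall>x. \<bar>v x\<bar> \<le> M) \<and>
     emeasure lborel {x. v x \<noteq> 0} < \<infinity> \<and> E v < \<infinity> \<and> (\<forall>x. x \<notin> \<Omega> \<longrightarrow> v x = 0)"

text \<open>The 3 in \<open>3 * C\<close> leaves room: the two errors together give 2e/3, strictly
  below e.\<close>

lemma E_add_less:
  assumes "v \<in> borel_measurable borel" "w \<in> borel_measurable borel" and e: "0 < e"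
    and "E v < ennreal (e / (3 * C))" "E w < ennreal (e / (3 * C))"
  shows "E (\<lambda>x. v x + w x) < ennreal e"
proof -
  have C: "1 \<le> C" by (rule loc.C_ge_1)
  have "E (\<lambda>x. v x + w x) \<le> ennreal C * (E v + E w)" by (rule E_add) fact+
  also have "\<dots> \<le> ennreal C * (ennreal (e / (3 * C)) + ennreal (e / (3 * C)))"
    using assms by (intro mult_left_mono add_mono) auto
  also have "\<dots> = ennreal (C * (e / (3 * C) + e / (3 * C)))"
    using C e by (simp flip: ennreal_plus ennreal_mult)
  also have "\<dots> < ennreal e" using C e by (intro ennreal_lessI) (auto simp: field_simps)
  finally show ?thesis .
qed

lemma approximable_zero: "approximable \<Omega> (\<lambda>_. 0)"
proof -
  have "E (\<lambda>_. 0) = 0" by (simp add: E_def loc.\<Phi>_def glob.\<Phi>_def loc.J_def glob.J_def)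
  then show ?thesis unfolding approximable_def
    by (intro conjI allI impI bexI[OF _ C0_infty_zero]) auto
qed

lemma approximable_add:
  assumes v: "approximable \<Omega> v" and w: "approximable \<Omega> w"
  shows "approximable \<Omega> (\<lambda>x. v x + w x)"
  unfolding approximable_def
proof (intro conjI allI impI)
  have [measurable]: "v \<in> borel_measurable borel" "w \<in> borel_measurable borel"
    using v w by (auto simp: approximable_def)
  show "(\<lambda>x. v x + w x) \<in> borel_measurable borel" by measurable
  fix e :: real assume e: "e > 0"
  then have "e / (3 * C) > 0" using loc.C_ge_1 by simp
  then obtain \<phi> \<psi> where \<phi>: "\<phi> \<in> C0_infty \<Omega>" "E (\<lambda>x. v x - \<phi> x) < ennreal (e / (3 * C))"
    and \<psi>: "\<psi> \<in> C0_infty \<Omega>" "E (\<lambda>x. w x - \<psi> x) < ennreal (e / (3 * C))"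
    using v w unfolding approximable_def by blast
  note [measurable] = C0_infty_measurable[OF \<phi>(1)] C0_infty_measurable[OF \<psi>(1)]
  have "E (\<lambda>x. (v x - \<phi> x) + (w x - \<psi> x)) < ennreal e"
    by (intro E_add_less \<phi> \<psi> e) measurable
  then show "\<exists>\<phi>\<in>C0_infty \<Omega>. E (\<lambda>x. v x + w x - \<phi> x) < ennreal e"
    by (intro bexI[OF _ C0_infty_add[OF \<phi>(1) \<psi>(1)]]) (simp add: algebra_simps)
qed

lemma approximable_limit:
  assumes v [measurable]: "v \<in> borel_measurable borel"
    and w: "\<And>n. approximable \<Omega> (w n)" and lim: "(\<lambda>n. E (\<lambda>x. v x - w n x)) \<longlonglongrightarrow> 0"
  shows "approximable \<Omega> v"
  unfolding approximable_def
proof (intro conjI allI impI v)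
  have wm [measurable]: "w n \<in> borel_measurable borel" for n using w by (auto simp: approximable_def)
  fix e :: real assume e: "e > 0"
  then have e': "e / (3 * C) > 0" using loc.C_ge_1 by simp
  then have "eventually (\<lambda>n. E (\<lambda>x. v x - w n x) < ennreal (e / (3 * C))) sequentially"
    using lim unfolding tendsto_zero_ennreal_iff by blast
  then obtain n where n: "E (\<lambda>x. v x - w n x) < ennreal (e / (3 * C))"
    by (auto simp: eventually_sequentially)
  obtain \<phi> where \<phi>: "\<phi> \<in> C0_infty \<Omega>" "E (\<lambda>x. w n x - \<phi> x) < ennreal (e / (3 * C))"
    using w[of n] e' unfolding approximable_def by blast
  note [measurable] = C0_infty_measurable[OF \<phi>(1)]
  have "E (\<lambda>x. (v x - w n x) + (w n x - \<phi> x)) < ennreal e"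
    by (intro E_add_less \<phi> n e) measurable
  then show "\<exists>\<phi>\<in>C0_infty \<Omega>. E (\<lambda>x. v x - \<phi> x) < ennreal e"
    by (intro bexI[OF _ \<phi>(1)]) simp
qed

lemma tame_multiplier:
  assumes v: "tame \<Omega> v" and \<psi> [measurable]: "\<psi> \<in> borel_measurable borel"
    and \<psi>1: "\<And>x. \<bar>\<psi> x\<bar> \<le> 1" and \<psi>L: "\<And>x y. \<bar>\<psi> x - \<psi> y\<bar> \<le> L * norm (x - y)" and L: "0 \<le> L"
  shows "tame \<Omega> (\<lambda>x. \<psi> x * v x)"
proof -
  obtain M where M: "\<And>x. \<bar>v x\<bar> \<le> M" using v by (auto simp: tame_def)
  have vm [measurable]: "v \<in> borel_measurable borel" and supp: "emeasure lborel {x. v x \<noteq> 0} < \<infinity>"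
    and fin: "loc.\<Phi> v < \<infinity>" "glob.\<Phi> v < \<infinity>"
    using v by (auto simp: tame_def E_def)
  have "\<bar>\<psi> x * v x\<bar> \<le> M" for x
    using mult_mono[OF \<psi>1[of x] M[of x]] by (simp add: abs_mult)
  moreover have "emeasure lborel {x. \<psi> x * v x \<noteq> 0} < \<infinity>"
    by (rule le_less_trans[OF emeasure_mono supp]) auto
  moreover have "loc.\<Phi> (\<lambda>x. \<psi> x * v x) < \<infinity>"
  proof (rule loc.multiplier_dominated[OF vm M supp fin(1) L])
    fix D :: "'a \<times> 'a \<Rightarrow> real"
    assume D: "(\<integral>\<^sup>+p. ennreal (D p) \<partial>lborel) < \<infinity>"
      "\<And>\<psi> p. (\<And>x. \<bar>\<psi> x\<bar> \<le> 1) \<Longrightarrow> (\<And>x y. \<bar>\<psi> x - \<psi> y\<bar> \<le> L * norm (x - y)) \<Longrightarrow> loc.J (\<lambda>x. \<psi> x * v x) p \<le> D p"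
    have "loc.\<Phi> (\<lambda>x. \<psi> x * v x) \<le> (\<integral>\<^sup>+p. ennreal (D p) \<partial>lborel)"
      unfolding loc.\<Phi>_def using D(2)[of \<psi>] \<psi>1 \<psi>L by (intro nn_integral_mono ennreal_leI) auto
    then show ?thesis using D(1) by simp
  qed
  moreover have "glob.\<Phi> (\<lambda>x. \<psi> x * v x) < \<infinity>"
  proof (rule glob.multiplier_dominated[OF vm M supp fin(2) L])
    fix D :: "'a \<times> 'a \<Rightarrow> real"
    assume D: "(\<integral>\<^sup>+p. ennreal (D p) \<partial>lborel) < \<infinity>"
      "\<And>\<psi> p. (\<And>x. \<bar>\<psi> x\<bar> \<le> 1) \<Longrightarrow> (\<And>x y. \<bar>\<psi> x - \<psi> y\<bar> \<le> L * norm (x - y)) \<Longrightarrow> glob.J (\<lambda>x. \<psi> x * v x) p \<le> D p"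
    have "glob.\<Phi> (\<lambda>x. \<psi> x * v x) \<le> (\<integral>\<^sup>+p. ennreal (D p) \<partial>lborel)"
      unfolding glob.\<Phi>_def using D(2)[of \<psi>] \<psi>1 \<psi>L by (intro nn_integral_mono ennreal_leI) auto
    then show ?thesis using D(1) by simp
  qed
  moreover have "\<forall>x. x \<notin> \<Omega> \<longrightarrow> \<psi> x * v x = 0" using v by (simp add: tame_def)
  ultimately show ?thesis unfolding tame_def E_less_top by (intro conjI exI[of _ M]) auto
qed

lemma E_multiplier_tendsto:
  assumes v: "tame \<Omega> v" and \<psi> [measurable]: "\<And>n. \<psi> n \<in> borel_measurable borel"
    and \<psi>1: "\<And>n x. \<bar>\<psi> n x\<bar> \<le> 1" and \<psi>L: "\<And>n x y. \<bar>\<psi> n x - \<psi> n y\<bar> \<le> L * norm (x - y)"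
    and L: "0 \<le> L" and lim: "\<And>x. (\<lambda>n. \<psi> n x) \<longlonglongrightarrow> 0"
  shows "(\<lambda>n. E (\<lambda>x. \<psi> n x * v x)) \<longlonglongrightarrow> 0"
proof -
  obtain M where M: "\<And>x. \<bar>v x\<bar> \<le> M" using v by (auto simp: tame_def)
  have vm [measurable]: "v \<in> borel_measurable borel" and supp: "emeasure lborel {x. v x \<noteq> 0} < \<infinity>"
    and fin: "loc.\<Phi> v < \<infinity>" "glob.\<Phi> v < \<infinity>"
    using v by (auto simp: tame_def E_def)
  have lim': "(\<lambda>n. \<psi> n x * v x) \<longlonglongrightarrow> 0" for x
    by (intro tendsto_mult_left_zero lim)
  have "(\<lambda>n. loc.\<Phi> (\<lambda>x. \<psi> n x * v x)) \<longlonglongrightarrow> 0"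
  proof (rule loc.multiplier_dominated[OF vm M supp fin(1) L])
    fix D :: "'a \<times> 'a \<Rightarrow> real"
    assume D: "D \<in> borel_measurable borel" "(\<integral>\<^sup>+p. ennreal (D p) \<partial>lborel) < \<infinity>"
      "\<And>\<psi> p. (\<And>x. \<bar>\<psi> x\<bar> \<le> 1) \<Longrightarrow> (\<And>x y. \<bar>\<psi> x - \<psi> y\<bar> \<le> L * norm (x - y)) \<Longrightarrow> loc.J (\<lambda>x. \<psi> x * v x) p \<le> D p"
    show ?thesis
      by (rule loc.\<Phi>_tendsto_zero[OF _ D(1,2)]) (auto intro!: D(3) \<psi>1 \<psi>L lim' borel_measurable_times \<psi> vm)
  qed
  moreover have "(\<lambda>n. glob.\<Phi> (\<lambda>x. \<psi> n x * v x)) \<longlonglongrightarrow> 0"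
  proof (rule glob.multiplier_dominated[OF vm M supp fin(2) L])
    fix D :: "'a \<times> 'a \<Rightarrow> real"
    assume D: "D \<in> borel_measurable borel" "(\<integral>\<^sup>+p. ennreal (D p) \<partial>lborel) < \<infinity>"
      "\<And>\<psi> p. (\<And>x. \<bar>\<psi> x\<bar> \<le> 1) \<Longrightarrow> (\<And>x y. \<bar>\<psi> x - \<psi> y\<bar> \<le> L * norm (x - y)) \<Longrightarrow> glob.J (\<lambda>x. \<psi> x * v x) p \<le> D p"
    show ?thesis
      by (rule glob.\<Phi>_tendsto_zero[OF _ D(1,2)]) (auto intro!: D(3) \<psi>1 \<psi>L lim' borel_measurable_times \<psi> vm)
  qed
  ultimately show ?thesis unfolding E_def using tendsto_add by fastforce
qed

text \<open>Two smallness requirements are met by one mollifier: all shifts in its support are short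
  enough for both modulars, and they all carry the support of v into \<Omega>.\<close>

lemma approximable_local:
  assumes op: "open \<Omega>" and v: "tame \<Omega> v" and r: "0 < r"
    and shift: "\<And>\<tau>. \<tau> > 0 \<Longrightarrow> \<exists>h. norm h < \<tau> \<and> (\<forall>y \<in> cball x (2 * r) \<inter> closure \<Omega>. y + h \<in> \<Omega>)"
    and supp: "\<And>y. v y \<noteq> 0 \<Longrightarrow> y \<in> cball x (2 * r)"
  shows "approximable \<Omega> v"
  unfolding approximable_def
proof (intro conjI allI impI)
  obtain M where M: "\<And>x. \<bar>v x\<bar> \<le> M" using v by (auto simp: tame_def)
  have vm [measurable]: "v \<in> borel_measurable borel" and sf: "emeasure lborel {x. v x \<noteq> 0} < \<infinity>"
    and fin: "loc.\<Phi> v < \<infinity>" "glob.\<Phi> v < \<infinity>" and off: "\<And>x. x \<notin> \<Omega> \<Longrightarrow> v x = 0"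
    using v by (auto simp: tame_def E_def)
  show "v \<in> borel_measurable borel" by (rule vm)
  have int: "integrable lborel v"
  proof (rule Bochner_Integration.integrable_bound[where f="\<lambda>x. M * indicator {x. v x \<noteq> 0} x"])
    show "integrable lborel (\<lambda>x. M * indicat_real {x. v x \<noteq> 0} x)"
      using sf by (intro integrable_mult_right integrable_real_indicator) auto
    show "AE x in lborel. norm (v x) \<le> norm (M * indicat_real {x. v x \<noteq> 0} x)"
      using M order_trans[OF M abs_ge_self] by (intro AE_I2) (auto split: split_indicator)
  qed simp
  fix e :: real assume e: "e > 0"
  then have e3: "0 < ennreal (e / 3)" by simp
  obtain r0 where r0: "r0 > 0" "\<And>h. norm h < r0 \<Longrightarrow> loc.\<Phi> (\<lambda>x. v x - v (x - h)) < ennreal (e / 3)"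
    using loc.\<Phi>_translation_continuous[OF int fin(1) e3] by blast
  obtain r1 where r1: "r1 > 0" "\<And>h. norm h < r1 \<Longrightarrow> glob.\<Phi> (\<lambda>x. v x - v (x - h)) < ennreal (e / 3)"
    using glob.\<Phi>_translation_continuous[OF int fin(2) e3] by blast
  \<comment> \<open>Half is spent on the shift \<open>h0\<close> and half on the mollifier radius d,
    so that |h| < 2 \<tau> on the support of \<rho>.\<close>
  define \<tau> where "\<tau> = min r0 r1 / 2"
  have \<tau>: "\<tau> > 0" "2 * \<tau> \<le> r0" "2 * \<tau> \<le> r1" using r0(1) r1(1) by (auto simp: \<tau>_def)
  \<comment> \<open>The closure makes \<open>Q\<close> compact, so its translate has a positive
    margin \<epsilon> inside the open set \<Omega>. This is why the shift property is stated for the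
    closure.\<close>
  define Q where "Q = cball x (2 * r) \<inter> closure \<Omega>"
  have Q: "compact Q" unfolding Q_def by (intro compact_Int_closed) auto
  have vQ: "y \<in> Q" if "v y \<noteq> 0" for y
    using that supp[of y] off[of y] closure_subset[of \<Omega>] by (auto simp: Q_def)
  obtain h0 where h0: "norm h0 < \<tau>" "\<And>y. y \<in> Q \<Longrightarrow> y + h0 \<in> \<Omega>"
    using shift[OF \<tau>(1)] unfolding Q_def by blast
  have "compact ((\<lambda>y. y + h0) ` Q)" by (intro compact_continuous_image continuous_intros Q)
  then obtain \<epsilon> where \<epsilon>: "\<epsilon> > 0" "(\<Union>y\<in>(\<lambda>y. y + h0) ` Q. cball y \<epsilon>) \<subseteq> \<Omega>"
    using compact_subset_open_imp_cball_epsilon_subset[OF _ op] h0(2) by blast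
  define d where "d = min \<epsilon> \<tau>"
  have d: "d > 0" "d \<le> \<epsilon>" "d \<le> \<tau>" using \<epsilon>(1) \<tau>(1) by (auto simp: d_def)
  obtain \<rho> :: "'a \<Rightarrow> real" where \<rho>: "\<And>h. 0 \<le> \<rho> h" "integrable lborel \<rho>" "(\<integral>h. \<rho> h \<partial>lborel) = 1"
    "\<And>h. \<rho> h \<noteq> 0 \<Longrightarrow> dist h h0 < d" and
    smooth: "\<And>v. integrable lborel v \<Longrightarrow> smooth_fun (\<lambda>x. \<integral>h. \<rho> h * v (x - h) \<partial>lborel)"
    using smooth_mollifier[OF d(1)] by blast
  define \<phi> where "\<phi> = (\<lambda>x. \<integral>h. \<rho> h * v (x - h) \<partial>lborel)"
  define S where "S = {y + k | y k. y \<in> Q \<and> k \<in> cball h0 d}"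
  have "\<phi> \<in> C0_infty \<Omega>"
  proof (rule C0_infty_intro[of _ S])
    show "smooth_fun \<phi>" unfolding \<phi>_def by (rule smooth[OF int])
    show "compact S" unfolding S_def by (intro compact_sums Q compact_cball)
    show "S \<subseteq> \<Omega>"
    proof
      fix z assume "z \<in> S"
      then obtain y k where z: "z = y + k" "y \<in> Q" "dist h0 k \<le> d" by (auto simp: S_def)
      have "dist (y + h0) z \<le> \<epsilon>" using z d by (simp add: dist_norm)
      then have "z \<in> (\<Union>y\<in>(\<lambda>y. y + h0) ` Q. cball y \<epsilon>)" using z(2) by auto
      then show "z \<in> \<Omega>" using \<epsilon>(2) by blast
    qed
    fix z assume "\<phi> z \<noteq> 0"
    have "\<exists>h. \<rho> h * v (z - h) \<noteq> 0"
    proof (rule ccontr)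
      assume "\<nexists>h. \<rho> h * v (z - h) \<noteq> 0"
      then have "(\<lambda>h. \<rho> h * v (z - h)) = (\<lambda>_. 0)" by auto
      then show False using \<open>\<phi> z \<noteq> 0\<close> by (simp add: \<phi>_def)
    qed
    then obtain h where "\<rho> h * v (z - h) \<noteq> 0" by blast
    then have "z - h \<in> Q" "h \<in> cball h0 d" using \<rho>(4)[of h] vQ[of "z - h"] by (auto simp: dist_commute)
    then show "z \<in> S" unfolding S_def by (intro CollectI exI[of _ "z - h"] exI[of _ h]) auto
  qed
  moreover have small: "norm h < r0" "norm h < r1" if "\<rho> h \<noteq> 0" for h
  proof -
    have "norm h \<le> norm h0 + dist h h0" by (metis dist_norm norm_triangle_sub)
    then show "norm h < r0" "norm h < r1" using \<rho>(4)[OF that] h0(1) d(3) \<tau> by auto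
  qed
  have "loc.\<Phi> (\<lambda>x. v x - \<phi> x) \<le> ennreal (e / 3)"
    unfolding \<phi>_def by (intro loc.\<Phi>_mollify_le[OF vm M \<rho>(1-3)] less_imp_le r0(2) small)
  moreover have "glob.\<Phi> (\<lambda>x. v x - \<phi> x) \<le> ennreal (e / 3)"
    unfolding \<phi>_def by (intro glob.\<Phi>_mollify_le[OF vm M \<rho>(1-3)] less_imp_le r1(2) small)
  ultimately have "E (\<lambda>x. v x - \<phi> x) \<le> ennreal (e / 3) + ennreal (e / 3)"
    unfolding E_def by (intro add_mono)
  also have "\<dots> = ennreal (2 * e / 3)" using e by (simp flip: ennreal_plus)
  also have "\<dots> < ennreal e" using e by (intro ennreal_lessI) auto
  finally show "\<exists>\<phi>\<in>C0_infty \<Omega>. E (\<lambda>x. v x - \<phi> x) < ennreal e" using \<open>\<phi> \<in> C0_infty \<Omega>\<close> by blast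
qed

text \<open>Induction peels off one ball at a time instead of building a partition of unity: a
  cutoff equal to 1 on ball x (r x) and to 0 off the ball of twice that radius isolates a local
  piece, and the rest vanishes on the peeled ball.\<close>

lemma approximable_finite_cover:
  assumes op: "open \<Omega>" and F: "finite F" and r: "\<And>x. x \<in> F \<Longrightarrow> 0 < r x"
    and shift: "\<And>x \<tau>. x \<in> F \<Longrightarrow> \<tau> > 0 \<Longrightarrow> \<exists>h. norm h < \<tau> \<and> (\<forall>y \<in> cball x (2 * r x) \<inter> closure \<Omega>. y + h \<in> \<Omega>)"
    and v: "tame \<Omega> v" and supp: "\<And>y. v y \<noteq> 0 \<Longrightarrow> y \<in> (\<Union>x\<in>F. ball x (r x))"
  shows "approximable \<Omega> v"
  using F r shift v supp
proof (induction F arbitrary: v rule: finite_induct)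
  case empty
  then have "v = (\<lambda>_. 0)" by auto
  then show ?case by (simp add: approximable_zero)
next
  case (insert x F)
  have rx: "r x > 0" using insert.prems(1) by simp
  define \<eta> where "\<eta> y = max 0 (min 1 (2 - dist y x / r x))" for y
  have \<eta>1: "\<bar>\<eta> y\<bar> \<le> 1" "\<bar>1 - \<eta> y\<bar> \<le> 1" for y unfolding \<eta>_def by auto
  have \<eta>L: "\<bar>\<eta> y - \<eta> z\<bar> \<le> (1 / r x) * norm (y - z)" for y z
  proof -
    have "\<bar>dist y x / r x - dist z x / r x\<bar> = \<bar>dist y x - dist z x\<bar> / r x"
      using rx by (simp flip: diff_divide_distrib)
    also have "\<dots> \<le> norm (y - z) / r x"
      using rx by (intro divide_right_mono) (auto simp: dist_norm intro: order_trans[OF norm_triangle_ineq3])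
    finally show ?thesis unfolding \<eta>_def by auto
  qed
  have [measurable]: "\<eta> \<in> borel_measurable borel"
    unfolding \<eta>_def by (intro borel_measurable_continuous_onI continuous_intros) (use rx in auto)
  have t1: "tame \<Omega> (\<lambda>y. \<eta> y * v y)"
    by (rule tame_multiplier[OF insert.prems(3) _ \<eta>1(1) \<eta>L]) (use rx in auto)
  have t2: "tame \<Omega> (\<lambda>y. (1 - \<eta> y) * v y)"
    by (rule tame_multiplier[OF insert.prems(3) _ \<eta>1(2), where L="1 / r x"])
       (use rx \<eta>L in \<open>auto simp: norm_minus_commute abs_minus_commute\<close>)
  have "approximable \<Omega> (\<lambda>y. \<eta> y * v y)"
  proof (rule approximable_local[OF op t1 rx])
    show "\<exists>h. norm h < \<tau> \<and> (\<forall>y \<in> cball x (2 * r x) \<inter> closure \<Omega>. y + h \<in> \<Omega>)" if "\<tau> > 0" for \<tau>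
      using insert.prems(2)[of x \<tau>] that by simp
    show "y \<in> cball x (2 * r x)" if "\<eta> y * v y \<noteq> 0" for y
    proof -
      have "\<eta> y \<noteq> 0" using that by simp
      then have "dist y x / r x \<le> 2" unfolding \<eta>_def by auto
      then show ?thesis using rx by (simp add: field_simps dist_commute)
    qed
  qed
  moreover have "approximable \<Omega> (\<lambda>y. (1 - \<eta> y) * v y)"
  proof (rule insert.IH[OF _ _ t2])
    show "0 < r z" if "z \<in> F" for z using insert.prems(1)[of z] that by simp
    show "\<exists>h. norm h < \<tau> \<and> (\<forall>y \<in> cball z (2 * r z) \<inter> closure \<Omega>. y + h \<in> \<Omega>)"
      if "z \<in> F" "\<tau> > 0" for z \<tau> using insert.prems(2)[of z \<tau>] that by simp
    show "y \<in> (\<Union>z\<in>F. ball z (r z))" if "(1 - \<eta> y) * v y \<noteq> 0" for y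
    proof -
      have "\<eta> y \<noteq> 1" "v y \<noteq> 0" using that by auto
      then have "dist y x / r x > 1" unfolding \<eta>_def by (auto simp: max_def min_def split: if_splits)
      then have "y \<notin> ball x (r x)" using rx by (auto simp: field_simps dist_commute)
      then show ?thesis using insert.prems(4)[OF \<open>v y \<noteq> 0\<close>] by auto
    qed
  qed
  ultimately have "approximable \<Omega> (\<lambda>y. \<eta> y * v y + (1 - \<eta> y) * v y)" by (rule approximable_add)
  then show ?case by (simp add: algebra_simps)
qed

lemma approximable_compact_support:
  assumes op: "open \<Omega>" and cb: "continuous_boundary \<Omega>" and v: "tame \<Omega> v"
    and supp: "\<And>y. v y \<noteq> 0 \<Longrightarrow> norm y \<le> R"
  shows "approximable \<Omega> v"
proof -
  define Q where "Q = cball 0 R \<inter> closure \<Omega>"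
  have Q: "compact Q" unfolding Q_def by (intro compact_Int_closed) auto
  have "\<forall>x\<in>Q. \<exists>r>0. \<forall>\<tau>>0. \<exists>h. norm h < \<tau> \<and> (\<forall>y \<in> cball x (2 * r) \<inter> closure \<Omega>. y + h \<in> \<Omega>)"
  proof
    fix x assume "x \<in> Q"
    then have "x \<in> closure \<Omega>" by (simp add: Q_def)
    then show "\<exists>r>0. \<forall>\<tau>>0. \<exists>h. norm h < \<tau> \<and> (\<forall>y \<in> cball x (2 * r) \<inter> closure \<Omega>. y + h \<in> \<Omega>)"
      using continuous_boundary_shift[OF op cb] by metis
  qed
  then obtain r where r: "\<And>x. x \<in> Q \<Longrightarrow> 0 < r x"
    "\<And>x \<tau>. x \<in> Q \<Longrightarrow> \<tau> > 0 \<Longrightarrow> \<exists>h. norm h < \<tau> \<and> (\<forall>y \<in> cball x (2 * r x) \<inter> closure \<Omega>. y + h \<in> \<Omega>)"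
    by metis
  have "Q \<subseteq> (\<Union>x\<in>Q. ball x (r x))" using r(1) by auto
  then obtain F where F: "F \<subseteq> Q" "finite F" "Q \<subseteq> (\<Union>x\<in>F. ball x (r x))"
    by (rule compactE_image[OF Q, rotated]) auto
  show ?thesis
  proof (rule approximable_finite_cover[OF op F(2) _ _ v])
    show "y \<in> (\<Union>x\<in>F. ball x (r x))" if "v y \<noteq> 0" for y
    proof -
      have "y \<in> \<Omega>" using v that by (auto simp: tame_def)
      then have "y \<in> Q" using supp[OF that] closure_subset[of \<Omega>] by (auto simp: Q_def)
      then show ?thesis using F(3) by blast
    qed
  qed (use F(1) r in blast)+
qed

text \<open>Only the boundary of \<Omega> is compact, so \<Omega> may be unbounded and the part near
  infinity is removed by cutoffs.\<close>

lemma approximable_tame: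
  assumes op: "open \<Omega>" and cb: "continuous_boundary \<Omega>" and v: "tame \<Omega> v"
  shows "approximable \<Omega> v"
proof -
  \<comment> \<open>Vanishes up to radius n + 1 and equals 1 from radius 2(n + 1) on. All these
    cutoffs share the Lipschitz constant 1, so one dominating function covers the sequence.\<close>
  define \<psi> where "\<psi> n x = max 0 (min 1 (norm x / real (Suc n) - 1))" for n and x :: 'a
  have \<psi>1: "\<bar>\<psi> n x\<bar> \<le> 1" "\<bar>1 - \<psi> n x\<bar> \<le> 1" for n x unfolding \<psi>_def by auto
  have \<psi>L: "\<bar>\<psi> n x - \<psi> n y\<bar> \<le> 1 * norm (x - y)" for n x y
  proof -
    have "\<bar>norm x / real (Suc n) - norm y / real (Suc n)\<bar> = \<bar>norm x - norm y\<bar> / real (Suc n)"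
      by (simp flip: diff_divide_distrib)
    also have "\<dots> \<le> \<bar>norm x - norm y\<bar>"
      by (simp add: divide_le_eq mult_le_cancel_left1 algebra_simps)
    also have "\<dots> \<le> norm (x - y)" by (rule norm_triangle_ineq3)
    finally show ?thesis unfolding \<psi>_def by auto
  qed
  have [measurable]: "\<psi> n \<in> borel_measurable borel" for n
    unfolding \<psi>_def by measurable
  have lim: "(\<lambda>n. \<psi> n x) \<longlonglongrightarrow> 0" for x
  proof (rule tendsto_eventually)
    obtain N :: nat where N: "norm x \<le> real N" using real_arch_simple by blast
    show "eventually (\<lambda>n. \<psi> n x = 0) sequentially"
      using eventually_ge_at_top[of N]
    proof eventually_elim
      case (elim n)
      then have "norm x \<le> real (Suc n)" using N by linarith
      then have "norm x / real (Suc n) - 1 \<le> 0" by (simp add: divide_le_eq)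
      then show ?case unfolding \<psi>_def by (intro max_absorb1 min.coboundedI2)
    qed
  qed
  have vm: "v \<in> borel_measurable borel" using v by (simp add: tame_def)
  show ?thesis
  proof (rule approximable_limit[OF vm])
    show "approximable \<Omega> (\<lambda>x. (1 - \<psi> n x) * v x)" for n
    proof (rule approximable_compact_support[OF op cb])
      show "tame \<Omega> (\<lambda>x. (1 - \<psi> n x) * v x)"
        by (rule tame_multiplier[OF v _ \<psi>1(2), where L=1])
           (use \<psi>L in \<open>auto simp: norm_minus_commute abs_minus_commute\<close>)
      show "norm y \<le> 2 * real (Suc n)" if "(1 - \<psi> n y) * v y \<noteq> 0" for y
      proof (rule ccontr)
        assume "\<not> norm y \<le> 2 * real (Suc n)"
        then have "1 \<le> norm y / real (Suc n) - 1" by (simp add: field_simps)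
        then have "\<psi> n y = 1" unfolding \<psi>_def by (simp only: min_absorb1 max_absorb2 zero_le_one)
        then show False using that by simp
      qed
    qed
    have "(\<lambda>n. E (\<lambda>x. \<psi> n x * v x)) \<longlonglongrightarrow> 0"
      by (rule E_multiplier_tendsto[OF v _ \<psi>1(1) \<psi>L _ lim]) auto
    then show "(\<lambda>n. E (\<lambda>x. v x - (1 - \<psi> n x) * v x)) \<longlonglongrightarrow> 0"
      by (simp add: algebra_simps)
  qed
qed

text \<open>The truncation vanishes where |u| is at most 1/(n+1), so \<open>level\<close> gives its
  support finite measure.\<close>

theorem approximable_finite_energy:
  assumes op: "open \<Omega>" and cb: "continuous_boundary \<Omega>"
    and u [measurable]: "u \<in> borel_measurable borel" and fin: "E u < \<infinity>"
    and off: "\<And>x. x \<notin> \<Omega> \<Longrightarrow> u x = 0"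
    and level: "\<And>m. 0 < m \<Longrightarrow> emeasure lborel {x. \<bar>u x\<bar> > m} < \<infinity>"
  shows "approximable \<Omega> u"
proof (rule approximable_limit[OF u])
  let ?k = "\<lambda>n x. clip (real (Suc n)) (u x) - clip (1 / real (Suc n)) (u x)"
  have fin': "loc.\<Phi> u < \<infinity>" "glob.\<Phi> u < \<infinity>" using fin by (auto simp: E_def)
  show "approximable \<Omega> (?k n)" for n
  proof (rule approximable_tame[OF op cb])
    have le: "0 \<le> 1 / real (Suc n)" "1 / real (Suc n) \<le> real (Suc n)" by (auto simp: field_simps)
    note contr = clip_diff_contraction(1)[OF le]
    have zero: "clip (real (Suc n)) 0 - clip (1 / real (Suc n)) 0 = 0" by (simp add: clip_def)
    have "loc.\<Phi> (?k n) \<le> loc.\<Phi> u"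
      by (intro loc.\<Phi>_mono loc.\<Phi>_contraction[where r="\<lambda>t. clip (real (Suc n)) t - clip (1 / real (Suc n)) t"] zero contr)
    moreover have "glob.\<Phi> (?k n) \<le> glob.\<Phi> u"
      by (intro glob.\<Phi>_mono glob.\<Phi>_contraction[where r="\<lambda>t. clip (real (Suc n)) t - clip (1 / real (Suc n)) t"] zero contr)
    ultimately have "E (?k n) < \<infinity>" using fin' unfolding E_less_top by (meson le_less_trans)
    moreover have "emeasure lborel {x. ?k n x \<noteq> 0} < \<infinity>"
    proof (rule le_less_trans[OF emeasure_mono level])
      show "{x. ?k n x \<noteq> 0} \<subseteq> {x. \<bar>u x\<bar> > 1 / real (Suc n)}"
        using clip_diff_zero[OF le] by (auto simp: not_le[symmetric])
    qed auto
    ultimately show "tame \<Omega> (?k n)"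
      unfolding tame_def using clip_diff_bound[OF le] off zero
      by (intro conjI exI[of _ "real (Suc n)"]) auto
  qed
  show "(\<lambda>n. E (\<lambda>x. u x - ?k n x)) \<longlonglongrightarrow> 0"
    unfolding E_def
    using tendsto_add[OF loc.\<Phi>_truncation_tendsto[OF u fin'(1)] glob.\<Phi>_truncation_tendsto[OF u fin'(2)]] by simp
qed

end

section \<open>Young functions and radial tails\<close>

text \<open>The last two facts are monotonicity statements: the derivative of G(t) t^(-r) has the
  sign of h(t) t - r G(t), so the quotient decreases for r = q and increases for r = p.\<close>

lemma young_function_facts:
  fixes h G :: "real \<Rightarrow> real"
  defines "G \<equiv> \<lambda>t. integral {0..t} h"
  assumes h0: "h 0 = 0" and cont: "continuous_on {0..} h" and mono: "mono_on {0..} h"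
    and p: "1 < p" "p \<le> q"
    and pq: "\<And>t. 0 < t \<Longrightarrow> p \<le> h t * t / G t \<and> h t * t / G t \<le> q"
  shows "G 0 = 0" and "convex_on UNIV (\<lambda>t. G \<bar>t\<bar>)"
    and "\<And>s t. 0 \<le> s \<Longrightarrow> s \<le> t \<Longrightarrow> G s \<le> G t"
    and "\<And>t. 0 < t \<Longrightarrow> 0 < G t"
    and "\<And>s t. 0 < s \<Longrightarrow> s \<le> t \<Longrightarrow> G t \<le> (t / s) powr q * G s"
    and "\<And>s t. 0 < s \<Longrightarrow> s \<le> t \<Longrightarrow> G s \<le> (s / t) powr p * G t"
proof -
  \<comment> \<open>Extends h by 0 to negative arguments. The extension is continuous and
    nondecreasing, so \<open>G\<close> becomes differentiable and convex on the whole line and t = 0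
    is not an endpoint.\<close>
  define k where "k t = h (max t 0)" for t
  have hpos: "0 \<le> h t" if "0 \<le> t" for t
    using mono_onD[OF mono, of 0 t] that h0 by simp
  have k_cont: "continuous_on A k" for A
    unfolding k_def by (rule continuous_on_compose2[OF cont]) (auto intro!: continuous_intros)
  have k_mono: "k s \<le> k t" if "s \<le> t" for s t
    unfolding k_def using that by (intro mono_onD[OF mono]) auto
  have eq: "integral {- c..x} k = G x" if "0 < c" "- c \<le> x" for c x
  proof (cases "x \<le> 0")
    case True
    have "integral {- c..x} k = integral {- c..x} (\<lambda>_. 0)"
      using True by (intro integral_cong) (auto simp: k_def h0)
    moreover have "G x = 0" using True by (cases "x = 0") (auto simp: G_def)
    ultimately show ?thesis by simp
  next
    case False
    have "integral {- c..0} k + integral {0..x} k = integral {- c..x} k"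
      using False that
      by (intro Henstock_Kurzweil_Integration.integral_combine integrable_continuous_real k_cont) auto
    moreover have "integral {- c..0} k = integral {- c..0} (\<lambda>_. 0)"
      by (intro integral_cong) (auto simp: k_def h0)
    moreover have "integral {0..x} k = G x"
      unfolding G_def by (intro integral_cong) (auto simp: k_def)
    ultimately show ?thesis by simp
  qed
  have deriv: "(G has_real_derivative k t) (at t)" for t
  proof -
    define c where "c = \<bar>t\<bar> + 1"
    have c: "c > 0" "- c < t" "t < c" by (auto simp: c_def)
    have "((\<lambda>x. integral {- c..x} k) has_real_derivative k t) (at t within {- c..c})"
      using c by (intro integral_has_real_derivative k_cont) auto
    then have "((\<lambda>x. integral {- c..x} k) has_real_derivative k t) (at t)"
      using c by (simp add: at_within_Icc_at)
    then show ?thesis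
      by (rule has_field_derivative_transform_within_open[where S="{- c<..<c}"])
         (use c eq in auto)
  qed
  show G0: "G 0 = 0" by (simp add: G_def)
  have conv: "convex_on UNIV G"
    by (rule convex_on_realI[OF _ deriv]) (auto intro: k_mono)
  have k_nonneg: "0 \<le> k t" for t unfolding k_def by (intro hpos) auto
  show G_mono: "G s \<le> G t" if "0 \<le> s" "s \<le> t" for s t
    using that(2) deriv k_nonneg by (intro DERIV_nonneg_imp_nondecreasing[of s t G]) blast+
  show "convex_on UNIV (\<lambda>t. G \<bar>t\<bar>)"
  proof (rule convex_onI)
    fix u x y :: real assume u: "0 < u" "u < 1"
    have "\<bar>(1 - u) *\<^sub>R x + u *\<^sub>R y\<bar> \<le> (1 - u) *\<^sub>R \<bar>x\<bar> + u *\<^sub>R \<bar>y\<bar>"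
      using u abs_triangle_ineq[of "(1 - u) * x" "u * y"] by (simp add: abs_mult)
    then have "G \<bar>(1 - u) *\<^sub>R x + u *\<^sub>R y\<bar> \<le> G ((1 - u) *\<^sub>R \<bar>x\<bar> + u *\<^sub>R \<bar>y\<bar>)"
      by (intro G_mono) auto
    also have "\<dots> \<le> (1 - u) * G \<bar>x\<bar> + u * G \<bar>y\<bar>"
      using u by (intro convex_onD[OF conv]) auto
    finally show "G \<bar>(1 - u) *\<^sub>R x + u *\<^sub>R y\<bar> \<le> (1 - u) * G \<bar>x\<bar> + u * G \<bar>y\<bar>" .
  qed auto
  show pos: "0 < G t" if "0 < t" for t
  proof -
    \<comment> \<open>If \<open>G t\<close> were 0, the quotient in \<open>pq\<close> would be 0 by
      the convention for division by zero, contradicting 1 < p.\<close>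
    have "G t \<noteq> 0" using pq[OF that] p by auto
    moreover have "0 \<le> G t" using G_mono[of 0 t] that G0 by simp
    ultimately show ?thesis by simp
  qed
  have pq': "p * G t \<le> k t * t" "k t * t \<le> q * G t" if "0 < t" for t
    using pq[OF that] pos[OF that] that by (auto simp: k_def field_simps)
  have deriv2: "((\<lambda>t. G t * t powr (- r)) has_real_derivative t powr (- r - 1) * (k t * t - r * G t)) (at t)"
    if "0 < t" for t r
  proof -
    have "((\<lambda>t. G t * t powr (- r)) has_real_derivative
        k t * t powr (- r) + G t * ((- r) * t powr (- r - 1))) (at t)"
      using that by (auto intro!: derivative_eq_intros deriv has_real_derivative_powr)
    moreover have "t powr (- r) = t powr (- r - 1) * t"
      using that powr_add[of t "- r - 1" 1] by simp
    ultimately show ?thesis by (simp add: algebra_simps)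
  qed
  show "G t \<le> (t / s) powr q * G s" if st: "0 < s" "s \<le> t" for s t
  proof -
    have "G t * t powr (- q) \<le> G s * s powr (- q)"
    proof (rule DERIV_nonpos_imp_nonincreasing[OF st(2)])
      fix x assume "s \<le> x" "x \<le> t"
      then have x: "0 < x" using st by simp
      have "x powr (- q - 1) * (k x * x - q * G x) \<le> 0"
        using pq'[OF x] by (intro mult_nonneg_nonpos) auto
      then show "\<exists>y. ((\<lambda>t. G t * t powr (- q)) has_real_derivative y) (at x) \<and> y \<le> 0"
        using deriv2[OF x] by blast
    qed
    then show ?thesis using st by (simp add: powr_minus powr_divide field_simps)
  qed
  show "G s \<le> (s / t) powr p * G t" if st: "0 < s" "s \<le> t" for s t
  proof -
    have "G s * s powr (- p) \<le> G t * t powr (- p)"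
    proof (rule DERIV_nonneg_imp_nondecreasing[OF st(2)])
      fix x assume "s \<le> x" "x \<le> t"
      then have x: "0 < x" using st by simp
      have "0 \<le> x powr (- p - 1) * (k x * x - p * G x)"
        using pq'[OF x] by (intro mult_nonneg_nonneg) auto
      then show "\<exists>y. ((\<lambda>t. G t * t powr (- p)) has_real_derivative y) (at x) \<and> y \<ge> 0"
        using deriv2[OF x] by blast
    qed
    then show ?thesis using st by (simp add: powr_minus powr_divide field_simps)
  qed
qed

text \<open>At each point one term of the series dominates w. The volume of
  \<open>cball 0 (R k)\<close> cancels the power of \<open>R k\<close>, and a geometric series
  remains.\<close>

lemma nn_integral_shells_finite:
  fixes w :: "'a::euclidean_space \<Rightarrow> real" and R :: "nat \<Rightarrow> real"
  assumes q: "0 \<le> q" "q < 1" and D: "0 \<le> D" and R: "\<And>k. 0 < R k"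
    and w: "\<And>z. w z \<noteq> 0 \<Longrightarrow> \<exists>k. norm z \<le> R k \<and> w z \<le> D * q ^ k / R k ^ DIM('a)"
  shows "(\<integral>\<^sup>+z. ennreal (w z) \<partial>lborel) < \<infinity>"
proof -
  define V where "V = unit_ball_vol (real DIM('a))"
  have V: "0 \<le> V" unfolding V_def by simp
  have [measurable]: "cball 0 r \<in> sets (borel :: 'a measure)" for r by (intro borel_closed) auto
  let ?f = "\<lambda>k z. ennreal (D * q ^ k / R k ^ DIM('a)) * indicator (cball 0 (R k)) z"
  have "(\<integral>\<^sup>+z. ennreal (w z) \<partial>lborel) \<le> (\<integral>\<^sup>+(z::'a). (\<Sum>k. ?f k z) \<partial>lborel)"
  proof (rule nn_integral_mono)
    fix z :: 'a
    show "ennreal (w z) \<le> (\<Sum>k. ?f k z)"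
    proof (cases "w z = 0")
      case False
      then obtain k where k: "norm z \<le> R k" "w z \<le> D * q ^ k / R k ^ DIM('a)" using w by blast
      then have "ennreal (w z) \<le> (\<Sum>k\<in>{k}. ?f k z)" by (simp add: ennreal_leI)
      also have "\<dots> \<le> (\<Sum>k. ?f k z)" by (intro sum_le_suminf) auto
      finally show ?thesis .
    qed simp
  qed
  also have "\<dots> = (\<Sum>k. \<integral>\<^sup>+(z::'a). ?f k z \<partial>lborel)"
    by (rule nn_integral_suminf) measurable
  also have "\<dots> = (\<Sum>k. ennreal (D * V * q ^ k))"
  proof (rule suminf_cong)
    fix k
    have "(\<integral>\<^sup>+(z::'a). ?f k z \<partial>lborel) = ennreal (D * q ^ k / R k ^ DIM('a)) * emeasure lborel (cball (0::'a) (R k))"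
      by (rule nn_integral_cmult_indicator) simp
    also have "\<dots> = ennreal (D * q ^ k / R k ^ DIM('a)) * ennreal (V * R k ^ DIM('a))"
      using R[of k] by (subst emeasure_cball) (auto simp: V_def)
    also have "\<dots> = ennreal (D * q ^ k / R k ^ DIM('a) * (V * R k ^ DIM('a)))"
      using R[of k] V by (intro ennreal_mult[symmetric]) (auto intro!: divide_nonneg_nonneg mult_nonneg_nonneg zero_le_power D q(1))
    also have "D * q ^ k / R k ^ DIM('a) * (V * R k ^ DIM('a)) = D * V * q ^ k"
      using R[of k] by simp
    finally show "(\<integral>\<^sup>+(z::'a). ?f k z \<partial>lborel) = ennreal (D * V * q ^ k)" .
  qed
  also have "\<dots> = ennreal (\<Sum>k. D * V * q ^ k)"
    using q D V by (intro suminf_ennreal2 summable_mult summable_geometric) auto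
  also have "\<dots> < \<infinity>" by simp
  finally show ?thesis .
qed

text \<open>Dyadic decomposition on both sides of the unit sphere: each step in the radius changes
  the power with exponent b or -b by the ratio q = 2^(-b).\<close>

lemma nn_integral_power_tail_finite:
  fixes w :: "'a::euclidean_space \<Rightarrow> real"
  assumes b: "0 < b" and w [measurable]: "w \<in> borel_measurable borel"
    and le1: "\<And>z. z \<noteq> 0 \<Longrightarrow> norm z \<le> 1 \<Longrightarrow> w z \<le> A * norm z powr b / norm z ^ DIM('a)"
    and gt1: "\<And>z. 1 < norm z \<Longrightarrow> w z \<le> A * norm z powr (- b) / norm z ^ DIM('a)"
    and zero: "w 0 = 0" and A: "0 \<le> A"
  shows "(\<integral>\<^sup>+z. ennreal (w z) \<partial>lborel) < \<infinity>"
proof -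
  define q where "q = (1/2) powr b"
  have q: "0 \<le> q" "q < 1" using b powr_less_mono2[of b "1/2" 1] by (auto simp: q_def)
  have qk: "q ^ k = ((1/2) ^ k) powr b" for k
    unfolding q_def by (simp add: powr_realpow[symmetric] powr_powr mult.commute del: powr_realpow)
  have [measurable]: "cball 0 1 \<in> sets (borel :: 'a measure)" by (intro borel_closed) auto
  let ?w1 = "\<lambda>z. indicator (cball 0 1) z * w z" and ?w2 = "\<lambda>z. indicator (- cball 0 1) z * w z"
  \<comment> \<open>Within a dyadic shell, |z| and the outer radius differ by a factor of at most 2,
    which costs 2 per dimension in the denominator.\<close>
  have D: "0 \<le> A * 2 ^ DIM('a)" using A by simp
  have "(\<integral>\<^sup>+z. ennreal (?w1 z) \<partial>lborel) < \<infinity>"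
  proof (rule nn_integral_shells_finite[OF q D, where R="\<lambda>k. (1/2) ^ k"])
    fix z assume nz: "?w1 z \<noteq> 0"
    then have z: "z \<noteq> 0" "norm z \<le> 1" using zero by (auto split: split_indicator_asm)
    \<comment> \<open>As |z| \<le> 1 the least such n is a successor, and its predecessor k
      satisfies (1/2)^(k+1) < |z| \<le> (1/2)^k.\<close>
    define n where "n = (LEAST n. (1/2::real) ^ n < norm z)"
    have ex: "\<exists>n. (1/2::real) ^ n < norm z" using z by (intro real_arch_pow_inv) auto
    have n: "(1/2::real) ^ n < norm z" unfolding n_def by (rule LeastI_ex[OF ex])
    have "n \<noteq> 0"
    proof
      assume "n = 0" then show False using n z by simp
    qed
    then obtain k where k: "n = Suc k" by (cases n) auto
    have le: "norm z \<le> (1/2) ^ k" using not_less_Least[of k "\<lambda>n. (1/2::real) ^ n < norm z"] k unfolding n_def by auto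
    have "w z \<le> A * norm z powr b / norm z ^ DIM('a)" by (rule le1[OF z])
    also have "\<dots> \<le> A * q ^ k / ((1/2) ^ Suc k) ^ DIM('a)"
      using n k z le b A unfolding qk
      by (intro frac_le mult_left_mono powr_mono2 power_mono zero_less_power mult_nonneg_nonneg) auto
    also have "\<dots> = A * 2 ^ DIM('a) * q ^ k / ((1/2) ^ k) ^ DIM('a)"
      by (simp add: power_mult_distrib field_simps)
    finally show "\<exists>k. norm z \<le> (1/2) ^ k \<and> ?w1 z \<le> A * 2 ^ DIM('a) * q ^ k / ((1/2) ^ k) ^ DIM('a)"
      using le nz by (intro exI[of _ k]) (auto split: split_indicator_asm)
  qed auto
  moreover have "(\<integral>\<^sup>+z. ennreal (?w2 z) \<partial>lborel) < \<infinity>"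
  proof (rule nn_integral_shells_finite[OF q D, where R="\<lambda>k. 2 ^ Suc k"])
    fix z assume nz: "?w2 z \<noteq> 0"
    then have z: "1 < norm z" by (auto split: split_indicator_asm)
    define n where "n = (LEAST n. norm z < (2::real) ^ n)"
    have ex: "\<exists>n. norm z < (2::real) ^ n" by (intro real_arch_pow) auto
    have n: "norm z < (2::real) ^ n" unfolding n_def by (rule LeastI_ex[OF ex])
    have "n \<noteq> 0"
    proof
      assume "n = 0" then show False using n z by simp
    qed
    then obtain k where k: "n = Suc k" by (cases n) auto
    have ge: "2 ^ k \<le> norm z" using not_less_Least[of k "\<lambda>n. norm z < (2::real) ^ n"] k unfolding n_def by auto
    have "norm z powr (- b) \<le> (2 ^ k) powr (- b)"
      using ge b by (intro powr_mono2') auto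
    also have "\<dots> = q ^ k"
      unfolding qk by (simp add: powr_minus power_one_over powr_divide divide_simps)
    finally have qle: "norm z powr (- b) \<le> q ^ k" .
    have "w z \<le> A * norm z powr (- b) / norm z ^ DIM('a)" by (rule gt1[OF z])
    also have "\<dots> \<le> A * q ^ k / (2 ^ k) ^ DIM('a)"
      using qle ge A q by (intro frac_le mult_left_mono power_mono zero_less_power mult_nonneg_nonneg) auto
    also have "\<dots> = A * 2 ^ DIM('a) * q ^ k / (2 ^ Suc k) ^ DIM('a)"
      by (simp add: power_mult_distrib field_simps)
    finally show "\<exists>k. norm z \<le> 2 ^ Suc k \<and> ?w2 z \<le> A * 2 ^ DIM('a) * q ^ k / (2 ^ Suc k) ^ DIM('a)"
      using n k nz by (intro exI[of _ k]) (auto split: split_indicator_asm)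
  qed auto
  moreover have "(\<integral>\<^sup>+z. ennreal (w z) \<partial>lborel) \<le> (\<integral>\<^sup>+z. ennreal (?w1 z) + ennreal (?w2 z) \<partial>lborel)"
    by (intro nn_integral_mono) (auto split: split_indicator)
  moreover have "\<dots> = (\<integral>\<^sup>+z. ennreal (?w1 z) \<partial>lborel) + (\<integral>\<^sup>+z. ennreal (?w2 z) \<partial>lborel)"
    by (rule nn_integral_add) measurable
  ultimately show ?thesis by (metis ennreal_add_less_top infinity_ennreal_def le_less_trans)
qed

lemma AE_lborel_reflect:
  fixes P :: "'a::euclidean_space \<Rightarrow> bool"
  assumes "AE x in lborel. P x"
  shows "AE x in lborel. P (c - x)"
proof -
  obtain N where N: "{x \<in> space lborel. \<not> P x} \<subseteq> N" "emeasure lborel N = 0" "N \<in> sets lborel"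
    using assms by (auto elim: AE_E)
  have [measurable]: "N \<in> sets borel" using N(3) by simp
  have "(\<integral>\<^sup>+x. indicator N (c - x) \<partial>lborel) = 0"
    using nn_integral_lborel_reflect[of "indicator N" c] N by simp
  then have "AE x in lborel. (indicator N (c - x) :: ennreal) = 0"
    by (subst (asm) nn_integral_0_iff_AE) auto
  then show ?thesis
    by eventually_elim (use N(1) in \<open>auto split: split_indicator_asm\<close>)
qed

text \<open>A Lebesgue measurable function of \<open>x - y\<close> has, by Fubini, almost every section in \<open>y\<close> almost everywhere
  equal to a Borel function; one such section suffices.\<close>

lemma difference_kernel_AE_borel:
  fixes k :: "'a::euclidean_space \<Rightarrow> real"
  assumes "(\<lambda>p. k (fst p - snd p)) \<in> borel_measurable (lebesgue :: ('a \<times> 'a) measure)"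
  shows "\<exists>k'\<in>borel_measurable borel. AE z in lborel. k z = k' z"
proof -
  obtain g where g: "g \<in> borel_measurable (lborel :: ('a \<times> 'a) measure)"
    "AE p in lborel. k (fst p - snd p) = g p"
    using completion_ex_borel_measurable_real[OF assms] by auto
  have "AE p in lborel \<Otimes>\<^sub>M (lborel :: 'a measure). k (fst p - snd p) = g p"
    using g(2) by (simp only: lborel_prod)
  then have "AE x in lborel. AE y in lborel. k (x - y) = g (x, y)"
    using lborel_pair.AE_pair by fastforce
  \<comment> \<open>The space is not a null set, so a property that holds almost everywhere holds at
    some x.\<close>
  moreover have "\<not> (AE x in (lborel :: 'a measure). False)"
    using AE_iff_measurable[of UNIV "lborel :: 'a measure" "\<lambda>_. False"] by simp
  ultimately obtain x where x: "AE y in lborel. k (x - y) = g (x, y)"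
    by (metis (mono_tags, lifting) eventually_mono)
  have "AE z in lborel. k z = g (x, x - z)" using AE_lborel_reflect[OF x, of x] by simp
  moreover have "(\<lambda>z. g (x, x - z)) \<in> borel_measurable borel"
  proof -
    have "(\<lambda>z. (x, x - z)) \<in> borel \<rightarrow>\<^sub>M (borel :: ('a \<times> 'a) measure)"
      by (intro borel_measurable_continuous_onI continuous_intros)
    then show ?thesis using measurable_compose g(1) by fastforce
  qed
  ultimately show ?thesis by (intro bexI[of _ "\<lambda>z. g (x, x - z)"])
qed

section \<open>Kernels depending on the difference\<close>

lemma convex_on_scaled:
  fixes f :: "real \<Rightarrow> real"
  assumes f: "convex_on UNIV f" and d: "0 \<le> d"
  shows "convex_on UNIV (\<lambda>t. d * f (c * t))"
proof (rule convex_onI)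
  fix u x y :: real assume u: "0 < u" "u < 1"
  have "f (c * ((1 - u) *\<^sub>R x + u *\<^sub>R y)) = f ((1 - u) *\<^sub>R (c * x) + u *\<^sub>R (c * y))"
    by (simp add: algebra_simps)
  also have "\<dots> \<le> (1 - u) * f (c * x) + u * f (c * y)"
    using u by (intro convex_onD[OF f]) auto
  finally have "d * f (c * ((1 - u) *\<^sub>R x + u *\<^sub>R y)) \<le> d * ((1 - u) * f (c * x) + u * f (c * y))"
    using d by (rule mult_left_mono)
  then show "d * f (c * ((1 - u) *\<^sub>R x + u *\<^sub>R y)) \<le> (1 - u) * (d * f (c * x)) + u * (d * f (c * y))"
    by (simp add: algebra_simps)
qed auto

text \<open>Here p, q and b will be g^-, g^+ and \<open>C2\<close>. \<open>K_AE_borel\<close> allows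
  a different exceptional null set for each t.\<close>

locale young_kernel =
  fixes K :: "'a::euclidean_space \<Rightarrow> real \<Rightarrow> real" and s p q b :: real
  assumes s: "0 < s" "s < 1" and p: "0 < p" and q: "0 \<le> q"
    and K_zero: "K z 0 = 0"
    and K_convex: "convex_on UNIV (\<lambda>t. K z \<bar>t\<bar>)"
    and K_mono: "0 \<le> t \<Longrightarrow> t \<le> t' \<Longrightarrow> K z t \<le> K z t'"
    and K_pos: "0 < t \<Longrightarrow> 0 < K z t"
    and K_upper: "0 < t \<Longrightarrow> t \<le> t' \<Longrightarrow> K z t' \<le> (t' / t) powr q * K z t"
    and K_lower: "0 < t \<Longrightarrow> t \<le> t' \<Longrightarrow> K z t \<le> (t / t') powr p * K z t'"
    and K_bound: "K z 1 \<le> b"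
    and K_AE_borel: "\<exists>k'\<in>borel_measurable borel. AE z in lborel. K z t = k' z"
begin

lemma K_continuous: "continuous_on UNIV (\<lambda>t. K z \<bar>t\<bar>)"
  by (intro convex_on_continuous K_convex) auto

lemma K_nonneg: "0 \<le> t \<Longrightarrow> 0 \<le> K z t"
  using K_mono[of 0 t z] K_zero by simp

lemma K_double: "K z \<bar>2 * t\<bar> \<le> 2 powr q * K z \<bar>t\<bar>"
proof (cases "t = 0")
  case False
  then show ?thesis using K_upper[of "\<bar>t\<bar>" "\<bar>2 * t\<bar>" z] by (simp add: abs_mult)
qed (simp add: K_zero)

text \<open>The even extension in t, set to 0 on the exceptional set \<open>N\<close>; not to be
  confused with the diagonal kernel \<open>K 0\<close>.\<close>

definition K0 :: "'a set \<Rightarrow> 'a \<Rightarrow> real \<Rightarrow> real" where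
  "K0 N z t = (if z \<in> N then 0 else K z \<bar>t\<bar>)"

text \<open>Only the countably many grid values i/(n+1) are controlled, so one null set suffices.
  Continuity in t then exhibits the kernel off \<open>N\<close> as a pointwise limit of functions
  that are step functions in t, which gives joint measurability.\<close>

lemma borel_version:
  obtains N where "N \<in> null_sets lborel" "case_prod (K0 N) \<in> borel_measurable borel"
proof -
  define d where "d n i = real_of_int i / real (Suc n)" for n :: nat and i :: int
  have "\<exists>k'. \<forall>n i. k' n i \<in> borel_measurable borel \<and> (AE z in lborel. K z \<bar>d n i\<bar> = k' n i z)"
  proof -
    have "\<forall>n. \<forall>i. \<exists>k. k \<in> borel_measurable borel \<and> (AE z in lborel. K z \<bar>d n i\<bar> = k z)"
      using K_AE_borel by blast
    from choice[OF allI, OF choice[OF spec[OF this]]] show ?thesis .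
  qed
  then obtain k' where k': "\<And>n i. k' n i \<in> borel_measurable borel"
    "\<And>n i. AE z in lborel. K z \<bar>d n i\<bar> = k' n i z" by blast
  have "AE z in lborel. \<forall>n i. K z \<bar>d n i\<bar> = k' n i z"
    using k'(2) by (simp add: AE_all_countable)
  then obtain N where N: "{z \<in> space lborel. \<not> (\<forall>n i. K z \<bar>d n i\<bar> = k' n i z)} \<subseteq> N"
    "emeasure lborel N = 0" "N \<in> sets lborel"
    by (elim AE_E)
  have [measurable]: "N \<in> sets borel" using N(3) by simp
  note [measurable] = k'(1)
  define f where "f n i z = (if z \<in> N then 0 else k' n i z)" for n i z
  have N_eq: "k' n i z = K z \<bar>d n i\<bar>" if "z \<notin> N" for n i z
  proof (rule ccontr)
    assume "k' n i z \<noteq> K z \<bar>d n i\<bar>"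
    then have "z \<in> {z \<in> space lborel. \<not> (\<forall>n i. K z \<bar>d n i\<bar> = k' n i z)}"
      by (auto intro!: exI[of _ n] exI[of _ i])
    then show False using N(1) that by blast
  qed
  have f_eq: "f n i z = K0 N z (d n i)" for n i z
    by (simp add: f_def K0_def N_eq)
  have [measurable]: "f n i \<in> borel_measurable borel" for n i unfolding f_def by measurable
  have "case_prod (K0 N) \<in> borel_measurable (borel \<Otimes>\<^sub>M borel)"
  proof (rule borel_measurable_LIMSEQ_real)
    fix zt :: "'a \<times> real"
    obtain z t where zt: "zt = (z, t)" by (cases zt)
    have "(\<lambda>n. d n \<lfloor>real (Suc n) * t\<rfloor>) \<longlonglongrightarrow> t"
    proof -
      have "(\<lambda>n. d n \<lfloor>real (Suc n) * t\<rfloor> - t) \<longlonglongrightarrow> 0"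
      proof (rule Lim_null_comparison[OF _ lim_1_over_n[THEN LIMSEQ_Suc]], rule always_eventually, rule allI)
        fix n
        have "\<bar>real_of_int \<lfloor>real (Suc n) * t\<rfloor> - real (Suc n) * t\<bar> \<le> 1" by linarith
        then have "\<bar>real_of_int \<lfloor>real (Suc n) * t\<rfloor> - real (Suc n) * t\<bar> / real (Suc n) \<le> 1 / real (Suc n)"
          by (intro divide_right_mono) auto
        moreover have "d n \<lfloor>real (Suc n) * t\<rfloor> - t = (real_of_int \<lfloor>real (Suc n) * t\<rfloor> - real (Suc n) * t) / real (Suc n)"
          unfolding d_def by (simp add: diff_divide_distrib del: of_nat_Suc)
        ultimately show "norm (d n \<lfloor>real (Suc n) * t\<rfloor> - t) \<le> 1 / real (Suc n)" by (simp add: abs_divide del: of_nat_Suc)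
      qed
      then show ?thesis by (simp add: LIM_zero_iff)
    qed
    then have "(\<lambda>n. K0 N z (d n \<lfloor>real (Suc n) * t\<rfloor>)) \<longlonglongrightarrow> K0 N z t"
      unfolding K0_def using continuous_on_tendsto_compose[OF K_continuous[of z]] by auto
    then show "(\<lambda>n. (\<lambda>(z, t). f n \<lfloor>real (Suc n) * t\<rfloor> z) zt) \<longlonglongrightarrow> case_prod (K0 N) zt"
      by (simp add: zt f_eq)
  next
    show "(\<lambda>(z, t). f n \<lfloor>real (Suc n) * t\<rfloor> z) \<in> borel_measurable (borel \<Otimes>\<^sub>M borel)" for n
      unfolding case_prod_beta
      by (rule measurable_compose_countable[where f="\<lambda>i zt. f n i (fst zt)" and g="\<lambda>zt. \<lfloor>real (Suc n) * snd zt\<rfloor>"]) measurable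
  qed
  moreover have "N \<in> null_sets lborel" using N by auto
  ultimately show thesis using that by (simp add: borel_prod)
qed

definition B_loc :: "'a \<Rightarrow> real \<Rightarrow> real" where
  "B_loc z t = indicator (cbox 0 One) z * K 0 \<bar>t\<bar>"

text \<open>At z = 0 the value is 0, since 1 / 0 = 0; this agrees with the integrand of
  \<open>J_sG\<close> on the diagonal.\<close>

definition B_glob :: "'a set \<Rightarrow> 'a \<Rightarrow> real \<Rightarrow> real" where
  "B_glob N z t = (1 / norm z ^ DIM('a)) * K0 N z ((1 / norm z powr s) * t)"

lemma C_ge_1: "1 \<le> 2 powr q"
  using q by (simp add: ge_one_powr_ge_zero)

lemma modular_loc: "nonlocal_modular B_loc 0 (2 powr q)"
proof
  have [measurable]: "(\<lambda>t. K 0 \<bar>t\<bar>) \<in> borel_measurable borel"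
    by (rule borel_measurable_continuous_onI[OF K_continuous])
  have "(\<lambda>(z, t). B_loc z t) \<in> borel_measurable (borel \<Otimes>\<^sub>M borel)"
    unfolding B_loc_def by measurable
  then show "case_prod B_loc \<in> borel_measurable borel" by (simp add: borel_prod)
  fix z :: 'a
  show "convex_on UNIV (B_loc z)"
    unfolding B_loc_def using convex_on_scaled[OF K_convex, of "indicator (cbox 0 One) z" 0 1] by simp
  show "B_loc z 0 = 0" by (simp add: B_loc_def K_zero)
  show "B_loc z t \<le> B_loc z t'" if "\<bar>t\<bar> \<le> \<bar>t'\<bar>" for t t'
    unfolding B_loc_def using that by (intro mult_left_mono K_mono) auto
  show "B_loc z (2 * t) \<le> 2 powr q * B_loc z t" for t
    unfolding B_loc_def using K_double[of 0 t] by (auto split: split_indicator)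
  fix M :: real
  have "(\<integral>\<^sup>+z. ennreal (B_loc z (M * min 1 (norm z))) \<partial>lborel) \<le>
      (\<integral>\<^sup>+z. ennreal (K 0 \<bar>M\<bar>) * indicator (cbox 0 One) z \<partial>(lborel :: 'a measure))"
  proof (rule nn_integral_mono)
    fix z :: 'a
    have "K 0 \<bar>M * min 1 (norm z)\<bar> \<le> K 0 \<bar>M\<bar>"
      by (intro K_mono) (auto simp: abs_mult mult_left_le)
    then show "ennreal (B_loc z (M * min 1 (norm z))) \<le> ennreal (K 0 \<bar>M\<bar>) * indicator (cbox 0 One) z"
      unfolding B_loc_def by (auto split: split_indicator intro: ennreal_leI)
  qed
  also have "\<dots> = ennreal (K 0 \<bar>M\<bar>) * emeasure lborel (cbox 0 One :: 'a set)"
    by (rule nn_integral_cmult_indicator) simp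
  also have "\<dots> < \<infinity>" by (simp add: ennreal_mult_less_top emeasure_lborel_cbox_eq)
  finally show "(\<integral>\<^sup>+z. ennreal (B_loc z (M * min 1 (norm z))) \<partial>lborel) < \<infinity>" .
qed (use C_ge_1 in auto)

text \<open>The argument of the kernel is M times \<open>m z\<close>, where \<open>m z\<close> is at
  most 1, equals |z|^(1-s) near 0 and |z|^(-s) far away. \<open>K_lower\<close> extracts its p-th
  power, and \<open>K_upper\<close> with \<open>K_bound\<close> bounds what is left independently of
  z.\<close>

lemma B_glob_tail:
  assumes N: "case_prod (K0 N) \<in> borel_measurable borel"
  shows "(\<integral>\<^sup>+z. ennreal (B_glob N z (M * min 1 (norm z))) \<partial>lborel) < \<infinity>"
proof -
  have [measurable]: "(\<lambda>x. K0 N (f x) (g x)) \<in> borel_measurable L"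
    if [measurable]: "f \<in> L \<rightarrow>\<^sub>M borel" "g \<in> borel_measurable L" for f g and L :: "'a measure"
    using measurable_compose[OF _ N, of "\<lambda>x. (f x, g x)" L] by simp
  define T where "T = max \<bar>M\<bar> 1"
  have T: "1 \<le> T" "\<bar>M\<bar> \<le> T" by (auto simp: T_def)
  \<comment> \<open>The decay exponents are (1 - s) p at the origin and s p at infinity; the smaller
    one serves both.\<close>
  define e where "e = min ((1 - s) * p) (s * p)"
  have e: "0 < e" "e \<le> (1 - s) * p" "e \<le> s * p" using s p by (auto simp: e_def)
  define A where "A = T powr q * b"
  have "0 < b" using K_pos[of 1 0] K_bound[of 0] by simp
  then have A: "0 \<le> A" by (simp add: A_def)
  define m where "m z = min 1 (norm z) / norm z powr s" for z :: 'a
  have main: "B_glob N z (M * min 1 (norm z)) \<le> A * m z powr p / norm z ^ DIM('a)" if z: "z \<noteq> 0" for z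
  proof -
    have m0: "0 < m z" using z by (simp add: m_def)
    have m1: "m z \<le> 1"
    proof (cases "norm z \<le> 1")
      case True
      then have "norm z powr 1 \<le> norm z powr s" using s z by (intro powr_mono') auto
      then show ?thesis using z True by (simp add: m_def divide_le_eq)
    next
      case False
      then have "1 \<le> norm z powr s" using s by (intro ge_one_powr_ge_zero) auto
      then show ?thesis using False by (simp add: m_def divide_le_eq)
    qed
    have "K0 N z ((1 / norm z powr s) * (M * min 1 (norm z))) \<le> K z \<bar>M * m z\<bar>"
      unfolding K0_def m_def by (simp add: K_nonneg)
    also have "\<dots> \<le> K z (T * m z)"
      using T m0 by (intro K_mono) (auto simp: abs_mult)
    also have "\<dots> \<le> ((T * m z) / T) powr p * K z T"
      using T m0 m1 by (intro K_lower) (auto simp: mult_left_le)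
    also have "\<dots> = m z powr p * K z T" using T by simp
    also have "\<dots> \<le> m z powr p * ((T / 1) powr q * K z 1)"
      using T by (intro mult_left_mono K_upper) auto
    also have "\<dots> \<le> m z powr p * A"
      unfolding A_def using mult_left_mono[OF K_bound[of z], of "T powr q"]
      by (intro mult_left_mono) simp_all
    finally show ?thesis
      unfolding B_glob_def by (simp add: divide_right_mono mult.commute)
  qed
  show ?thesis
  proof (rule nn_integral_power_tail_finite[OF e(1) _ _ _ _ A])
    show "(\<lambda>z. B_glob N z (M * min 1 (norm z))) \<in> borel_measurable borel"
      unfolding B_glob_def by measurable
    show "B_glob N 0 (M * min 1 (norm (0::'a))) = 0" by (simp add: B_glob_def)
    show "B_glob N z (M * min 1 (norm z)) \<le> A * norm z powr e / norm z ^ DIM('a)"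
      if z: "z \<noteq> 0" "norm z \<le> 1" for z
    proof -
      have "m z = norm z powr (1 - s)" using z by (simp add: m_def powr_diff)
      then have "m z powr p = norm z powr ((1 - s) * p)" by (simp add: powr_powr)
      also have "\<dots> \<le> norm z powr e" using z e by (intro powr_mono') auto
      finally have "A * m z powr p / norm z ^ DIM('a) \<le> A * norm z powr e / norm z ^ DIM('a)"
        using A by (intro divide_right_mono mult_left_mono) auto
      then show ?thesis using main[OF z(1)] by linarith
    qed
    show "B_glob N z (M * min 1 (norm z)) \<le> A * norm z powr (- e) / norm z ^ DIM('a)"
      if z: "1 < norm z" for z
    proof -
      have "m z = norm z powr (- s)" using z by (simp add: m_def powr_minus divide_simps)
      then have "m z powr p = norm z powr (- (s * p))" by (simp add: powr_powr)
      also have "\<dots> \<le> norm z powr (- e)" using z e by (intro powr_mono) auto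
      finally have "A * m z powr p / norm z ^ DIM('a) \<le> A * norm z powr (- e) / norm z ^ DIM('a)"
        using A by (intro divide_right_mono mult_left_mono) auto
      moreover have "z \<noteq> 0" using z by auto
      ultimately show ?thesis using main[of z] by linarith
    qed
  qed
qed

lemma modular_glob:
  assumes N: "case_prod (K0 N) \<in> borel_measurable borel"
  shows "nonlocal_modular (B_glob N) 1 (2 powr q)"
proof
  have [measurable]: "(\<lambda>x. K0 N (f x) (g x)) \<in> borel_measurable L"
    if [measurable]: "f \<in> L \<rightarrow>\<^sub>M borel" "g \<in> borel_measurable L" for f g and L :: "('a \<times> real) measure"
    using measurable_compose[OF _ N, of "\<lambda>x. (f x, g x)" L] by simp
  have "(\<lambda>(z, t). B_glob N z t) \<in> borel_measurable (borel \<Otimes>\<^sub>M borel)"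
    unfolding B_glob_def case_prod_beta by measurable
  then show "case_prod (B_glob N) \<in> borel_measurable borel" by (simp add: borel_prod)
  fix z :: 'a
  have "convex_on UNIV (K0 N z)"
    using K_convex[of z] by (cases "z \<in> N") (auto simp: K0_def [abs_def] convex_on_const)
  then show "convex_on UNIV (B_glob N z)"
    unfolding B_glob_def by (rule convex_on_scaled) simp
  show "B_glob N z 0 = 0" by (simp add: B_glob_def K0_def K_zero)
  show "B_glob N z t \<le> B_glob N z t'" if "\<bar>t\<bar> \<le> \<bar>t'\<bar>" for t t'
  proof -
    have "K0 N z ((1 / norm z powr s) * t) \<le> K0 N z ((1 / norm z powr s) * t')"
      unfolding K0_def using that by (auto intro!: K_mono simp: abs_mult mult_left_mono divide_right_mono)
    then show ?thesis unfolding B_glob_def by (intro mult_left_mono) auto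
  qed
  show "B_glob N z (2 * t) \<le> 2 powr q * B_glob N z t" for t
  proof -
    have "K0 N z (2 * ((1 / norm z powr s) * t)) \<le> 2 powr q * K0 N z ((1 / norm z powr s) * t)"
      unfolding K0_def using K_double[of z "(1 / norm z powr s) * t"] by simp
    then have "(1 / norm z ^ DIM('a)) * K0 N z (2 * ((1 / norm z powr s) * t)) \<le>
        (1 / norm z ^ DIM('a)) * (2 powr q * K0 N z ((1 / norm z powr s) * t))"
      by (intro mult_left_mono) auto
    then show ?thesis unfolding B_glob_def by (simp add: mult.left_commute)
  qed
qed (use C_ge_1 B_glob_tail[OF N] in auto)

end

section \<open>Density of test functions\<close>

context young_kernel
begin

text \<open>Integrating out y leaves the volume of the unit cube, which is 1, so no constant
  appears.\<close>

lemma loc_energy: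
  assumes v [measurable]: "v \<in> borel_measurable borel"
  shows "nonlocal_modular.\<Phi> B_loc 0 v = (\<integral>\<^sup>+x. ennreal (K 0 \<bar>v x\<bar>) \<partial>lborel)"
proof -
  interpret loc: nonlocal_modular B_loc 0 "2 powr q" by (rule modular_loc)
  have m: "(\<lambda>p. ennreal (loc.J v p)) \<in> borel_measurable (lborel \<Otimes>\<^sub>M lborel)"
    by (simp only: lborel_prod) measurable
  have "loc.\<Phi> v = (\<integral>\<^sup>+x. (\<integral>\<^sup>+y. ennreal (loc.J v (x, y)) \<partial>lborel) \<partial>lborel)"
    unfolding loc.\<Phi>_def using lborel.nn_integral_fst[OF m] by (simp only: lborel_prod)
  also have "\<dots> = (\<integral>\<^sup>+x. ennreal (K 0 \<bar>v x\<bar>) \<partial>lborel)"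
  proof (rule nn_integral_cong)
    fix x :: 'a
    have "(\<integral>\<^sup>+y. ennreal (loc.J v (x, y)) \<partial>lborel) =
        (\<integral>\<^sup>+y. ennreal (K 0 \<bar>v x\<bar>) * indicator (cbox 0 One) (x - y) \<partial>lborel)"
      by (intro nn_integral_cong) (auto simp: loc.J_def B_loc_def split: split_indicator)
    also have "\<dots> = ennreal (K 0 \<bar>v x\<bar>) * (\<integral>\<^sup>+y. indicator (cbox 0 One) (x - y) \<partial>(lborel :: 'a measure))"
      by (rule nn_integral_cmult) measurable
    also have "(\<integral>\<^sup>+y. indicator (cbox 0 One) (x - y) \<partial>(lborel :: 'a measure)) = emeasure lborel (cbox 0 One :: 'a set)"
      by (subst nn_integral_lborel_reflect) auto
    also have "\<dots> = 1" by (simp add: emeasure_lborel_cbox_eq)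
    finally show "(\<integral>\<^sup>+y. ennreal (loc.J v (x, y)) \<partial>lborel) = ennreal (K 0 \<bar>v x\<bar>)" by simp
  qed
  finally show ?thesis .
qed

lemma modular_L_eq:
  assumes G: "\<And>x y t. 0 \<le> t \<Longrightarrow> G x y t = K (x - y) t"
    and v: "v \<in> borel_measurable borel" and wv: "AE x in lborel. w x = v x"
  shows "modular_L G UNIV w = nonlocal_modular.\<Phi> B_loc 0 v"
proof -
  have "modular_L G UNIV w = (\<integral>\<^sup>+x. ennreal (K 0 \<bar>w x\<bar>) \<partial>lborel)"
    unfolding modular_L_def nn_integral_completion by (simp add: G)
  also have "\<dots> = (\<integral>\<^sup>+x. ennreal (K 0 \<bar>v x\<bar>) \<partial>lborel)"
    using wv by (intro nn_integral_cong_AE, eventually_elim) simp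
  finally show ?thesis by (simp add: loc_energy[OF v])
qed

text \<open>The replacement is made section by section: for almost every x, almost every y has w y =
  v y and x - y outside \<open>N\<close>. The iterated integral of the original integrand thus
  becomes that of a Borel function, to which Tonelli applies.\<close>

lemma J_sG_eq:
  assumes G: "\<And>x y t. 0 \<le> t \<Longrightarrow> G x y t = K (x - y) t"
    and N: "case_prod (K0 N) \<in> borel_measurable borel" "N \<in> null_sets lborel"
    and v [measurable]: "v \<in> borel_measurable borel" and wv: "AE x in lborel. w x = v x"
  shows "J_sG s G UNIV w = nonlocal_modular.\<Phi> (B_glob N) 1 v"
proof -
  interpret glob: nonlocal_modular "B_glob N" 1 "2 powr q" by (rule modular_glob[OF N(1)])
  have m: "(\<lambda>p. ennreal (glob.J v p)) \<in> borel_measurable (lborel \<Otimes>\<^sub>M lborel)"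
    by (simp only: lborel_prod) measurable
  have AE_N: "AE y in lborel. x - y \<notin> N" for x
    using AE_lborel_reflect[OF AE_not_in[OF N(2)], of x] .
  have "J_sG s G UNIV w = (\<integral>\<^sup>+x. (\<integral>\<^sup>+y.
       ennreal (G x y (\<bar>w x - w y\<bar> / dist x y powr s) / dist x y ^ DIM('a)) \<partial>lborel) \<partial>lborel)"
    unfolding J_sG_def nn_integral_completion by simp
  also have "\<dots> = (\<integral>\<^sup>+x. (\<integral>\<^sup>+y. ennreal (glob.J v (x, y)) \<partial>lborel) \<partial>lborel)"
  proof (intro nn_integral_cong_AE)
    show "AE x in lborel. (\<integral>\<^sup>+y. ennreal (G x y (\<bar>w x - w y\<bar> / dist x y powr s) / dist x y ^ DIM('a)) \<partial>lborel) =
        (\<integral>\<^sup>+y. ennreal (glob.J v (x, y)) \<partial>lborel)"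
      using wv
    proof eventually_elim
      case x: (elim x)
      show ?case
      proof (intro nn_integral_cong_AE)
        show "AE y in lborel. ennreal (G x y (\<bar>w x - w y\<bar> / dist x y powr s) / dist x y ^ DIM('a)) = ennreal (glob.J v (x, y))"
          using wv AE_N[of x]
        proof eventually_elim
          case (elim y)
          then show ?case
            using x by (simp add: glob.J_def B_glob_def K0_def G dist_norm abs_divide)
        qed
      qed
    qed
  qed
  also have "\<dots> = glob.\<Phi> v"
    unfolding glob.\<Phi>_def using lborel.nn_integral_fst[OF m] by (simp only: lborel_prod)
  finally show ?thesis .
qed

theorem C0_infty_dense:
  assumes op: "open \<Omega>" and cb: "continuous_boundary \<Omega>"
    and G: "\<And>x y t. 0 \<le> t \<Longrightarrow> G x y t = K (x - y) t"
    and u: "in_W0 s G \<Omega> u" and e: "0 < e"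
  shows "\<exists>\<phi>\<in>C0_infty \<Omega>. norm_W s G UNIV (\<lambda>x. u x - \<phi> x) < e"
proof -
  obtain N where N: "N \<in> null_sets lborel" "case_prod (K0 N) \<in> borel_measurable borel"
    by (rule borel_version)
  interpret modular_pair B_loc "B_glob N" "2 powr q"
    by (intro modular_pair.intro modular_loc modular_glob N)
  have um: "u \<in> borel_measurable lebesgue" and off: "AE x in lborel. x \<notin> \<Omega> \<longrightarrow> u x = 0"
    using u by (auto simp: in_W0_def in_W_def in_L_def AE_completion_iff)
  obtain u0 where u0 [measurable]: "u0 \<in> borel_measurable borel" and u_u0: "AE x in lborel. u x = u0 x"
    using completion_ex_borel_measurable_real[OF um] by auto
  have [measurable]: "\<Omega> \<in> sets borel" using op by simp
  \<comment> \<open>A Borel representative of \<open>u\<close> vanishing at every point outside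
    \<Omega>.\<close>
  define v where "v = (\<lambda>x. indicator \<Omega> x * u0 x)"
  have v [measurable]: "v \<in> borel_measurable borel" unfolding v_def by measurable
  have uv: "AE x in lborel. u x = v x"
    using u_u0 off by eventually_elim (auto simp: v_def split: split_indicator)
  have ex_pow: "\<exists>n. \<bar>c\<bar> \<le> 2 ^ n" for c :: real
    using real_arch_pow[of 2 "\<bar>c\<bar>"] by (auto intro: less_imp_le)
  obtain c1 where c1: "c1 > 0" "modular_L G UNIV (\<lambda>x. c1 * u x) < \<infinity>"
    using u by (auto simp: in_W0_def in_W_def in_L_def)
  obtain c2 where c2: "c2 > 0" "J_sG s G UNIV (\<lambda>x. c2 * u x) < \<infinity>"
    using u by (auto simp: in_W0_def in_W_def)
  have scaled: "AE x in lborel. c * u x = c * v x" for c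
    using uv by eventually_elim simp
  have loc_fin: "loc.\<Phi> v < \<infinity>"
  proof -
    obtain n where n: "\<bar>1 / c1\<bar> \<le> 2 ^ n" using ex_pow by blast
    have "loc.\<Phi> (\<lambda>x. c1 * v x) < \<infinity>"
      using c1(2) modular_L_eq[OF G _ scaled[of c1]] by simp
    then have "ennreal ((2 powr q) ^ n) * loc.\<Phi> (\<lambda>x. c1 * v x) < \<infinity>"
      by (simp add: ennreal_mult_less_top)
    moreover have "loc.\<Phi> v \<le> ennreal ((2 powr q) ^ n) * loc.\<Phi> (\<lambda>x. c1 * v x)"
      using loc.\<Phi>_scale[OF _ n, of "\<lambda>x. c1 * v x"] c1(1) by simp
    ultimately show ?thesis by (rule le_less_trans[rotated])
  qed
  have glob_fin: "glob.\<Phi> v < \<infinity>"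
  proof -
    obtain n where n: "\<bar>1 / c2\<bar> \<le> 2 ^ n" using ex_pow by blast
    have "glob.\<Phi> (\<lambda>x. c2 * v x) < \<infinity>"
      using c2(2) J_sG_eq[OF G N(2,1) _ scaled[of c2]] by simp
    then have "ennreal ((2 powr q) ^ n) * glob.\<Phi> (\<lambda>x. c2 * v x) < \<infinity>"
      by (simp add: ennreal_mult_less_top)
    moreover have "glob.\<Phi> v \<le> ennreal ((2 powr q) ^ n) * glob.\<Phi> (\<lambda>x. c2 * v x)"
      using glob.\<Phi>_scale[OF _ n, of "\<lambda>x. c2 * v x"] c2(1) by simp
    ultimately show ?thesis by (rule le_less_trans[rotated])
  qed
  \<comment> \<open>Chebyshev's inequality for the zeroth-order modular, using
    \<open>K 0 m > 0\<close>.\<close>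
  have level: "emeasure lborel {x. \<bar>v x\<bar> > m} < \<infinity>" if m: "0 < m" for m
  proof -
    have "ennreal (K 0 m) * emeasure lborel {x. \<bar>v x\<bar> > m} =
        (\<integral>\<^sup>+x. ennreal (K 0 m) * indicator {x. \<bar>v x\<bar> > m} x \<partial>lborel)"
      by (rule nn_integral_cmult_indicator[symmetric]) measurable
    also have "\<dots> \<le> loc.\<Phi> v"
      unfolding loc_energy[OF v]
      using m by (intro nn_integral_mono) (auto intro!: ennreal_leI K_mono split: split_indicator)
    finally show ?thesis
      using loc_fin K_pos[OF m, of 0]
      by (auto simp: less_top[symmetric] ennreal_mult_eq_top_iff top_unique)
  qed
  have "approximable \<Omega> v"
    by (rule approximable_finite_energy[OF op cb v _ _ level])
       (use loc_fin glob_fin in \<open>auto simp: E_def v_def\<close>)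
  define c where "c = e / 3"
  have c: "c > 0" using e by (simp add: c_def)
  obtain n where n: "\<bar>1 / c\<bar> \<le> 2 ^ n" using ex_pow by blast
  \<comment> \<open>The cost of scaling by 1/c. Energy below 1/A makes both modulars of (u -
    \<phi>)/c at most 1, so each Luxemburg term is at most c = e/3.\<close>
  define A where "A = (2 powr q) ^ n"
  have A: "A > 0" by (simp add: A_def)
  obtain \<phi> where \<phi>: "\<phi> \<in> C0_infty \<Omega>" "E (\<lambda>x. v x - \<phi> x) < ennreal (1 / A)"
    using \<open>approximable \<Omega> v\<close> A unfolding approximable_def by (metis zero_less_divide_1_iff)
  note [measurable] = C0_infty_measurable[OF \<phi>(1)]
  have diff: "AE x in lborel. (u x - \<phi> x) / c = 1 / c * (v x - \<phi> x)"
    using uv by eventually_elim simp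
  have one: "ennreal A * ennreal (1 / A) = 1" using A by (simp flip: ennreal_mult)
  have "loc.\<Phi> (\<lambda>x. v x - \<phi> x) \<le> ennreal (1 / A)" "glob.\<Phi> (\<lambda>x. v x - \<phi> x) \<le> ennreal (1 / A)"
    using \<phi>(2) unfolding E_def by (metis add_increasing2 add_increasing le_less_trans less_imp_le order_refl zero_le)+
  note small = this
  have "modular_L G UNIV (\<lambda>x. (u x - \<phi> x) / c) = loc.\<Phi> (\<lambda>x. 1 / c * (v x - \<phi> x))"
    by (rule modular_L_eq[OF G _ diff]) auto
  also have "\<dots> \<le> ennreal A * loc.\<Phi> (\<lambda>x. v x - \<phi> x)"
    unfolding A_def by (rule loc.\<Phi>_scale[OF _ n]) measurable
  also have "\<dots> \<le> 1" using mult_left_mono[OF small(1), of "ennreal A"] by (simp add: one)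
  finally have 1: "norm_L G UNIV (\<lambda>x. u x - \<phi> x) \<le> c"
    unfolding norm_L_def using c by (intro cInf_lower bdd_belowI[of _ 0]) auto
  have "J_sG s G UNIV (\<lambda>x. (u x - \<phi> x) / c) = glob.\<Phi> (\<lambda>x. 1 / c * (v x - \<phi> x))"
    by (rule J_sG_eq[OF G N(2,1) _ diff]) auto
  also have "\<dots> \<le> ennreal A * glob.\<Phi> (\<lambda>x. v x - \<phi> x)"
    unfolding A_def by (rule glob.\<Phi>_scale[OF _ n]) measurable
  also have "\<dots> \<le> 1" using mult_left_mono[OF small(2), of "ennreal A"] by (simp add: one)
  finally have 2: "Inf {c. c > 0 \<and> J_sG s G UNIV (\<lambda>x. (u x - \<phi> x) / c) \<le> 1} \<le> c"
    using c by (intro cInf_lower bdd_belowI[of _ 0]) auto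
  have "norm_W s G UNIV (\<lambda>x. u x - \<phi> x) \<le> 2 * c"
    unfolding norm_W_def using 1 2 by simp
  also have "\<dots> < e" using e by (simp add: c_def)
  finally show ?thesis using \<phi>(1) by blast
qed

end

section \<open>Verification of the kernel hypotheses for the given integrand\<close>

lemma gfun_continuous:
  assumes "((\<lambda>t. a x y t * t) \<longlongrightarrow> 0) (at_right 0)" "continuous_on {0<..} (a x y)"
  shows "continuous_on {0..} (gfun a x y)"
  unfolding continuous_on_def
proof
  fix t :: real assume t: "t \<in> {0..}"
  show "(gfun a x y \<longlongrightarrow> gfun a x y t) (at t within {0..})"
  proof (cases "t = 0")
    case True
    have "(gfun a x y \<longlongrightarrow> 0) (at_right 0)"
      by (rule Lim_transform_eventually[OF assms(1)])
         (intro eventually_mono[OF eventually_at_right_less[of 0]], simp add: gfun_def)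
    then show ?thesis using True by (simp add: gfun_def at_within_Ici_at_right)
  next
    case False
    then have t: "t > 0" using t by simp
    have "isCont (\<lambda>t. a x y t * t) t"
      using assms(2) t by (intro continuous_intros) (auto simp: continuous_on_eq_continuous_at)
    then have "((\<lambda>t. a x y t * t) \<longlongrightarrow> gfun a x y t) (at t)"
      using t by (simp add: isCont_def gfun_def)
    moreover have "eventually (\<lambda>r. a x y r * r = gfun a x y r) (at t)"
      using t eventually_at_topological by (intro eventually_at_topological[THEN iffD2] exI[of _ "{0<..}"]) (auto simp: gfun_def)
    ultimately have "(gfun a x y \<longlongrightarrow> gfun a x y t) (at t)" by (rule Lim_transform_eventually)
    then show ?thesis by (rule tendsto_within_subset) simp
  qed
qed

theorem theorem1p2:
  fixes \<Omega> :: "'a::euclidean_space set"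
    and s :: real
    and a :: "'a \<Rightarrow> 'a \<Rightarrow> real \<Rightarrow> real"
    and gm gp C1 C2 :: real
  assumes s: "0 < s" "s < 1"
    and \<Omega>: "open \<Omega>" "continuous_boundary \<Omega>"
    and a_nonneg: "\<And>x y t. a x y t \<ge> 0"
    and Carath: "\<And>t. (\<lambda>(x,y). Gfun a x y t) \<in> borel_measurable lebesgue"
    and g1: "\<And>x y. ((\<lambda>t. a x y t * t) \<longlongrightarrow> 0) (at_right 0)"
            "\<And>x y. filterlim (\<lambda>t. a x y t * t) at_top at_top"
    and g2: "\<And>x y. continuous_on {0<..} (a x y)"
    and g3: "\<And>x y. strict_mono_on {0<..} (\<lambda>t. a x y t * t)"
    and g4: "1 < gm" "gm \<le> gp"
            "\<And>x y t. t > 0 \<Longrightarrow> gm \<le> a x y t * t\<^sup>2 / Gfun a x y t \<and>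
                                  a x y t * t\<^sup>2 / Gfun a x y t \<le> gp"
    and H1: "\<And>c A. c > 0 \<Longrightarrow> compact A \<Longrightarrow>
               (\<integral>\<^sup>+ p. indicator (A \<times> A) p * ennreal (Gfun a (fst p) (snd p) c) \<partial>lebesgue) < \<infinity> \<and>
               (\<integral>\<^sup>+ x. indicator A x * ennreal (Gfun a x x c) \<partial>lebesgue) < \<infinity>"
    and H2: "\<And>x y z t. t \<ge> 0 \<Longrightarrow> Gfun a (x - z) (y - z) t = Gfun a x y t"
    and Bf: "0 < C1" "0 < C2" "\<And>x y. C1 \<le> Gfun a x y 1 \<and> Gfun a x y 1 \<le> C2"
  shows "\<forall>u. in_W0 s (Gfun a) \<Omega> u \<longrightarrow>
           (\<forall>\<epsilon>>0. \<exists>\<phi>\<in>C0_infty \<Omega>. norm_W s (Gfun a) UNIV (\<lambda>x. u x - \<phi> x) < \<epsilon>)"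
proof (intro allI impI)
  fix u and \<epsilon> :: real
  assume u: "in_W0 s (Gfun a) \<Omega> u" and \<epsilon>: "0 < \<epsilon>"
  \<comment> \<open>Translation invariance with shift y moves the pair (x, y) to (x - y, 0).\<close>
  define K where "K z t = Gfun a z 0 t" for z t
  have G: "Gfun a x y t = K (x - y) t" if "0 \<le> t" for x y t
    using H2[OF that, of x y y] by (simp add: K_def)
  have mono: "mono_on {0..} (gfun a x y)" for x y
  proof (rule mono_onI)
    fix r t :: real assume rt: "r \<in> {0..}" "t \<in> {0..}" "r \<le> t"
    show "gfun a x y r \<le> gfun a x y t"
    proof (cases "r = 0")
      case True
      then show ?thesis using a_nonneg[of x y t] rt by (simp add: gfun_def)
    next
      case False
      then show ?thesis
        using strict_mono_on_leD[OF g3, of r t x y] rt by (simp add: gfun_def)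
    qed
  qed
  have ratio: "gm \<le> gfun a x y t * t / integral {0..t} (gfun a x y) \<and>
      gfun a x y t * t / integral {0..t} (gfun a x y) \<le> gp" if "0 < t" for x y t
    using g4(3)[OF that, of x y] that by (simp add: gfun_def Gfun_def power2_eq_square mult.assoc)
  have K_eq: "K z t = integral {0..t} (gfun a z 0)" for z t
    by (simp add: K_def Gfun_def)
  have gfun_0: "gfun a x y 0 = 0" for x y by (simp add: gfun_def)
  note Y = young_function_facts[OF gfun_0 gfun_continuous[OF g1(1) g2] mono g4(1,2) ratio]
  interpret young_kernel K s gm gp C2
  proof
    show "\<exists>k'\<in>borel_measurable borel. AE z in lborel. K z t = k' z" for t
    proof (cases "0 \<le> t")
      case True
      have "(\<lambda>(x, y). Gfun a x y t) = (\<lambda>p. K (fst p - snd p) t)"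
        using G[OF True] by (auto simp: fun_eq_iff)
      then show ?thesis
        using Carath[of t] by (intro difference_kernel_AE_borel) simp
    next
      case False
      \<comment> \<open>For negative t the integral runs over an empty interval.\<close>
      then have "K z t = 0" for z by (simp add: K_def Gfun_def)
      then show ?thesis by (intro bexI[of _ "\<lambda>_. 0"]) auto
    qed
    show "K z 1 \<le> C2" for z using Bf(3)[of z 0] by (simp add: K_def)
    show "K z 0 = 0" for z
      unfolding K_eq by (rule Y(1))
    show "convex_on UNIV (\<lambda>t. K z \<bar>t\<bar>)" for z
      unfolding K_eq by (rule Y(2))
    show "K z t \<le> K z t'" if "0 \<le> t" "t \<le> t'" for z t t'
      unfolding K_eq by (rule Y(3)[OF _ that])
    show "0 < K z t" if "0 < t" for z t
      unfolding K_eq by (rule Y(4)[OF _ that])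
    show "K z t' \<le> (t' / t) powr gp * K z t" if "0 < t" "t \<le> t'" for z t t'
      unfolding K_eq by (rule Y(5)[OF _ that])
    show "K z t \<le> (t / t') powr gm * K z t'" if "0 < t" "t \<le> t'" for z t t'
      unfolding K_eq by (rule Y(6)[OF _ that])
  qed (use s g4(1,2) in auto)
  show "\<exists>\<phi>\<in>C0_infty \<Omega>. norm_W s (Gfun a) UNIV (\<lambda>x. u x - \<phi> x) < \<epsilon>"
    by (rule C0_infty_dense[OF \<Omega> G u \<epsilon>])
qed

end
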